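(* For any state $\rho_{ABC}$ on finite-dimensional systems $A,B,C$, $$\Delta(\rho)\ge I(A:C|B)_\rho.$$
   Context: $I(A:C|B)_\rho=S(AB)+S(BC)-S(B)-S(ABC)$ is the quantum conditional mutual information, with $S$ the von Neumann entropy of the respective reduced states. A quantum Markov state on a tripartite system $XYZ$ is a state $\mu_{XYZ}$ for which there exist an orthogonal direct sum decomposition $\mathcal H_Y=\bigoplus_j b_j^L\otimes b_j^R$, a probability distribution $(p_j)$ and states $\mu^{(j)}_{Xb_j^L}$, $\mu^{(j)}_{b_j^RZ}$ with $\mu_{XYZ}=\bigoplus_j p_j\,\mu^{(j)}_{Xb_j^L}\otimes\mu^{(j)}_{b_j^RZ}$. $\Delta(\rho)=\inf D(\rho\|\mu)$, the infimum over all finite-dimensional systems $\widehat A\supseteq A$, $\widehat B\supseteq B$, $\widehat C\supseteq C$ (isometric embeddings, with $\rho$ regarded as a state on $\widehat A\widehat B\widehat C$) and all quantum Markov states $\mu$ on $\widehat A\widehat B\widehat C$, where $D(\rho\|\mu)=\operatorname{tr}\rho(\log\rho-\log\mu)$ is the quantum relative entropy. *)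

theory Defs
  imports Complex_Main "HOL-Library.Extended_Real" "Jordan_Normal_Form.Matrix"
begin

definition cadj :: "complex mat \<Rightarrow> complex mat" where
  "cadj A = mat (dim_col A) (dim_row A) (\<lambda>(i,j). cnj (A $$ (j,i)))"

definition kron :: "complex mat \<Rightarrow> complex mat \<Rightarrow> complex mat" where
  "kron A B = mat (dim_row A * dim_row B) (dim_col A * dim_col B)
     (\<lambda>(i,j). A $$ (i div dim_row B, j div dim_col B) * B $$ (i mod dim_row B, j mod dim_col B))"

definition isometry :: "complex mat \<Rightarrow> bool" where
  "isometry V \<longleftrightarrow> cadj V * V = 1\<^sub>m (dim_col V)"

definition unitary_mat :: "nat \<Rightarrow> complex mat \<Rightarrow> bool" where
  "unitary_mat n U \<longleftrightarrow> U \<in> carrier_mat n n \<and> isometry U"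

definition rdiag :: "nat \<Rightarrow> (nat \<Rightarrow> real) \<Rightarrow> complex mat" where
  "rdiag n f = mat n n (\<lambda>(i,j). if i = j then complex_of_real (f i) else 0)"

definition spectral :: "nat \<Rightarrow> complex mat \<Rightarrow> complex mat \<Rightarrow> (nat \<Rightarrow> real) \<Rightarrow> bool" where
  "spectral n A U lam \<longleftrightarrow> A \<in> carrier_mat n n \<and> unitary_mat n U \<and> A = U * rdiag n lam * cadj U"

definition is_state :: "nat \<Rightarrow> complex mat \<Rightarrow> bool" where
  "is_state n \<rho> \<longleftrightarrow> \<rho> \<in> carrier_mat n n \<and> cadj \<rho> = \<rho> \<and>
     (\<forall>v::nat \<Rightarrow> complex. 0 \<le> Re (\<Sum>i<n. \<Sum>j<n. cnj (v i) * \<rho> $$ (i,j) * v j)) \<and>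
     (\<Sum>i<n. \<rho> $$ (i,i)) = 1"

definition eta :: "real \<Rightarrow> real" where
  "eta x = (if x \<le> 0 then 0 else x * ln x)"

definition vN_entropy :: "complex mat \<Rightarrow> real" where
  "vN_entropy \<rho> = (let n = dim_row \<rho>; (U, lam) = (SOME (U, lam). spectral n \<rho> U lam)
                   in - (\<Sum>i<n. eta (lam i)))"

text \<open>Quantum relative entropy D(rho||mu) = tr rho (log rho - log mu), with value
  +infinity unless supp rho is contained in supp mu.  Writing mu = sum_j m_j |f_j><f_j|,
  tr rho log mu = sum_j q_j log m_j with q_j = <f_j|rho|f_j>.\<close>
definition rel_entropy :: "complex mat \<Rightarrow> complex mat \<Rightarrow> ereal" where
  "rel_entropy \<rho> \<mu> = (let n = dim_row \<mu>; (U, m) = (SOME (U, m). spectral n \<mu> U m);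
       q = (\<lambda>j. Re ((cadj U * \<rho> * U) $$ (j,j)))
     in if (\<exists>j<n. m j = 0 \<and> q j \<noteq> 0) then \<infinity>
        else ereal (- vN_entropy \<rho> - (\<Sum>j\<in>{j. j < n \<and> m j \<noteq> 0}. q j * ln (m j))))"

definition ptrace_right :: "nat \<Rightarrow> nat \<Rightarrow> complex mat \<Rightarrow> complex mat" where
  "ptrace_right d1 d2 \<rho> = mat d1 d1 (\<lambda>(i,j). \<Sum>k<d2. \<rho> $$ (i*d2 + k, j*d2 + k))"

definition ptrace_left :: "nat \<Rightarrow> nat \<Rightarrow> complex mat \<Rightarrow> complex mat" where
  "ptrace_left d1 d2 \<rho> = mat d2 d2 (\<lambda>(i,j). \<Sum>k<d1. \<rho> $$ (k*d2 + i, k*d2 + j))"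

text \<open>Tripartite system ABC with dims a, b, c; index (x*b + y)*c + z.\<close>
definition qCMI :: "nat \<Rightarrow> nat \<Rightarrow> nat \<Rightarrow> complex mat \<Rightarrow> real" where
  "qCMI a b c \<rho> =
     (let \<rho>AB = ptrace_right (a*b) c \<rho>; \<rho>BC = ptrace_left a (b*c) \<rho>; \<rho>B = ptrace_left a b \<rho>AB
      in vN_entropy \<rho>AB + vN_entropy \<rho>BC - vN_entropy \<rho>B - vN_entropy \<rho>)"

text \<open>mu on XYZ (dims x, y, z) is Markov if, for a unitary U on Y whose columns are labelled
  (via the bijection e) by triples (j,l,r) with l < L j, r < R j -- i.e.
  H_Y = (+)_j b_j^L (x) b_j^R with dim b_j^L = L j, dim b_j^R = R j --
  mu = (+)_j p_j sigma_j (x) tau_j with sigma_j a state on X b_j^L, tau_j a state on b_j^R Z.\<close>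
definition markov_state :: "nat \<Rightarrow> nat \<Rightarrow> nat \<Rightarrow> complex mat \<Rightarrow> bool" where
  "markov_state x y z \<mu> \<longleftrightarrow>
    (\<exists>(k::nat) (L::nat \<Rightarrow> nat) (R::nat \<Rightarrow> nat) (e::nat \<Rightarrow> nat \<times> nat \<times> nat) U
       (p::nat \<Rightarrow> real) (\<sigma>::nat \<Rightarrow> complex mat) (\<tau>::nat \<Rightarrow> complex mat).
      bij_betw e {..<y} {(j,l,r). j < k \<and> l < L j \<and> r < R j} \<and>
      unitary_mat y U \<and>
      (\<forall>j<k. 0 \<le> p j) \<and> (\<Sum>j<k. p j) = 1 \<and>
      (\<forall>j<k. is_state (x * L j) (\<sigma> j) \<and> is_state (R j * z) (\<tau> j)) \<and>
      \<mu> = kron (kron (1\<^sub>m x) U) (1\<^sub>m z) *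
          mat (x*y*z) (x*y*z) (\<lambda>(i,i').
            let xi = i div (y*z); yi = (i div z) mod y; zi = i mod z;
                xi' = i' div (y*z); yi' = (i' div z) mod y; zi' = i' mod z;
                (j,l,r) = e yi; (j',l',r') = e yi'
            in if j = j' then complex_of_real (p j) * \<sigma> j $$ (xi * L j + l, xi' * L j + l')
                               * \<tau> j $$ (r * z + zi, r' * z + zi')
               else 0) *
          cadj (kron (kron (1\<^sub>m x) U) (1\<^sub>m z)))"

definition Delta :: "nat \<Rightarrow> nat \<Rightarrow> nat \<Rightarrow> complex mat \<Rightarrow> ereal" where
  "Delta a b c \<rho> = Inf {rel_entropy (kron (kron VA VB) VC * \<rho> * cadj (kron (kron VA VB) VC)) \<mu>
      | a' b' c' VA VB VC \<mu>.
        VA \<in> carrier_mat a' a \<and> VB \<in> carrier_mat b' b \<and> VC \<in> carrier_mat c' c \<and>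
        isometry VA \<and> isometry VB \<and> isometry VC \<and>
        is_state (a'*b'*c') \<mu> \<and> markov_state a' b' c' \<mu>}"

end

theory Submission
  imports Defs "Jordan_Normal_Form.Spectral_Radius"
begin

text \<open>For a Markov state \<open>\<mu>\<close> on \<open>ABC\<close> the logarithm satisfies
  \<open>log \<mu> = log \<mu>AB + log \<mu>BC - log \<mu>B\<close> on its support, so that
  \<open>D(\<rho>||\<mu>) = I(A:C|B) + D(\<rho>AB||\<mu>AB) + D(\<rho>BC||\<mu>BC) - D(\<rho>B||\<mu>B)\<close>. The claim follows since
  \<open>D(\<rho>BC||\<mu>BC) \<ge> 0\<close> (Klein) and \<open>D(\<rho>AB||\<mu>AB) \<ge> D(\<rho>B||\<mu>B)\<close> (monotonicity), and the local
  isometries do not change the entropies. Monotonicity is obtained from the function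
  \<open>H t = (\<Sum>k j. \<bar>\<langle>f j, e k\<rangle>\<bar>\<^sup>2 * r k * ln (s j + t * r k))\<close> of the spectral data of a pair of states:
  its derivative is the maximum of a quadratic functional that can only grow when a subsystem is added,
  and comparing \<open>t = 0\<close> with \<open>t \<rightarrow> \<infinity>\<close> gives the relative entropies.\<close>

section \<open>Orthonormal families and eigen-decompositions of kernels\<close>

text \<open>Operators are kernels on arbitrary finite index sets because the argument regroups
  tensor factors, and on kernels a regrouping such as (x, (j, l, r), z) to (j, (x, l), (r, z)) is
  mere composition with a bijection. Two obstacles shape the rest. The entropies are read off an
  eigenbasis picked by \<open>SOME\<close>, so spectral sums must be independent of that choice,
  even for families that span only the support; this holds for every function vanishing at 0, hence
  for \<open>ln\<close>, as \<open>ln 0 = 0\<close>. And states may be singular: positivity is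
  recovered by dropping zero eigenvalues, which requires a support inclusion that survives partial
  traces; where it fails, the relative entropy is infinite and nothing is left to prove. The
  functional grows with the system because a test operator Y on the small system and 1 tensor Y on
  the large one have the same value. The unitary of the Markov decomposition acts on B alone, so its
  adjoint can be absorbed into the isometry embedding B.\<close>

definition inner_on :: "'i set \<Rightarrow> ('i \<Rightarrow> complex) \<Rightarrow> ('i \<Rightarrow> complex) \<Rightarrow> complex" where
  "inner_on I u v = (\<Sum>i\<in>I. cnj (u i) * v i)"

definition orthonormal :: "'i set \<Rightarrow> 'k set \<Rightarrow> ('k \<Rightarrow> 'i \<Rightarrow> complex) \<Rightarrow> bool" where
  "orthonormal I K u \<longleftrightarrow> (\<forall>k\<in>K. \<forall>l\<in>K. inner_on I (u k) (u l) = (if k = l then 1 else 0))"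

text \<open>Completeness is the resolution of the identity, so \<open>K\<close> is never counted
  against \<open>I\<close> and bijections of the index set preserve the notion.\<close>

definition orthonormal_basis :: "'i set \<Rightarrow> 'k set \<Rightarrow> ('k \<Rightarrow> 'i \<Rightarrow> complex) \<Rightarrow> bool" where
  "orthonormal_basis I K u \<longleftrightarrow> orthonormal I K u \<and>
    (\<forall>i\<in>I. \<forall>j\<in>I. (\<Sum>k\<in>K. u k i * cnj (u k j)) = (if i = j then 1 else 0))"

text \<open>The family need not be complete, so that an isometry maps eigen-decompositions to
  eigen-decompositions with the same eigenvalues.\<close>

definition has_dec ::
    "'i set \<Rightarrow> 'k set \<Rightarrow> ('k \<Rightarrow> 'i \<Rightarrow> complex) \<Rightarrow> ('k \<Rightarrow> real) \<Rightarrow> ('i \<Rightarrow> 'i \<Rightarrow> complex) \<Rightarrow> bool" where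
  "has_dec I K u lam M \<longleftrightarrow> orthonormal I K u \<and>
    (\<forall>i\<in>I. \<forall>j\<in>I. M i j = (\<Sum>k\<in>K. of_real (lam k) * u k i * cnj (u k j)))"

definition quad :: "'i set \<Rightarrow> ('i \<Rightarrow> 'i \<Rightarrow> complex) \<Rightarrow> ('i \<Rightarrow> complex) \<Rightarrow> complex" where
  "quad I M v = (\<Sum>i\<in>I. \<Sum>j\<in>I. cnj (v i) * M i j * v j)"

lemma orthonormalD: "orthonormal I K u \<Longrightarrow> k \<in> K \<Longrightarrow> l \<in> K \<Longrightarrow> inner_on I (u k) (u l) = (if k = l then 1 else 0)"
  by (simp add: orthonormal_def)

lemma basis_orthonormal: "orthonormal_basis I K u \<Longrightarrow> orthonormal I K u"
  by (simp add: orthonormal_basis_def)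

lemma has_dec_orthonormal: "has_dec I K u lam M \<Longrightarrow> orthonormal I K u"
  by (simp add: has_dec_def)

lemma has_decD: "has_dec I K u lam M \<Longrightarrow> i \<in> I \<Longrightarrow> j \<in> I \<Longrightarrow>
    M i j = (\<Sum>k\<in>K. of_real (lam k) * u k i * cnj (u k j))"
  by (simp add: has_dec_def)

lemma inner_on_cnj: "cnj (inner_on I u v) = inner_on I v u"
  by (simp add: inner_on_def mult.commute)

lemma inner_on_self: "inner_on I v v = of_real (\<Sum>i\<in>I. (cmod (v i))\<^sup>2)"
  by (simp add: inner_on_def complex_norm_square[symmetric] mult.commute)

lemma inner_on_sum_right: "inner_on I u (\<lambda>i. \<Sum>k\<in>K. c k * v k i) = (\<Sum>k\<in>K. c k * inner_on I u (v k))"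
proof -
  have "inner_on I u (\<lambda>i. \<Sum>k\<in>K. c k * v k i) = (\<Sum>i\<in>I. \<Sum>k\<in>K. c k * (cnj (u i) * v k i))"
    by (simp add: inner_on_def sum_distrib_left mult_ac)
  also have "\<dots> = (\<Sum>k\<in>K. c k * inner_on I u (v k))"
    by (subst sum.swap) (simp add: inner_on_def sum_distrib_left)
  finally show ?thesis .
qed

lemma inner_on_cong: "(\<And>i. i \<in> I \<Longrightarrow> u i = u' i) \<Longrightarrow> (\<And>i. i \<in> I \<Longrightarrow> v i = v' i) \<Longrightarrow> inner_on I u v = inner_on I u' v'"
  by (simp add: inner_on_def)

lemma orthonormal_basis_expand:
  assumes "finite I" "orthonormal_basis I K u" "i \<in> I"
  shows "(\<Sum>k\<in>K. inner_on I (u k) v * u k i) = v i"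
proof -
  have "(\<Sum>k\<in>K. inner_on I (u k) v * u k i) = (\<Sum>j\<in>I. v j * (\<Sum>k\<in>K. u k i * cnj (u k j)))"
    unfolding inner_on_def sum_distrib_left sum_distrib_right
    by (subst sum.swap) (simp add: mult_ac)
  also have "\<dots> = (\<Sum>j\<in>I. v j * (if i = j then 1 else 0))"
    using assms by (intro sum.cong) (auto simp: orthonormal_basis_def)
  also have "\<dots> = v i" using assms by (simp add: if_distrib cong: if_cong)
  finally show ?thesis .
qed

text \<open>With \<open>w\<close> the projection of \<open>v\<close> onto the span of the family,
  the inner products of \<open>w\<close> with \<open>v\<close> and with itself both equal the sum on
  the left, so the squared norm of \<open>v - w\<close> is the difference of the two sides.\<close>

lemma bessel:
  assumes fin: "finite K" and on: "orthonormal I K u"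
  shows "(\<Sum>k\<in>K. (cmod (inner_on I (u k) v))\<^sup>2) \<le> (\<Sum>i\<in>I. (cmod (v i))\<^sup>2)"
proof -
  define w where "w = (\<lambda>i. \<Sum>k\<in>K. inner_on I (u k) v * u k i)"
  have uw: "inner_on I (u k) w = inner_on I (u k) v" if "k \<in> K" for k
  proof -
    have "inner_on I (u k) w = (\<Sum>l\<in>K. inner_on I (u l) v * (if k = l then 1 else 0))"
      unfolding w_def inner_on_sum_right using on that by (intro sum.cong) (auto simp: orthonormalD)
    then show ?thesis using that fin by (simp add: if_distrib cong: if_cong)
  qed
  have vw: "inner_on I x w = (\<Sum>k\<in>K. inner_on I (u k) v * inner_on I x (u k))" for x
    unfolding w_def inner_on_sum_right ..
  have S: "(\<Sum>k\<in>K. of_real ((cmod (inner_on I (u k) v))\<^sup>2)) = inner_on I v w"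
    unfolding vw by (intro sum.cong refl) (simp only: inner_on_cnj[of I "u _" v, symmetric] complex_norm_square)
  have ww: "inner_on I w w = inner_on I v w"
    unfolding vw[of w] vw[of v]
    by (intro sum.cong refl) (simp add: inner_on_cnj[of _ "u _", symmetric] uw)
  have "inner_on I (\<lambda>i. v i - w i) (\<lambda>i. v i - w i) = inner_on I v v - inner_on I v w - cnj (inner_on I v w) + inner_on I w w"
    by (simp only: inner_on_cnj) (simp add: inner_on_def algebra_simps sum.distrib sum_subtractf)
  also have "\<dots> = inner_on I v v - cnj (inner_on I v w)" by (simp add: ww)
  also have "cnj (inner_on I v w) = (\<Sum>k\<in>K. of_real ((cmod (inner_on I (u k) v))\<^sup>2))"
    by (simp add: S[symmetric])
  finally have "complex_of_real (\<Sum>i\<in>I. (cmod (v i - w i))\<^sup>2) =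
      of_real ((\<Sum>i\<in>I. (cmod (v i))\<^sup>2) - (\<Sum>k\<in>K. (cmod (inner_on I (u k) v))\<^sup>2))"
    unfolding inner_on_self by simp
  then have "(\<Sum>i\<in>I. (cmod (v i - w i))\<^sup>2) =
      (\<Sum>i\<in>I. (cmod (v i))\<^sup>2) - (\<Sum>k\<in>K. (cmod (inner_on I (u k) v))\<^sup>2)"
    by (simp only: of_real_eq_iff)
  moreover have "0 \<le> (\<Sum>i\<in>I. (cmod (v i - w i))\<^sup>2)" by (intro sum_nonneg) auto
  ultimately show ?thesis by linarith
qed

lemma parseval:
  assumes fin: "finite I" and on: "orthonormal_basis I K u"
  shows "(\<Sum>k\<in>K. (cmod (inner_on I (u k) v))\<^sup>2) = (\<Sum>i\<in>I. (cmod (v i))\<^sup>2)"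
proof -
  have "inner_on I v v = inner_on I v (\<lambda>i. \<Sum>k\<in>K. inner_on I (u k) v * u k i)"
    by (rule inner_on_cong) (simp_all add: orthonormal_basis_expand[OF fin on])
  also have "\<dots> = (\<Sum>k\<in>K. of_real ((cmod (inner_on I (u k) v))\<^sup>2))"
    unfolding inner_on_sum_right
    by (intro sum.cong refl) (simp only: inner_on_cnj[of I "u _" v, symmetric] complex_norm_square)
  finally have "complex_of_real (\<Sum>i\<in>I. (cmod (v i))\<^sup>2) = of_real (\<Sum>k\<in>K. (cmod (inner_on I (u k) v))\<^sup>2)"
    by (simp add: inner_on_self)
  then show ?thesis by (simp only: of_real_eq_iff)
qed

section \<open>Eigen-decompositions and functions of a kernel\<close>

lemma dec_apply:
  assumes "has_dec I K u lam M" "i \<in> I"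
  shows "(\<Sum>j\<in>I. M i j * v j) = (\<Sum>k\<in>K. of_real (lam k) * inner_on I (u k) v * u k i)"
proof -
  have "(\<Sum>j\<in>I. M i j * v j) = (\<Sum>j\<in>I. \<Sum>k\<in>K. of_real (lam k) * (cnj (u k j) * v j) * u k i)"
    using assms by (intro sum.cong) (auto simp: has_decD sum_distrib_left sum_distrib_right mult_ac)
  also have "\<dots> = (\<Sum>k\<in>K. of_real (lam k) * inner_on I (u k) v * u k i)"
    by (subst sum.swap) (simp add: inner_on_def sum_distrib_left sum_distrib_right)
  finally show ?thesis .
qed

lemma dec_eigvec:
  assumes "finite K" "has_dec I K u lam M" "i \<in> I" "k \<in> K"
  shows "(\<Sum>j\<in>I. M i j * u k j) = of_real (lam k) * u k i"
proof -
  have "(\<Sum>j\<in>I. M i j * u k j) = (\<Sum>l\<in>K. of_real (lam l) * (if l = k then 1 else 0) * u l i)"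
    unfolding dec_apply[OF assms(2,3)] using assms
    by (intro sum.cong refl) (auto simp: has_dec_def orthonormal_def)
  also have "\<dots> = (\<Sum>l\<in>K. if l = k then of_real (lam k) * u k i else 0)"
    by (intro sum.cong) auto
  finally show ?thesis using assms by simp
qed

lemma dec_quad:
  assumes "has_dec I K u lam M"
  shows "quad I M v = of_real (\<Sum>k\<in>K. lam k * (cmod (inner_on I (u k) v))\<^sup>2)"
proof -
  have "quad I M v = (\<Sum>i\<in>I. cnj (v i) * (\<Sum>j\<in>I. M i j * v j))"
    by (simp add: quad_def sum_distrib_left mult_ac)
  also have "\<dots> = inner_on I v (\<lambda>i. \<Sum>k\<in>K. of_real (lam k) * inner_on I (u k) v * u k i)"
    by (simp add: inner_on_def dec_apply[OF assms])
  also have "\<dots> = (\<Sum>k\<in>K. of_real (lam k) * inner_on I (u k) v * inner_on I v (u k))"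
    by (rule inner_on_sum_right)
  also have "\<dots> = (\<Sum>k\<in>K. of_real (lam k * (cmod (inner_on I (u k) v))\<^sup>2))"
    by (intro sum.cong refl)
       (simp add: complex_norm_square inner_on_cnj del: of_real_power)
  finally show ?thesis by simp
qed

lemma dec_quad_eigvec:
  assumes "finite K" "has_dec I K u lam M" "k \<in> K"
  shows "quad I M (u k) = of_real (lam k)"
proof -
  have "quad I M (u k) = of_real (\<Sum>l\<in>K. if l = k then lam k else 0)"
    unfolding dec_quad[OF assms(2)] using assms
    by (intro arg_cong[where f=of_real] sum.cong) (auto simp: has_dec_def orthonormal_def)
  then show ?thesis using assms by simp
qed

lemma dec_trace:
  assumes "has_dec I K u lam M"
  shows "(\<Sum>i\<in>I. M i i) = of_real (\<Sum>k\<in>K. lam k)"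
proof -
  have "(\<Sum>i\<in>I. M i i) = (\<Sum>i\<in>I. \<Sum>k\<in>K. of_real (lam k) * (cnj (u k i) * u k i))"
    using assms by (intro sum.cong) (auto simp: has_decD mult_ac)
  also have "\<dots> = (\<Sum>k\<in>K. of_real (lam k) * inner_on I (u k) (u k))"
    by (subst sum.swap) (simp add: inner_on_def sum_distrib_left)
  also have "\<dots> = (\<Sum>k\<in>K. of_real (lam k))"
    using assms by (intro sum.cong) (auto simp: has_dec_def orthonormal_def)
  finally show ?thesis by simp
qed

text \<open>The kernel \<phi>(M) does not depend on the decomposition. The overlap of two
  eigenvectors vanishes unless their eigenvalues agree, so \<phi> may be evaluated on either side of
  an overlap; eigenvectors with nonzero eigenvalue expand in the other family, and the remaining
  ones, which may lie outside its span, are removed by \<open>\<phi> 0 = 0\<close>.\<close>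

lemma dec_fun:
  assumes fin: "finite K" "finite K'"
    and d: "has_dec I K u lam M" and d': "has_dec I K' u' lam' M"
    and phi: "\<phi> 0 = (0::real)"
    and ij: "i \<in> I" "j \<in> I"
  shows "(\<Sum>k\<in>K. of_real (\<phi> (lam k)) * u k i * cnj (u k j)) =
         (\<Sum>k\<in>K'. of_real (\<phi> (lam' k)) * u' k i * cnj (u' k j))"
proof -
  define W where "W = (\<lambda>k' k. inner_on I (u' k') (u k))"
  \<comment> \<open>Both sides are the inner product of \<open>u' k'\<close> with M applied to
    \<open>u k\<close>.\<close>
  have eig: "of_real (lam' k') * W k' k = of_real (lam k) * W k' k" if k: "k \<in> K" "k' \<in> K'" for k k'
  proof -
    have "of_real (lam k) * W k' k = inner_on I (u' k') (\<lambda>i. of_real (lam k) * u k i)"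
      by (simp add: W_def inner_on_def sum_distrib_left mult_ac)
    also have "\<dots> = inner_on I (u' k') (\<lambda>i. \<Sum>l\<in>K'. of_real (lam' l) * W l k * u' l i)"
      by (rule inner_on_cong) (simp_all add: W_def dec_eigvec[OF fin(1) d _ k(1), symmetric] dec_apply[OF d'])
    also have "\<dots> = (\<Sum>l\<in>K'. of_real (lam' l) * W l k * (if k' = l then 1 else 0))"
      unfolding inner_on_sum_right using has_dec_orthonormal[OF d'] k by (intro sum.cong) (auto simp: orthonormalD)
    finally have "of_real (lam k) * W k' k = of_real (lam' k') * W k' k"
      using fin k by (simp add: if_distrib cong: if_cong)
    then show ?thesis ..
  qed
  have ph: "of_real (\<phi> (lam' k')) * W k' k = of_real (\<phi> (lam k)) * W k' k" if "k \<in> K" "k' \<in> K'" for k k'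
    using eig[OF that] by auto
  have ex: "of_real (\<phi> (lam k)) * u k i = (\<Sum>k'\<in>K'. of_real (\<phi> (lam k)) * W k' k * u' k' i)"
    if k: "k \<in> K" and i: "i \<in> I" for k i
  proof (cases "lam k = 0")
    case False
    have "of_real (lam k) * u k i = (\<Sum>k'\<in>K'. of_real (lam' k') * W k' k * u' k' i)"
      unfolding W_def dec_apply[OF d' i, symmetric] dec_eigvec[OF fin(1) d i k] ..
    also have "\<dots> = of_real (lam k) * (\<Sum>k'\<in>K'. W k' k * u' k' i)"
      using k by (simp add: eig sum_distrib_left mult_ac)
    finally have "u k i = (\<Sum>k'\<in>K'. W k' k * u' k' i)" using False by simp
    from arg_cong[OF this, of "\<lambda>z. of_real (\<phi> (lam k)) * z"] show ?thesis
      by (simp add: sum_distrib_left mult_ac)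
  qed (simp add: phi)
  have ex': "of_real (\<phi> (lam' k')) * u' k' i = (\<Sum>k\<in>K. of_real (\<phi> (lam' k')) * cnj (W k' k) * u k i)"
    if k': "k' \<in> K'" and i: "i \<in> I" for k' i
  proof (cases "lam' k' = 0")
    case False
    have c: "inner_on I (u k) (u' k') = cnj (W k' k)" for k by (simp add: W_def inner_on_cnj)
    have e: "of_real (lam' k') * cnj (W k' k) = of_real (lam k) * cnj (W k' k)" if "k \<in> K" for k
      using arg_cong[OF eig[OF that k'], of cnj] by simp
    have "of_real (lam' k') * u' k' i = (\<Sum>k\<in>K. of_real (lam k) * cnj (W k' k) * u k i)"
      unfolding c[symmetric] dec_apply[OF d i, symmetric] dec_eigvec[OF fin(2) d' i k'] ..
    also have "\<dots> = of_real (lam' k') * (\<Sum>k\<in>K. cnj (W k' k) * u k i)"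
      by (simp add: e[symmetric] sum_distrib_left mult_ac)
    finally have "u' k' i = (\<Sum>k\<in>K. cnj (W k' k) * u k i)" using False by simp
    from arg_cong[OF this, of "\<lambda>z. of_real (\<phi> (lam' k')) * z"] show ?thesis
      by (simp add: sum_distrib_left mult_ac)
  qed (simp add: phi)
  have "(\<Sum>k\<in>K. of_real (\<phi> (lam k)) * u k i * cnj (u k j)) =
      (\<Sum>k\<in>K. \<Sum>k'\<in>K'. of_real (\<phi> (lam' k')) * W k' k * u' k' i * cnj (u k j))"
    using ij by (simp add: ex ph sum_distrib_right)
  also have "\<dots> = (\<Sum>k'\<in>K'. u' k' i * cnj (\<Sum>k\<in>K. of_real (\<phi> (lam' k')) * cnj (W k' k) * u k j))"
    by (subst sum.swap) (simp add: sum_distrib_left mult_ac)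
  also have "\<dots> = (\<Sum>k\<in>K'. of_real (\<phi> (lam' k)) * u' k i * cnj (u' k j))"
  proof (intro sum.cong refl)
    fix k' assume k': "k' \<in> K'"
    show "u' k' i * cnj (\<Sum>k\<in>K. of_real (\<phi> (lam' k')) * cnj (W k' k) * u k j) =
        of_real (\<phi> (lam' k')) * u' k' i * cnj (u' k' j)"
      unfolding ex'[OF k' ij(2), symmetric] by (simp add: mult_ac)
  qed
  finally show ?thesis .
qed

text \<open>Both sums are the trace of \<phi>(M). With \<phi> = \<open>eta\<close> this frees the
  entropy from the eigenbasis that \<open>SOME\<close> selects.\<close>

lemma dec_sum_fun:
  assumes fin: "finite K" "finite K'"
    and d: "has_dec I K u lam M" and d': "has_dec I K' u' lam' M" and phi: "\<phi> 0 = (0::real)"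
  shows "(\<Sum>k\<in>K. \<phi> (lam k)) = (\<Sum>k\<in>K'. \<phi> (lam' k))"
proof -
  define N where "N = (\<lambda>i j. \<Sum>k\<in>K. of_real (\<phi> (lam k)) * u k i * cnj (u k j))"
  have 1: "has_dec I K u (\<lambda>k. \<phi> (lam k)) N"
    using d by (auto simp: has_dec_def N_def)
  have 2: "has_dec I K' u' (\<lambda>k. \<phi> (lam' k)) N"
    using d' dec_fun[where \<phi>=\<phi>, OF assms] by (auto simp: has_dec_def N_def)
  show ?thesis using dec_trace[OF 1] dec_trace[OF 2] by (simp only: of_real_eq_iff)
qed

text \<open>Both sides are the trace of M times the operator with vectors \<open>u k\<close> and
  weights \<open>c k\<close>; in the form on the right, a change of decomposition only touches the
  inner sum.\<close>

lemma quad_weighted_sum: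
  "(\<Sum>k\<in>K. c k * quad I M (u k)) = (\<Sum>i\<in>I. \<Sum>j\<in>I. M i j * (\<Sum>k\<in>K. c k * u k j * cnj (u k i)))"
proof -
  have "(\<Sum>k\<in>K. c k * quad I M (u k)) =
      (\<Sum>k\<in>K. \<Sum>i\<in>I. \<Sum>j\<in>I. M i j * (c k * u k j * cnj (u k i)))"
    by (simp add: quad_def sum_distrib_left mult_ac)
  also have "\<dots> = (\<Sum>i\<in>I. \<Sum>k\<in>K. \<Sum>j\<in>I. M i j * (c k * u k j * cnj (u k i)))"
    by (rule sum.swap)
  also have "\<dots> = (\<Sum>i\<in>I. \<Sum>j\<in>I. \<Sum>k\<in>K. M i j * (c k * u k j * cnj (u k i)))"
    by (intro sum.cong refl sum.swap)
  finally show ?thesis by (simp add: sum_distrib_left)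
qed

text \<open>Both sides are the trace of R \<phi>(M). With \<phi> = \<open>ln\<close> this exchanges
  an arbitrary eigenbasis of the Markov state for one of product vectors, where the logarithm
  splits.\<close>

lemma dec_cross_fun:
  assumes fin: "finite K" "finite K'"
    and d: "has_dec I K u lam M" and d': "has_dec I K' u' lam' M" and phi: "\<phi> 0 = (0::real)"
  shows "(\<Sum>k\<in>K. of_real (\<phi> (lam k)) * quad I R (u k)) = (\<Sum>k\<in>K'. of_real (\<phi> (lam' k)) * quad I R (u' k))"
  unfolding quad_weighted_sum
  by (intro sum.cong refl arg_cong2[where f="(*)"] dec_fun[where \<phi>=\<phi>, OF assms])

section \<open>Isometric images and relabelled index sets\<close>

definition lift :: "'i set \<Rightarrow> ('i \<Rightarrow> 'p \<Rightarrow> complex) \<Rightarrow> ('i \<Rightarrow> complex) \<Rightarrow> 'p \<Rightarrow> complex" where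
  "lift I W f p = (\<Sum>i\<in>I. f i * W i p)"

text \<open>The vectors \<open>W i\<close> are the columns of a linear map; this is M conjugated by
  that map, and \<open>lift\<close> is the map itself.\<close>

definition conj_by :: "'i set \<Rightarrow> ('i \<Rightarrow> 'p \<Rightarrow> complex) \<Rightarrow> ('i \<Rightarrow> 'i \<Rightarrow> complex) \<Rightarrow> 'p \<Rightarrow> 'p \<Rightarrow> complex" where
  "conj_by I W M p q = (\<Sum>i\<in>I. \<Sum>j\<in>I. W i p * M i j * cnj (W j q))"

lemma inner_on_lift:
  assumes "finite I" "orthonormal P I W"
  shows "inner_on P (lift I W f) (lift I W g) = inner_on I f g"
proof -
  have "inner_on P (lift I W f) (lift I W g) = (\<Sum>j\<in>I. g j * inner_on P (lift I W f) (W j))"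
    unfolding lift_def[of _ _ g] by (rule inner_on_sum_right)
  also have "\<dots> = (\<Sum>j\<in>I. g j * cnj (inner_on P (W j) (lift I W f)))"
    by (simp add: inner_on_cnj)
  also have "\<dots> = (\<Sum>j\<in>I. g j * cnj (f j))"
  proof (intro sum.cong refl)
    fix j assume j: "j \<in> I"
    have "inner_on P (W j) (lift I W f) = (\<Sum>i\<in>I. f i * (if j = i then 1 else 0))"
      unfolding lift_def inner_on_sum_right using assms j by (intro sum.cong) (auto simp: orthonormalD)
    also have "\<dots> = f j" using assms j by (simp add: if_distrib cong: if_cong)
    finally show "g j * cnj (inner_on P (W j) (lift I W f)) = g j * cnj (f j)" by simp
  qed
  finally show ?thesis by (simp add: inner_on_def mult.commute)
qed

lemma sum_prod_cnj:
  "(\<Sum>k\<in>K. c k * (\<Sum>i\<in>I. f k i) * cnj (\<Sum>j\<in>J. g k j)) =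
   (\<Sum>i\<in>I. \<Sum>j\<in>J. \<Sum>k\<in>K. c k * f k i * cnj (g k j))"
proof -
  have "(\<Sum>k\<in>K. c k * (\<Sum>i\<in>I. f k i) * cnj (\<Sum>j\<in>J. g k j)) =
      (\<Sum>k\<in>K. \<Sum>i\<in>I. \<Sum>j\<in>J. c k * f k i * cnj (g k j))"
    by (simp add: sum_distrib_left sum_distrib_right) (intro sum.cong refl sum.swap)
  also have "\<dots> = (\<Sum>i\<in>I. \<Sum>k\<in>K. \<Sum>j\<in>J. c k * f k i * cnj (g k j))"
    by (rule sum.swap)
  also have "\<dots> = (\<Sum>i\<in>I. \<Sum>j\<in>J. \<Sum>k\<in>K. c k * f k i * cnj (g k j))"
    by (intro sum.cong refl sum.swap)
  finally show ?thesis .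
qed

lemma dec_lift:
  assumes fin: "finite I" and W: "orthonormal P I W" and d: "has_dec I K u lam M"
  shows "has_dec P K (\<lambda>k. lift I W (u k)) lam (conj_by I W M)"
  unfolding has_dec_def
proof (intro conjI ballI)
  show "orthonormal P K (\<lambda>k. lift I W (u k))"
    using has_dec_orthonormal[OF d] unfolding orthonormal_def by (simp add: inner_on_lift[OF fin W])
  fix p q assume "p \<in> P" "q \<in> P"
  have "(\<Sum>k\<in>K. of_real (lam k) * lift I W (u k) p * cnj (lift I W (u k) q)) =
    (\<Sum>i\<in>I. \<Sum>j\<in>I. \<Sum>k\<in>K. of_real (lam k) * (u k i * W i p) * cnj (u k j * W j q))"
    unfolding lift_def by (rule sum_prod_cnj)
  also have "\<dots> = conj_by I W M p q"
    unfolding conj_by_def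
    by (intro sum.cong refl) (simp add: has_decD[OF d] sum_distrib_left sum_distrib_right mult_ac)
  finally show "conj_by I W M p q = (\<Sum>k\<in>K. of_real (lam k) * lift I W (u k) p * cnj (lift I W (u k) q))" ..
qed

lemma orthonormal_basis_lift:
  assumes fin: "finite I" and W: "orthonormal_basis P I W" and u: "orthonormal_basis I K u"
  shows "orthonormal_basis P K (\<lambda>k. lift I W (u k))"
  unfolding orthonormal_basis_def
proof (intro conjI ballI)
  show "orthonormal P K (\<lambda>k. lift I W (u k))"
    using u unfolding orthonormal_basis_def orthonormal_def by (simp add: inner_on_lift[OF fin basis_orthonormal[OF W]])
  fix p q assume pq: "p \<in> P" "q \<in> P"
  have "(\<Sum>k\<in>K. 1 * lift I W (u k) p * cnj (lift I W (u k) q)) =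
    (\<Sum>i\<in>I. \<Sum>j\<in>I. \<Sum>k\<in>K. 1 * (u k i * W i p) * cnj (u k j * W j q))"
    unfolding lift_def by (rule sum_prod_cnj)
  also have "\<dots> = (\<Sum>i\<in>I. \<Sum>j\<in>I. W i p * cnj (W j q) * (\<Sum>k\<in>K. u k i * cnj (u k j)))"
    by (simp add: sum_distrib_left mult_ac)
  also have "\<dots> = (\<Sum>i\<in>I. \<Sum>j\<in>I. W i p * cnj (W j q) * (if i = j then 1 else 0))"
    using u by (intro sum.cong refl) (auto simp: orthonormal_basis_def)
  also have "\<dots> = (\<Sum>i\<in>I. W i p * cnj (W i q))"
    using fin by (simp add: if_distrib cong: if_cong)
  also have "\<dots> = (if p = q then 1 else 0)" using W pq by (simp add: orthonormal_basis_def)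
  finally show "(\<Sum>k\<in>K. lift I W (u k) p * cnj (lift I W (u k) q)) = (if p = q then 1 else 0)" by simp
qed

lemma inner_on_reindex: "bij_betw h P I \<Longrightarrow> inner_on P (\<lambda>p. f (h p)) (\<lambda>p. g (h p)) = inner_on I f g"
  unfolding inner_on_def by (rule sum.reindex_bij_betw)

lemma orthonormal_reindex: "bij_betw h P I \<Longrightarrow> orthonormal I K u \<Longrightarrow> orthonormal P K (\<lambda>k p. u k (h p))"
  by (simp add: orthonormal_def inner_on_reindex)

lemma dec_reindex:
  assumes h: "bij_betw h P I" and d: "has_dec I K u lam M"
    and N: "\<And>p q. p \<in> P \<Longrightarrow> q \<in> P \<Longrightarrow> N p q = M (h p) (h q)"
  shows "has_dec P K (\<lambda>k p. u k (h p)) lam N"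
  using d bij_betwE[OF h] by (auto simp: has_dec_def orthonormal_reindex[OF h] N)

lemma orthonormal_basis_reindex:
  assumes h: "bij_betw h P I" and u: "orthonormal_basis I K u"
  shows "orthonormal_basis P K (\<lambda>k p. u k (h p))"
  using u bij_betwE[OF h] bij_betw_imp_inj_on[OF h]
  by (auto simp: orthonormal_basis_def orthonormal_reindex[OF h] inj_on_def)

lemma quad_reindex:
  assumes h: "bij_betw h P I"
  shows "quad P (\<lambda>p q. M (h p) (h q)) (\<lambda>p. v (h p)) = quad I M v"
proof -
  have "quad P (\<lambda>p q. M (h p) (h q)) (\<lambda>p. v (h p)) =
      (\<Sum>p\<in>P. \<Sum>j\<in>I. cnj (v (h p)) * M (h p) j * v j)"
    unfolding quad_def by (intro sum.cong refl sum.reindex_bij_betw[OF h])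
  also have "\<dots> = quad I M v"
    unfolding quad_def by (rule sum.reindex_bij_betw[OF h])
  finally show ?thesis .
qed


section \<open>Monotonicity of relative entropy under partial trace\<close>

definition ptrace_fst :: "'a set \<Rightarrow> ('a \<times> 'b \<Rightarrow> 'a \<times> 'b \<Rightarrow> complex) \<Rightarrow> 'b \<Rightarrow> 'b \<Rightarrow> complex" where
  "ptrace_fst A M b b' = (\<Sum>a\<in>A. M (a, b) (a, b'))"

definition trace_prod :: "'i set \<Rightarrow> ('i \<Rightarrow> 'i \<Rightarrow> complex) \<Rightarrow> ('i \<Rightarrow> 'i \<Rightarrow> complex) \<Rightarrow> complex" where
  "trace_prod I R X = (\<Sum>i\<in>I. \<Sum>j\<in>I. R i j * X j i)"

text \<open>The kernel of the adjoint of X times X; on \<open>adj_ker X\<close> it becomes X times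
  its adjoint. \<open>var_fun\<close> needs the product in both orders.\<close>

definition gram :: "'i set \<Rightarrow> ('i \<Rightarrow> 'i \<Rightarrow> complex) \<Rightarrow> 'i \<Rightarrow> 'i \<Rightarrow> complex" where
  "gram I X i j = (\<Sum>m\<in>I. cnj (X m i) * X m j)"

definition adj_ker :: "('i \<Rightarrow> 'i \<Rightarrow> complex) \<Rightarrow> 'i \<Rightarrow> 'i \<Rightarrow> complex" where
  "adj_ker X i j = cnj (X j i)"

text \<open>For spectral data of \<open>R\<close> and \<open>S\<close> with positive eigenvalues, the maximum of this quadratic
  functional over \<open>X\<close> is
  \<open>F t = (\<Sum>k j. \<bar>\<langle>f j, e k\<rangle>\<bar>\<^sup>2 * r k\<^sup>2 / (s j + t * r k))\<close>, and the relative entropy is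
  the integral of \<open>F t - 1 / (1 + t)\<close> over \<open>t > 0\<close>.\<close>

definition var_fun :: "'i set \<Rightarrow> real \<Rightarrow> ('i \<Rightarrow> 'i \<Rightarrow> complex) \<Rightarrow> ('i \<Rightarrow> 'i \<Rightarrow> complex) \<Rightarrow>
    ('i \<Rightarrow> 'i \<Rightarrow> complex) \<Rightarrow> real" where
  "var_fun I t R S X =
     2 * Re (trace_prod I R X) - Re (trace_prod I S (gram I (adj_ker X))) - t * Re (trace_prod I R (gram I X))"

lemma dec_trace_prod:
  assumes d: "has_dec I K u lam M"
  shows "trace_prod I M X = (\<Sum>k\<in>K. of_real (lam k) * quad I X (u k))"
proof -
  have "trace_prod I M X = (\<Sum>i\<in>I. \<Sum>j\<in>I. X j i * (\<Sum>k\<in>K. of_real (lam k) * u k i * cnj (u k j)))"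
    unfolding trace_prod_def by (intro sum.cong refl) (simp add: has_decD[OF d] mult.commute)
  also have "\<dots> = (\<Sum>j\<in>I. \<Sum>i\<in>I. X j i * (\<Sum>k\<in>K. of_real (lam k) * u k i * cnj (u k j)))"
    by (rule sum.swap)
  also have "\<dots> = (\<Sum>k\<in>K. of_real (lam k) * quad I X (u k))"
    by (rule quad_weighted_sum[symmetric])
  finally show ?thesis .
qed

lemma quad_gram: "quad I (gram I X) v = of_real (\<Sum>m\<in>I. (cmod (\<Sum>i\<in>I. X m i * v i))\<^sup>2)"
proof -
  have "of_real (\<Sum>m\<in>I. (cmod (\<Sum>i\<in>I. X m i * v i))\<^sup>2) =
      (\<Sum>m\<in>I. 1 * (\<Sum>j\<in>I. X m j * v j) * cnj (\<Sum>i\<in>I. X m i * v i))"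
    by (simp only: of_real_sum complex_norm_square mult_1)
  also have "\<dots> = (\<Sum>j\<in>I. \<Sum>i\<in>I. \<Sum>m\<in>I. 1 * (X m j * v j) * cnj (X m i * v i))"
    by (rule sum_prod_cnj)
  also have "\<dots> = (\<Sum>i\<in>I. \<Sum>j\<in>I. \<Sum>m\<in>I. 1 * (X m j * v j) * cnj (X m i * v i))"
    by (rule sum.swap)
  also have "\<dots> = quad I (gram I X) v"
    unfolding quad_def gram_def by (simp add: sum_distrib_left sum_distrib_right mult_ac)
  finally show ?thesis ..
qed

lemma var_fun_dec:
  assumes r: "has_dec I K e r R" and s: "has_dec I J f s S"
  shows "var_fun I t R S X = 2 * (\<Sum>k\<in>K. r k * Re (quad I X (e k)))
     - (\<Sum>j\<in>J. s j * (\<Sum>m\<in>I. (cmod (\<Sum>i\<in>I. cnj (X i m) * f j i))\<^sup>2))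
     - t * (\<Sum>k\<in>K. r k * (\<Sum>m\<in>I. (cmod (\<Sum>i\<in>I. X m i * e k i))\<^sup>2))"
  unfolding var_fun_def dec_trace_prod[OF r] dec_trace_prod[OF s] quad_gram adj_ker_def by simp

text \<open>Moves X to the other side, so that matrix elements of X can be bounded both through X
  applied to \<open>e\<close> and through its adjoint applied to \<open>f\<close>.\<close>

lemma mat_elem:
  "inner_on I f (\<lambda>m. \<Sum>i\<in>I. X m i * e i) = cnj (inner_on I e (\<lambda>m. \<Sum>i\<in>I. cnj (X i m) * f i))"
proof -
  have "inner_on I f (\<lambda>m. \<Sum>i\<in>I. X m i * e i) = (\<Sum>m\<in>I. \<Sum>i\<in>I. cnj (f m) * X m i * e i)"
    by (simp add: inner_on_def sum_distrib_left mult_ac)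
  also have "\<dots> = (\<Sum>i\<in>I. \<Sum>m\<in>I. cnj (f m) * X m i * e i)" by (rule sum.swap)
  also have "\<dots> = cnj (inner_on I e (\<lambda>m. \<Sum>i\<in>I. cnj (X i m) * f i))"
    by (simp add: inner_on_def sum_distrib_left mult_ac)
  finally show ?thesis .
qed

text \<open>The parabola in x has its vertex at x = r w / c; the defect is the squared modulus of
  \<open>of_real r * w - of_real c * x\<close> divided by c.\<close>

lemma complete_square:
  fixes w x :: complex and c r :: real
  assumes "c > 0"
  shows "2 * (r * Re (cnj w * x)) - c * (cmod x)\<^sup>2 \<le> (cmod w)\<^sup>2 * r\<^sup>2 / c"
proof -
  have "0 \<le> (cmod (of_real r * w - of_real c * x))\<^sup>2 / c" using assms by simp
  also have "\<dots> = (cmod w)\<^sup>2 * r\<^sup>2 / c - 2 * (r * Re (cnj w * x)) + c * (cmod x)\<^sup>2"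
  proof -
    have "(cmod (of_real r * w - of_real c * x))\<^sup>2 =
        r\<^sup>2 * (cmod w)\<^sup>2 - 2 * c * r * Re (cnj w * x) + c\<^sup>2 * (cmod x)\<^sup>2"
      unfolding cmod_power2 by (simp add: algebra_simps power2_eq_square)
    then show ?thesis using assms by (simp add: field_simps power2_eq_square)
  qed
  finally show ?thesis by simp
qed

text \<open>In terms of the matrix elements \<open>x j k\<close> of X between \<open>f j\<close> and
  \<open>e k\<close> the functional is bounded by a sum of independent parabolas. The families span
  supports only, so Bessel's inequality discards the other entries of X, which enter negatively; the
  expansion \<open>ex\<close> ensures that the linear term involves no discarded entry.\<close>

lemma var_fun_le:
  assumes fin: "finite I" "finite K" "finite J"
    and r: "has_dec I K e r R" and s: "has_dec I J f s S"
    and rp: "\<And>k. k \<in> K \<Longrightarrow> r k > 0" and sp: "\<And>j. j \<in> J \<Longrightarrow> s j > 0" and t: "t > 0"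
    and ex: "\<And>k i. k \<in> K \<Longrightarrow> i \<in> I \<Longrightarrow> e k i = (\<Sum>j\<in>J. inner_on I (f j) (e k) * f j i)"
  shows "var_fun I t R S X \<le> (\<Sum>k\<in>K. \<Sum>j\<in>J. (cmod (inner_on I (f j) (e k)))\<^sup>2 * (r k)\<^sup>2 / (s j + t * r k))"
proof -
  define Xe where "Xe = (\<lambda>k m. \<Sum>i\<in>I. X m i * e k i)"
  define Xf where "Xf = (\<lambda>j m. \<Sum>i\<in>I. cnj (X i m) * f j i)"
  define x where "x = (\<lambda>j k. inner_on I (f j) (Xe k))"
  define w where "w = (\<lambda>j k. inner_on I (f j) (e k))"
  have x': "x j k = cnj (inner_on I (e k) (Xf j))" for j k
    unfolding x_def Xe_def Xf_def by (rule mat_elem)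
  have 1: "quad I X (e k) = (\<Sum>j\<in>J. cnj (w j k) * x j k)" if k: "k \<in> K" for k
  proof -
    have "quad I X (e k) = inner_on I (e k) (Xe k)"
      by (simp add: quad_def inner_on_def Xe_def sum_distrib_left mult_ac)
    also have "\<dots> = cnj (inner_on I (Xe k) (e k))" by (simp add: inner_on_cnj)
    also have "inner_on I (Xe k) (e k) = inner_on I (Xe k) (\<lambda>i. \<Sum>j\<in>J. w j k * f j i)"
      by (rule inner_on_cong) (simp_all add: w_def ex[OF k, symmetric])
    also have "\<dots> = (\<Sum>j\<in>J. w j k * cnj (x j k))"
      unfolding inner_on_sum_right x_def by (simp add: inner_on_cnj)
    finally show ?thesis by simp
  qed
  \<comment> \<open>Up to conjugation, \<open>x j k\<close> is the coefficient along
    \<open>e k\<close> of the adjoint of X applied to \<open>f j\<close>.\<close>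
  have 2: "(\<Sum>k\<in>K. (cmod (x j k))\<^sup>2) \<le> (\<Sum>m\<in>I. (cmod (Xf j m))\<^sup>2)" if "j \<in> J" for j
    unfolding x' complex_mod_cnj by (rule bessel[OF fin(2) has_dec_orthonormal[OF r]])
  have 3: "(\<Sum>j\<in>J. (cmod (x j k))\<^sup>2) \<le> (\<Sum>m\<in>I. (cmod (Xe k m))\<^sup>2)" if "k \<in> K" for k
    unfolding x_def by (rule bessel[OF fin(3) has_dec_orthonormal[OF s]])
  have "var_fun I t R S X = 2 * (\<Sum>k\<in>K. r k * Re (quad I X (e k)))
      - (\<Sum>j\<in>J. s j * (\<Sum>m\<in>I. (cmod (Xf j m))\<^sup>2)) - t * (\<Sum>k\<in>K. r k * (\<Sum>m\<in>I. (cmod (Xe k m))\<^sup>2))"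
    unfolding var_fun_dec[OF r s] Xe_def Xf_def ..
  also have "\<dots> \<le> 2 * (\<Sum>k\<in>K. r k * Re (quad I X (e k)))
      - (\<Sum>j\<in>J. s j * (\<Sum>k\<in>K. (cmod (x j k))\<^sup>2)) - t * (\<Sum>k\<in>K. r k * (\<Sum>j\<in>J. (cmod (x j k))\<^sup>2))"
    using t by (intro diff_mono order_refl mult_left_mono sum_mono 2 3) (auto intro: less_imp_le rp sp)
  also have "(\<Sum>j\<in>J. s j * (\<Sum>k\<in>K. (cmod (x j k))\<^sup>2)) = (\<Sum>k\<in>K. \<Sum>j\<in>J. s j * (cmod (x j k))\<^sup>2)"
    unfolding sum_distrib_left by (rule sum.swap)
  also have "2 * (\<Sum>k\<in>K. r k * Re (quad I X (e k))) - (\<Sum>k\<in>K. \<Sum>j\<in>J. s j * (cmod (x j k))\<^sup>2)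
      - t * (\<Sum>k\<in>K. r k * (\<Sum>j\<in>J. (cmod (x j k))\<^sup>2)) =
      (\<Sum>k\<in>K. \<Sum>j\<in>J. 2 * (r k * Re (cnj (w j k) * x j k)) - (s j + t * r k) * (cmod (x j k))\<^sup>2)"
    by (simp add: 1 sum_distrib_left sum_subtractf sum.distrib algebra_simps cong: sum.cong)
  also have "\<dots> \<le> (\<Sum>k\<in>K. \<Sum>j\<in>J. (cmod (w j k))\<^sup>2 * (r k)\<^sup>2 / (s j + t * r k))"
    using t by (intro sum_mono complete_square add_pos_pos mult_pos_pos rp sp)
  finally show ?thesis by (simp only: w_def)
qed

text \<open>The maximizer is the operator with matrix elements \<open>c j k\<close> between the two
  families, \<open>c j k\<close> being the vertex of the parabola in \<open>complete_square\<close>.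
  It kills the orthogonal complement of the \<open>e k\<close> and maps into the span of the
  \<open>f j\<close>, so the Bessel estimates become equalities.\<close>

lemma var_fun_attained:
  assumes fin: "finite I" "finite K" "finite J"
    and r: "has_dec I K e r R" and s: "has_dec I J f s S"
    and rp: "\<And>k. k \<in> K \<Longrightarrow> r k > 0" and sp: "\<And>j. j \<in> J \<Longrightarrow> s j > 0" and t: "t > 0"
  obtains X where
    "var_fun I t R S X = (\<Sum>k\<in>K. \<Sum>j\<in>J. (cmod (inner_on I (f j) (e k)))\<^sup>2 * (r k)\<^sup>2 / (s j + t * r k))"
proof
  define w where "w = (\<lambda>j k. inner_on I (f j) (e k))"
  define c where "c = (\<lambda>j k. w j k * of_real (r k / (s j + t * r k)))"
  define X where "X = (\<lambda>m i. \<Sum>k\<in>K. \<Sum>j\<in>J. c j k * f j m * cnj (e k i))"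
  have on: "orthonormal I K e" "orthonormal I J f" using r s by (auto dest: has_dec_orthonormal)
  have Xe: "(\<Sum>i\<in>I. X m i * e k i) = (\<Sum>j\<in>J. c j k * f j m)" if k: "k \<in> K" for k m
  proof -
    have "(\<Sum>i\<in>I. X m i * e k i) = (\<Sum>i\<in>I. \<Sum>l\<in>K. (cnj (e l i) * e k i) * (\<Sum>j\<in>J. c j l * f j m))"
      by (simp add: X_def sum_distrib_left sum_distrib_right mult_ac)
    also have "\<dots> = (\<Sum>l\<in>K. inner_on I (e l) (e k) * (\<Sum>j\<in>J. c j l * f j m))"
      by (subst sum.swap) (simp add: inner_on_def sum_distrib_right)
    also have "\<dots> = (\<Sum>l\<in>K. if l = k then (\<Sum>j\<in>J. c j l * f j m) else 0)"
      using k by (intro sum.cong refl) (auto simp: orthonormalD[OF on(1)])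
    finally show ?thesis using k fin by simp
  qed
  have Xf: "(\<Sum>i\<in>I. cnj (X i m) * f j i) = (\<Sum>k\<in>K. cnj (c j k) * e k m)" if j: "j \<in> J" for j m
  proof -
    have "(\<Sum>i\<in>I. cnj (X i m) * f j i) =
        (\<Sum>i\<in>I. \<Sum>k\<in>K. \<Sum>l\<in>J. (cnj (f l i) * f j i) * (cnj (c l k) * e k m))"
      by (simp add: X_def sum_distrib_left sum_distrib_right mult_ac)
    also have "\<dots> = (\<Sum>i\<in>I. \<Sum>l\<in>J. \<Sum>k\<in>K. (cnj (f l i) * f j i) * (cnj (c l k) * e k m))"
      by (intro sum.cong refl sum.swap)
    also have "\<dots> = (\<Sum>i\<in>I. \<Sum>l\<in>J. (cnj (f l i) * f j i) * (\<Sum>k\<in>K. cnj (c l k) * e k m))"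
      by (simp add: sum_distrib_left)
    also have "\<dots> = (\<Sum>l\<in>J. inner_on I (f l) (f j) * (\<Sum>k\<in>K. cnj (c l k) * e k m))"
      by (subst sum.swap) (simp add: inner_on_def sum_distrib_right)
    also have "\<dots> = (\<Sum>l\<in>J. if l = j then (\<Sum>k\<in>K. cnj (c l k) * e k m) else 0)"
      using j by (intro sum.cong refl) (auto simp: orthonormalD[OF on(2)])
    finally show ?thesis using j fin by simp
  qed
  have norm: "(\<Sum>m\<in>I. (cmod (\<Sum>j\<in>L. a j * g j m))\<^sup>2) = (\<Sum>j\<in>L. (cmod (a j))\<^sup>2)"
    if "finite L" "orthonormal I L g" for L and g :: "'d \<Rightarrow> 'a \<Rightarrow> complex" and a
  proof -
    have "inner_on I (lift L g a) (lift L g a) = inner_on L a a" by (rule inner_on_lift[OF that])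
    then show ?thesis unfolding inner_on_self lift_def by (simp only: of_real_eq_iff)
  qed
  have 1: "quad I X (e k) = (\<Sum>j\<in>J. cnj (w j k) * c j k)" if k: "k \<in> K" for k
  proof -
    have "quad I X (e k) = inner_on I (e k) (\<lambda>m. \<Sum>j\<in>J. c j k * f j m)"
      by (simp add: quad_def inner_on_def Xe[OF k, symmetric] sum_distrib_left mult_ac)
    also have "\<dots> = (\<Sum>j\<in>J. cnj (w j k) * c j k)"
      unfolding inner_on_sum_right w_def by (simp add: inner_on_cnj mult.commute)
    finally show ?thesis .
  qed
  have 2: "(\<Sum>m\<in>I. (cmod (\<Sum>i\<in>I. cnj (X i m) * f j i))\<^sup>2) = (\<Sum>k\<in>K. (cmod (c j k))\<^sup>2)"
    if j: "j \<in> J" for j unfolding Xf[OF j] norm[OF fin(2) on(1)] by simp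
  have 3: "(\<Sum>m\<in>I. (cmod (\<Sum>i\<in>I. X m i * e k i))\<^sup>2) = (\<Sum>j\<in>J. (cmod (c j k))\<^sup>2)"
    if k: "k \<in> K" for k unfolding Xe[OF k] norm[OF fin(3) on(2)] by simp
  have sw: "(\<Sum>j\<in>J. s j * (\<Sum>k\<in>K. (cmod (c j k))\<^sup>2)) = (\<Sum>k\<in>K. \<Sum>j\<in>J. s j * (cmod (c j k))\<^sup>2)"
    unfolding sum_distrib_left by (rule sum.swap)
  have pt: "2 * (r k * Re (cnj (w j k) * c j k)) - (s j + t * r k) * (cmod (c j k))\<^sup>2 =
      (cmod (w j k))\<^sup>2 * (r k)\<^sup>2 / (s j + t * r k)" if "k \<in> K" "j \<in> J" for j k
  proof -
    have p: "s j + t * r k > 0" using that t by (intro add_pos_pos mult_pos_pos rp sp)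
    define q where "q = r k / (s j + t * r k)"
    have "cnj (w j k) * c j k = of_real ((cmod (w j k))\<^sup>2 * q)"
      unfolding c_def q_def[symmetric] of_real_mult complex_norm_square by (simp add: mult_ac)
    then have a: "Re (cnj (w j k) * c j k) = (cmod (w j k))\<^sup>2 * q" by (simp only: Re_complex_of_real)
    have b: "(cmod (c j k))\<^sup>2 = (cmod (w j k))\<^sup>2 * q\<^sup>2"
      unfolding c_def q_def[symmetric] by (simp add: norm_mult power_mult_distrib)
    have d: "(s j + t * r k) * q = r k" using p by (simp add: q_def)
    have "2 * (r k * ((cmod (w j k))\<^sup>2 * q)) - (s j + t * r k) * ((cmod (w j k))\<^sup>2 * q\<^sup>2) =
        (cmod (w j k))\<^sup>2 * q * (2 * r k - (s j + t * r k) * q)"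
      by (simp add: algebra_simps power2_eq_square)
    also have "\<dots> = (cmod (w j k))\<^sup>2 * (r k)\<^sup>2 / (s j + t * r k)"
      unfolding d by (simp add: q_def power2_eq_square)
    finally show ?thesis unfolding a b .
  qed
  have "var_fun I t R S X = 2 * (\<Sum>k\<in>K. r k * (\<Sum>j\<in>J. Re (cnj (w j k) * c j k)))
     - (\<Sum>k\<in>K. \<Sum>j\<in>J. s j * (cmod (c j k))\<^sup>2) - t * (\<Sum>k\<in>K. r k * (\<Sum>j\<in>J. (cmod (c j k))\<^sup>2))"
    unfolding var_fun_dec[OF r s] by (simp only: 1 2 3 sw Re_sum cong: sum.cong)
  also have "\<dots> = (\<Sum>k\<in>K. \<Sum>j\<in>J. 2 * (r k * Re (cnj (w j k) * c j k)) - (s j + t * r k) * (cmod (c j k))\<^sup>2)"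
    by (simp add: sum_distrib_left sum_subtractf sum.distrib algebra_simps)
  also have "\<dots> = (\<Sum>k\<in>K. \<Sum>j\<in>J. (cmod (w j k))\<^sup>2 * (r k)\<^sup>2 / (s j + t * r k))"
    by (intro sum.cong refl pt)
  finally show "var_fun I t R S X =
    (\<Sum>k\<in>K. \<Sum>j\<in>J. (cmod (inner_on I (f j) (e k)))\<^sup>2 * (r k)\<^sup>2 / (s j + t * r k))"
    by (simp only: w_def)
qed

section \<open>Test operators that act as the identity on the traced factor\<close>

definition id_tensor :: "('b \<Rightarrow> 'b \<Rightarrow> complex) \<Rightarrow> 'a \<times> 'b \<Rightarrow> 'a \<times> 'b \<Rightarrow> complex" where
  "id_tensor Y p q = (if fst p = fst q then Y (snd p) (snd q) else 0)"

text \<open>The duality that characterizes the partial trace.\<close>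

lemma trace_prod_id_tensor:
  assumes "finite A"
  shows "trace_prod (A \<times> B) R (id_tensor Y) = trace_prod B (ptrace_fst A R) Y"
proof -
  have "trace_prod (A \<times> B) R (id_tensor Y) =
      (\<Sum>a\<in>A. \<Sum>b\<in>B. \<Sum>a'\<in>A. \<Sum>b'\<in>B. R (a, b) (a', b') * (if a' = a then Y b' b else 0))"
    by (simp add: trace_prod_def id_tensor_def sum.cartesian_product' cong: if_cong)
  also have "\<dots> = (\<Sum>a\<in>A. \<Sum>b\<in>B. \<Sum>a'\<in>A. if a' = a then \<Sum>b'\<in>B. R (a, b) (a', b') * Y b' b else 0)"
    by (intro sum.cong refl) auto
  also have "\<dots> = (\<Sum>a\<in>A. \<Sum>b\<in>B. \<Sum>b'\<in>B. R (a, b) (a, b') * Y b' b)"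
    using assms by simp
  also have "\<dots> = (\<Sum>b\<in>B. \<Sum>a\<in>A. \<Sum>b'\<in>B. R (a, b) (a, b') * Y b' b)" by (rule sum.swap)
  also have "\<dots> = (\<Sum>b\<in>B. \<Sum>b'\<in>B. \<Sum>a\<in>A. R (a, b) (a, b') * Y b' b)"
    by (intro sum.cong refl sum.swap)
  finally show ?thesis by (simp add: trace_prod_def ptrace_fst_def sum_distrib_right)
qed

lemma trace_prod_cong: "(\<And>i j. i \<in> I \<Longrightarrow> j \<in> I \<Longrightarrow> X i j = Y i j) \<Longrightarrow> trace_prod I R X = trace_prod I R Y"
  by (simp add: trace_prod_def)

lemma gram_id_tensor:
  assumes "finite A" "p \<in> A \<times> B" "q \<in> A \<times> B"
  shows "gram (A \<times> B) (id_tensor Y) p q = id_tensor (gram B Y) p q"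
proof -
  obtain a b a' b' where pq: "p = (a, b)" "q = (a', b')" "a \<in> A" "a' \<in> A" using assms by auto
  have "gram (A \<times> B) (id_tensor Y) p q =
      (\<Sum>c\<in>A. if c = a then (if a = a' then \<Sum>m\<in>B. cnj (Y m b) * Y m b' else 0) else 0)"
    unfolding gram_def id_tensor_def sum.cartesian_product' pq by (intro sum.cong refl) auto
  then show ?thesis using assms pq by (simp add: id_tensor_def gram_def)
qed

lemma adj_ker_id_tensor: "adj_ker (id_tensor Y) = id_tensor (adj_ker Y)"
  by (auto simp: adj_ker_def id_tensor_def fun_eq_iff)

text \<open>Adjoints and products of operators 1 tensor Y stay of this form, so all three traces in
  the functional reduce to partial traces. Hence the supremum over the large system is at least that
  over the small one.\<close>

lemma var_fun_id_tensor:
  assumes "finite A"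
  shows "var_fun (A \<times> B) t R S (id_tensor Y) = var_fun B t (ptrace_fst A R) (ptrace_fst A S) Y"
proof -
  have "trace_prod (A \<times> B) M (gram (A \<times> B) (id_tensor Z)) = trace_prod B (ptrace_fst A M) (gram B Z)" for M Z
  proof -
    have "trace_prod (A \<times> B) M (gram (A \<times> B) (id_tensor Z)) = trace_prod (A \<times> B) M (id_tensor (gram B Z))"
      by (rule trace_prod_cong) (rule gram_id_tensor[OF assms])
    then show ?thesis by (simp add: trace_prod_id_tensor[OF assms])
  qed
  then show ?thesis unfolding var_fun_def adj_ker_id_tensor trace_prod_id_tensor[OF assms] by simp
qed

lemma tendsto_sum_ln:
  fixes w r s :: "'k \<Rightarrow> 'j \<Rightarrow> real"
  assumes "\<And>k j. k \<in> K \<Longrightarrow> j \<in> J \<Longrightarrow> r k j > 0"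
  shows "((\<lambda>t. \<Sum>k\<in>K. \<Sum>j\<in>J. w k j * ln (r k j + s k j / t)) \<longlongrightarrow> (\<Sum>k\<in>K. \<Sum>j\<in>J. w k j * ln (r k j))) at_top"
proof (intro tendsto_sum tendsto_mult tendsto_const)
  fix k j assume kj: "k \<in> K" "j \<in> J"
  have "((\<lambda>t. r k j + s k j / t) \<longlongrightarrow> r k j + 0) at_top"
    by (intro tendsto_add tendsto_const tendsto_divide_0[OF tendsto_const]
        filterlim_at_top_imp_at_infinity filterlim_ident)
  then show "((\<lambda>t. ln (r k j + s k j / t)) \<longlongrightarrow> ln (r k j)) at_top"
    using assms[OF kj] by (intro tendsto_ln) auto
qed

text \<open>The difference \<open>H\<close> of the two logarithmic sums has as derivative the
  difference of the maxima of \<open>var_fun\<close> for the pair and for its partial traces, so it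
  is nondecreasing on the positive axis. Equal traces make the growth in \<open>ln t\<close> cancel,
  so \<open>H\<close> has a finite limit at infinity; that limit is the right side, while
  \<open>H 0\<close> is the left.\<close>

lemma cross_mono_pos:
  assumes fin: "finite A" "finite B" "finite K" "finite J" "finite K'" "finite J'"
    and r: "has_dec (A \<times> B) K e r R" and s: "has_dec (A \<times> B) J f s S"
    and r': "has_dec B K' e' r' (ptrace_fst A R)" and s': "has_dec B J' f' s' (ptrace_fst A S)"
    and rp: "\<And>k. k \<in> K \<Longrightarrow> r k > 0" and sp: "\<And>j. j \<in> J \<Longrightarrow> s j > 0"
    and rp': "\<And>k. k \<in> K' \<Longrightarrow> r' k > 0" and sp': "\<And>j. j \<in> J' \<Longrightarrow> s' j > 0"
    and ex: "\<And>k i. k \<in> K \<Longrightarrow> i \<in> A \<times> B \<Longrightarrow> e k i = (\<Sum>j\<in>J. inner_on (A \<times> B) (f j) (e k) * f j i)"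
    and ex': "\<And>k i. k \<in> K' \<Longrightarrow> i \<in> B \<Longrightarrow> e' k i = (\<Sum>j\<in>J'. inner_on B (f' j) (e' k) * f' j i)"
  shows "(\<Sum>k\<in>K. \<Sum>j\<in>J. (cmod (inner_on (A \<times> B) (f j) (e k)))\<^sup>2 * r k * ln (s j))
       - (\<Sum>k\<in>K'. \<Sum>j\<in>J'. (cmod (inner_on B (f' j) (e' k)))\<^sup>2 * r' k * ln (s' j))
     \<le> (\<Sum>k\<in>K. r k * ln (r k)) - (\<Sum>k\<in>K'. r' k * ln (r' k))"
proof -
  define w where "w = (\<lambda>k j. (cmod (inner_on (A \<times> B) (f j) (e k)))\<^sup>2 * r k)"
  define w' where "w' = (\<lambda>k j. (cmod (inner_on B (f' j) (e' k)))\<^sup>2 * r' k)"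
  define H where "H = (\<lambda>t. (\<Sum>k\<in>K. \<Sum>j\<in>J. w k j * ln (s j + t * r k)) -
                           (\<Sum>k\<in>K'. \<Sum>j\<in>J'. w' k j * ln (s' j + t * r' k)))"
  define G where "G = (\<lambda>t. (\<Sum>k\<in>K. \<Sum>j\<in>J. w k j * ln (r k + s j / t)) -
                           (\<Sum>k\<in>K'. \<Sum>j\<in>J'. w' k j * ln (r' k + s' j / t)))"
  \<comment> \<open>A unit vector lying in the span of the second family has squared coefficients
    that sum to 1, although that family need not be complete.\<close>
  have unit: "(\<Sum>j\<in>J0. (cmod (inner_on I (f0 j) (e0 k)))\<^sup>2) = 1"
    if "orthonormal I K0 e0" "k \<in> K0" and x: "\<And>i. i \<in> I \<Longrightarrow> e0 k i = (\<Sum>j\<in>J0. inner_on I (f0 j) (e0 k) * f0 j i)"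
    for I and J0 :: "'x set" and K0 :: "'y set" and e0 f0 k
  proof -
    have "1 = inner_on I (e0 k) (e0 k)" using that by (simp add: orthonormalD)
    also have "\<dots> = inner_on I (e0 k) (\<lambda>i. \<Sum>j\<in>J0. inner_on I (f0 j) (e0 k) * f0 j i)"
      by (rule inner_on_cong) (simp_all add: x[symmetric])
    also have "\<dots> = of_real (\<Sum>j\<in>J0. (cmod (inner_on I (f0 j) (e0 k)))\<^sup>2)"
      unfolding inner_on_sum_right of_real_sum
      by (intro sum.cong refl) (simp only: inner_on_cnj[of I "f0 _" "e0 k", symmetric] complex_norm_square)
    finally have "complex_of_real (\<Sum>j\<in>J0. (cmod (inner_on I (f0 j) (e0 k)))\<^sup>2) = 1" ..
    then show ?thesis by (simp only: of_real_eq_1_iff)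
  qed
  have W: "(\<Sum>j\<in>J. w k j) = r k" if "k \<in> K" for k
    using unit[OF has_dec_orthonormal[OF r] that ex[OF that]] by (simp add: w_def sum_distrib_right[symmetric])
  have W': "(\<Sum>j\<in>J'. w' k j) = r' k" if "k \<in> K'" for k
    using unit[OF has_dec_orthonormal[OF r'] that ex'[OF that]] by (simp add: w'_def sum_distrib_right[symmetric])
  have tr: "(\<Sum>k\<in>K. r k) = (\<Sum>k\<in>K'. r' k)"
  proof -
    have "(\<Sum>i\<in>A\<times>B. R i i) = (\<Sum>b\<in>B. ptrace_fst A R b b)"
      unfolding ptrace_fst_def by (subst sum.swap) (simp add: sum.cartesian_product')
    then show ?thesis using dec_trace[OF r] dec_trace[OF r'] by (simp only: of_real_eq_iff)
  qed
  have pos: "s j + t * r k > 0" if "k \<in> K" "j \<in> J" "t \<ge> 0" for j k t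
    using rp[of k] sp[of j] that by (intro add_pos_nonneg) auto
  have pos': "s' j + t * r' k > 0" if "k \<in> K'" "j \<in> J'" "t \<ge> 0" for j k t
    using rp'[of k] sp'[of j] that by (intro add_pos_nonneg) auto
  \<comment> \<open>Positive eigenvalues keep the logarithms smooth at t = 0 as well, which gives
    the continuity used in \<open>mono\<close>.\<close>
  have deriv: "(H has_real_derivative
      (\<Sum>k\<in>K. \<Sum>j\<in>J. w k j * r k / (s j + t * r k)) -
      (\<Sum>k\<in>K'. \<Sum>j\<in>J'. w' k j * r' k / (s' j + t * r' k))) (at t)" if t: "t \<ge> 0" for t
    unfolding H_def
    by (intro DERIV_diff DERIV_sum) (auto intro!: derivative_eq_intros simp: pos pos' t)
  have nonneg: "0 \<le> (\<Sum>k\<in>K. \<Sum>j\<in>J. w k j * r k / (s j + t * r k)) -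
      (\<Sum>k\<in>K'. \<Sum>j\<in>J'. w' k j * r' k / (s' j + t * r' k))" if t: "t > 0" for t
  proof -
    \<comment> \<open>The maximizer for the reduced pair, tensored with the identity, is a
      competitor for the full pair.\<close>
    obtain Y where "var_fun B t (ptrace_fst A R) (ptrace_fst A S) Y =
        (\<Sum>k\<in>K'. \<Sum>j\<in>J'. (cmod (inner_on B (f' j) (e' k)))\<^sup>2 * (r' k)\<^sup>2 / (s' j + t * r' k))"
      using var_fun_attained[OF fin(2,5,6) r' s' rp' sp' t] by blast
    moreover have "var_fun (A \<times> B) t R S (id_tensor Y) \<le>
        (\<Sum>k\<in>K. \<Sum>j\<in>J. (cmod (inner_on (A \<times> B) (f j) (e k)))\<^sup>2 * (r k)\<^sup>2 / (s j + t * r k))"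
      using fin by (intro var_fun_le[OF _ fin(3,4) r s rp sp t ex]) auto
    ultimately show ?thesis
      by (simp add: var_fun_id_tensor[OF fin(1)] w_def w'_def power2_eq_square mult_ac)
  qed
  have mono: "H 0 \<le> H t" if t: "t > 0" for t
  proof -
    have "isCont H x" if "x \<in> {0..t}" for x
      using DERIV_isCont[OF deriv, of x] that by simp
    then have "continuous_on {0..t} H" by (intro continuous_at_imp_continuous_on ballI)
    moreover have "\<exists>y. (H has_real_derivative y) (at x) \<and> 0 \<le> y" if "0 < x" for x
      using deriv[of x] nonneg[OF that] that by (intro exI conjI) auto
    ultimately show ?thesis
      using t by (intro DERIV_nonneg_imp_increasing_open[of 0 t H]) auto
  qed
  \<comment> \<open>Taking t out of each logarithm leaves \<open>ln t\<close> times the trace of R,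
    which is also the trace of its partial trace.\<close>
  have HG: "H t = G t" if t: "t > 0" for t
  proof -
    have split: "ln (y + t * x) = ln t + ln (x + y / t)" if "x > 0" "y > 0" for x y :: real
    proof -
      have "y + t * x = t * (x + y / t)" using t by (simp add: algebra_simps)
      moreover have "x + y / t > 0" using that t by (intro add_pos_pos) auto
      ultimately show ?thesis using t by (simp add: ln_mult)
    qed
    have row: "(\<Sum>j\<in>J0. v j * ln (y j + t * x)) = x * ln t + (\<Sum>j\<in>J0. v j * ln (x + y j / t))"
      if "x > 0" "\<And>j. j \<in> J0 \<Longrightarrow> y j > 0" "(\<Sum>j\<in>J0. v j) = x"
      for J0 :: "'x set" and v y :: "'x \<Rightarrow> real" and x
    proof -
      have "(\<Sum>j\<in>J0. v j * ln (y j + t * x)) = (\<Sum>j\<in>J0. v j * ln t + v j * ln (x + y j / t))"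
        using that by (intro sum.cong refl) (simp add: split distrib_left)
      then show ?thesis using that(3) by (simp add: sum.distrib sum_distrib_right[symmetric])
    qed
    have a: "(\<Sum>k\<in>K. \<Sum>j\<in>J. w k j * ln (s j + t * r k)) =
        (\<Sum>k\<in>K. r k * ln t + (\<Sum>j\<in>J. w k j * ln (r k + s j / t)))"
      by (intro sum.cong refl row rp sp W)
    have b: "(\<Sum>k\<in>K'. \<Sum>j\<in>J'. w' k j * ln (s' j + t * r' k)) =
        (\<Sum>k\<in>K'. r' k * ln t + (\<Sum>j\<in>J'. w' k j * ln (r' k + s' j / t)))"
      by (intro sum.cong refl row rp' sp' W')
    show ?thesis unfolding H_def G_def a b by (simp add: sum.distrib sum_distrib_right[symmetric] tr)
  qed
  have "(G \<longlongrightarrow> (\<Sum>k\<in>K. \<Sum>j\<in>J. w k j * ln (r k)) - (\<Sum>k\<in>K'. \<Sum>j\<in>J'. w' k j * ln (r' k))) at_top"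
    unfolding G_def by (intro tendsto_diff tendsto_sum_ln rp rp')
  then have "H 0 \<le> (\<Sum>k\<in>K. \<Sum>j\<in>J. w k j * ln (r k)) - (\<Sum>k\<in>K'. \<Sum>j\<in>J'. w' k j * ln (r' k))"
    by (rule tendsto_lowerbound)
       (use mono HG in \<open>auto intro!: eventually_mono[OF eventually_gt_at_top[of "0::real"]]\<close>)
  also have "\<dots> = (\<Sum>k\<in>K. r k * ln (r k)) - (\<Sum>k\<in>K'. r' k * ln (r' k))"
    by (simp add: sum_distrib_right[symmetric] W W')
  finally show ?thesis by (simp add: H_def w_def w'_def)
qed


text \<open>For positive kernels a vanishing quadratic form means lying in the null space, so this
  is inclusion of supports. Expressed by quadratic forms it needs no eigenvectors and passes to
  partial traces term by term.\<close>

definition supp_le :: "'i set \<Rightarrow> ('i \<Rightarrow> 'i \<Rightarrow> complex) \<Rightarrow> ('i \<Rightarrow> 'i \<Rightarrow> complex) \<Rightarrow> bool" where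
  "supp_le I R S \<longleftrightarrow> (\<forall>v. quad I S v = 0 \<longrightarrow> quad I R v = 0)"

lemma dec_restrict:
  assumes "finite K" "has_dec I K u lam M"
  shows "has_dec I {k \<in> K. lam k \<noteq> 0} u lam M"
  unfolding has_dec_def
proof (intro conjI ballI)
  show "orthonormal I {k \<in> K. lam k \<noteq> 0} u" using assms by (auto simp: has_dec_def orthonormal_def)
  fix i j assume ij: "i \<in> I" "j \<in> I"
  show "M i j = (\<Sum>k\<in>{k \<in> K. lam k \<noteq> 0}. of_real (lam k) * u k i * cnj (u k j))"
    unfolding has_decD[OF assms(2) ij] using assms(1) by (intro sum.mono_neutral_right) auto
qed

text \<open>The quadratic form is a sum of nonnegative terms, so each of them vanishes.\<close>

lemma dec_weight_zero:
  assumes fin: "finite K" and d: "has_dec I K u lam M" and nn: "\<And>k. k \<in> K \<Longrightarrow> lam k \<ge> 0"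
    and z: "quad I M v = 0" and k: "k \<in> K" "lam k \<noteq> 0"
  shows "inner_on I (u k) v = 0"
proof -
  have "(\<Sum>k\<in>K. lam k * (cmod (inner_on I (u k) v))\<^sup>2) = 0"
    using z unfolding dec_quad[OF d] by (simp only: of_real_eq_0_iff)
  then have "lam k * (cmod (inner_on I (u k) v))\<^sup>2 = 0"
    using fin nn k by (subst (asm) sum_nonneg_eq_0_iff) auto
  then show ?thesis using k by simp
qed

text \<open>The null space of S is spanned by the \<open>f j\<close> with \<open>s j = 0\<close>, so
  testing these suffices. Hypothesis \<open>z\<close> is the form in which finiteness of the
  relative entropy supplies the inclusion.\<close>

lemma supp_leI:
  assumes fin: "finite I" "finite K" "finite J"
    and r: "has_dec I K e r R" and rn: "\<And>k. k \<in> K \<Longrightarrow> r k \<ge> 0"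
    and s: "has_dec I J f s S" and sn: "\<And>j. j \<in> J \<Longrightarrow> s j \<ge> 0" and f: "orthonormal_basis I J f"
    and z: "\<And>j. j \<in> J \<Longrightarrow> s j = 0 \<Longrightarrow> quad I R (f j) = 0"
  shows "supp_le I R S"
  unfolding supp_le_def
proof (intro allI impI)
  fix v assume v: "quad I S v = 0"
  have "inner_on I (e k) v = 0" if k: "k \<in> K" "r k \<noteq> 0" for k
  proof -
    have "inner_on I (e k) v = inner_on I (e k) (\<lambda>i. \<Sum>j\<in>J. inner_on I (f j) v * f j i)"
      by (rule inner_on_cong) (simp_all add: orthonormal_basis_expand[OF fin(1) f])
    also have "\<dots> = (\<Sum>j\<in>J. inner_on I (f j) v * inner_on I (e k) (f j))" by (rule inner_on_sum_right)
    also have "\<dots> = 0"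
    proof (intro sum.neutral ballI)
      fix j assume j: "j \<in> J"
      show "inner_on I (f j) v * inner_on I (e k) (f j) = 0"
        using dec_weight_zero[OF fin(3) s sn v j] dec_weight_zero[OF fin(2) r rn z[OF j] k] by auto
    qed
    finally show ?thesis .
  qed
  then have "(\<Sum>k\<in>K. r k * (cmod (inner_on I (e k) v))\<^sup>2) = 0" by (intro sum.neutral) auto
  then show "quad I R v = 0" unfolding dec_quad[OF r] by (simp only: of_real_0)
qed

lemma supp_le_eigvec:
  assumes "finite J" "has_dec I J f s S" "supp_le I R S" "j \<in> J" "s j = 0"
  shows "quad I R (f j) = 0"
  using assms dec_quad_eigvec[OF assms(1,2,4)] by (auto simp: supp_le_def)

text \<open>The trace of R g(S), written in eigenvectors of S alone and in overlaps with those of R.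
  Null vectors of S carry no weight of R, so the value \<open>g 0\<close> is immaterial and only
  nonzero eigenvalues remain.\<close>

lemma cross_split:
  assumes fin: "finite K" "finite J"
    and r: "has_dec I K e r R" and s: "has_dec I J f s S" and supp: "supp_le I R S"
  shows "(\<Sum>j\<in>J. g (s j) * Re (quad I R (f j))) =
    (\<Sum>k\<in>{k \<in> K. r k \<noteq> 0}. \<Sum>j\<in>{j \<in> J. s j \<noteq> 0}. (cmod (inner_on I (f j) (e k)))\<^sup>2 * r k * g (s j))"
proof -
  have "(\<Sum>j\<in>J. g (s j) * Re (quad I R (f j))) = (\<Sum>j\<in>{j \<in> J. s j \<noteq> 0}. g (s j) * Re (quad I R (f j)))"
    using fin supp_le_eigvec[OF fin(2) s supp] by (intro sum.mono_neutral_right) auto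
  also have "\<dots> = (\<Sum>j\<in>{j \<in> J. s j \<noteq> 0}. \<Sum>k\<in>{k \<in> K. r k \<noteq> 0}. (cmod (inner_on I (f j) (e k)))\<^sup>2 * r k * g (s j))"
  proof (intro sum.cong refl)
    fix j
    have "cmod (inner_on I (e k) (f j)) = cmod (inner_on I (f j) (e k))" for k
      using complex_mod_cnj[of "inner_on I (f j) (e k)"] unfolding inner_on_cnj .
    then show "g (s j) * Re (quad I R (f j)) =
        (\<Sum>k\<in>{k \<in> K. r k \<noteq> 0}. (cmod (inner_on I (f j) (e k)))\<^sup>2 * r k * g (s j))"
      unfolding dec_quad[OF dec_restrict[OF fin(1) r]] by (simp add: sum_distrib_left mult_ac)
  qed
  finally show ?thesis by (subst sum.swap)
qed

text \<open>Eigenvectors of R with nonzero eigenvalue are orthogonal to the null vectors of S. This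
  yields the expansion demanded by \<open>cross_mono_pos\<close> once zero eigenvalues have been
  dropped.\<close>

lemma supp_expand:
  assumes fin: "finite I" "finite K" "finite J"
    and r: "has_dec I K e r R" and rn: "\<And>k. k \<in> K \<Longrightarrow> r k \<ge> 0"
    and s: "has_dec I J f s S" and f: "orthonormal_basis I J f" and supp: "supp_le I R S"
    and k: "k \<in> {k \<in> K. r k \<noteq> 0}" and i: "i \<in> I"
  shows "e k i = (\<Sum>j\<in>{j \<in> J. s j \<noteq> 0}. inner_on I (f j) (e k) * f j i)"
proof -
  have "inner_on I (f j) (e k) = 0" if j: "j \<in> J" "s j = 0" for j
  proof -
    have "inner_on I (e k) (f j) = 0"
      using dec_weight_zero[OF fin(2) r rn supp_le_eigvec[OF fin(3) s supp j]] k by auto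
    then show ?thesis using inner_on_cnj[of I "e k" "f j"] by simp
  qed
  then have "(\<Sum>j\<in>J. inner_on I (f j) (e k) * f j i) = (\<Sum>j\<in>{j \<in> J. s j \<noteq> 0}. inner_on I (f j) (e k) * f j i)"
    using fin by (intro sum.mono_neutral_right) auto
  then show ?thesis by (simp add: orthonormal_basis_expand[OF fin(1) f i])
qed

text \<open>The left side tests M on the vectors a tensor v, with a running over the standard basis
  of the traced factor. Positivity and vanishing thus descend to the partial trace one summand at a
  time.\<close>

lemma quad_ptrace_fst:
  assumes "finite A"
  shows "(\<Sum>a\<in>A. quad (A \<times> B) M (\<lambda>p. if fst p = a then v (snd p) else 0)) = quad B (ptrace_fst A M) v"
proof -
  have "quad (A \<times> B) M (\<lambda>p. if fst p = a then v (snd p) else 0) =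
      (\<Sum>b\<in>B. \<Sum>b'\<in>B. cnj (v b) * M (a, b) (a, b') * v b')" if a: "a \<in> A" for a
  proof -
    have "quad (A \<times> B) M (\<lambda>p. if fst p = a then v (snd p) else 0) =
      (\<Sum>c\<in>A. \<Sum>b\<in>B. \<Sum>c'\<in>A. \<Sum>b'\<in>B. if c = a then if c' = a then cnj (v b) * M (a, b) (a, b') * v b' else 0 else 0)"
      unfolding quad_def sum.cartesian_product' by (intro sum.cong refl) auto
    also have "\<dots> = (\<Sum>c\<in>A. if c = a then \<Sum>b\<in>B. \<Sum>c'\<in>A. if c' = a then \<Sum>b'\<in>B. cnj (v b) * M (a, b) (a, b') * v b' else 0 else 0)"
      by (intro sum.cong refl) (auto intro!: sum.cong)
    finally show ?thesis using a assms by simp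
  qed
  then have "(\<Sum>a\<in>A. quad (A \<times> B) M (\<lambda>p. if fst p = a then v (snd p) else 0)) =
      (\<Sum>a\<in>A. \<Sum>b\<in>B. \<Sum>b'\<in>B. cnj (v b) * M (a, b) (a, b') * v b')" by simp
  also have "\<dots> = (\<Sum>b\<in>B. \<Sum>a\<in>A. \<Sum>b'\<in>B. cnj (v b) * M (a, b) (a, b') * v b')" by (rule sum.swap)
  also have "\<dots> = (\<Sum>b\<in>B. \<Sum>b'\<in>B. \<Sum>a\<in>A. cnj (v b) * M (a, b) (a, b') * v b')"
    by (intro sum.cong refl sum.swap)
  finally show ?thesis by (simp add: quad_def ptrace_fst_def sum_distrib_left sum_distrib_right)
qed

lemma supp_le_ptrace_fst:
  fixes A :: "'a set" and B :: "'b set"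
  assumes fin: "finite A" "finite J" and s: "has_dec (A \<times> B) J f s S" and sn: "\<And>j. j \<in> J \<Longrightarrow> s j \<ge> 0"
    and supp: "supp_le (A \<times> B) R S"
  shows "supp_le B (ptrace_fst A R) (ptrace_fst A S)"
  unfolding supp_le_def
proof (intro allI impI)
  fix v assume z: "quad B (ptrace_fst A S) v = 0"
  define x where "x = (\<lambda>a (p :: 'a \<times> 'b). if fst p = a then v (snd p) else 0)"
  define y where "y = (\<lambda>a. \<Sum>j\<in>J. s j * (cmod (inner_on (A \<times> B) (f j) (x a)))\<^sup>2)"
  have q: "quad (A \<times> B) S (x a) = of_real (y a)" for a unfolding y_def by (rule dec_quad[OF s])
  have "(\<Sum>a\<in>A. quad (A \<times> B) S (x a)) = 0" using z by (simp add: quad_ptrace_fst[OF fin(1)] x_def)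
  then have "(\<Sum>a\<in>A. y a) = 0" unfolding q of_real_sum[symmetric] by (simp only: of_real_eq_0_iff)
  moreover have "y a \<ge> 0" for a unfolding y_def using sn by (intro sum_nonneg) auto
  ultimately have "y a = 0" if "a \<in> A" for a
    using fin that by (subst (asm) sum_nonneg_eq_0_iff) auto
  then have "quad (A \<times> B) R (x a) = 0" if "a \<in> A" for a
    using supp q that by (simp add: supp_le_def)
  then show "quad B (ptrace_fst A R) v = 0" using quad_ptrace_fst[OF fin(1), of B R v] by (simp add: x_def)
qed

text \<open>The inequality \<open>D(ptrace_fst A R||ptrace_fst A S) \<le> D(R||S)\<close>, with the terms
  \<open>r k * ln (r k)\<close> moved to the right. Vanishing eigenvalues do no harm because \<open>ln 0 = 0\<close>.\<close>

theorem cross_mono: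
  assumes fin: "finite A" "finite B" "finite K" "finite J" "finite K'" "finite J'"
    and r: "has_dec (A \<times> B) K e r R" and rn: "\<And>k. k \<in> K \<Longrightarrow> r k \<ge> 0"
    and s: "has_dec (A \<times> B) J f s S" and sn: "\<And>j. j \<in> J \<Longrightarrow> s j \<ge> 0" and f: "orthonormal_basis (A \<times> B) J f"
    and r': "has_dec B K' e' r' (ptrace_fst A R)" and rn': "\<And>k. k \<in> K' \<Longrightarrow> r' k \<ge> 0"
    and s': "has_dec B J' f' s' (ptrace_fst A S)" and sn': "\<And>j. j \<in> J' \<Longrightarrow> s' j \<ge> 0" and f': "orthonormal_basis B J' f'"
    and supp: "supp_le (A \<times> B) R S"
  shows "(\<Sum>j\<in>J. ln (s j) * Re (quad (A \<times> B) R (f j))) - (\<Sum>j\<in>J'. ln (s' j) * Re (quad B (ptrace_fst A R) (f' j)))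
     \<le> (\<Sum>k\<in>K. r k * ln (r k)) - (\<Sum>k\<in>K'. r' k * ln (r' k))"
proof -
  have supp': "supp_le B (ptrace_fst A R) (ptrace_fst A S)" by (rule supp_le_ptrace_fst[OF fin(1,4) s sn supp])
  have AB: "finite (A \<times> B)" using fin by simp
  have e: "(\<Sum>k\<in>K. r k * ln (r k)) = (\<Sum>k\<in>{k\<in>K. r k \<noteq> 0}. r k * ln (r k))"
    "(\<Sum>k\<in>K'. r' k * ln (r' k)) = (\<Sum>k\<in>{k\<in>K'. r' k \<noteq> 0}. r' k * ln (r' k))"
    using fin by (auto intro!: sum.mono_neutral_right)
  have pos: "k \<in> {k \<in> K. r k \<noteq> 0} \<Longrightarrow> r k > 0" "j \<in> {j \<in> J. s j \<noteq> 0} \<Longrightarrow> s j > 0"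
    "k' \<in> {k \<in> K'. r' k \<noteq> 0} \<Longrightarrow> r' k' > 0" "j' \<in> {j \<in> J'. s' j \<noteq> 0} \<Longrightarrow> s' j' > 0" for k j k' j'
    using rn[of k] sn[of j] rn'[of k'] sn'[of j'] by auto
  show ?thesis
    unfolding cross_split[OF fin(3,4) r s supp] cross_split[OF fin(5,6) r' s' supp'] e
    using fin
    by (intro cross_mono_pos[of A B _ _ _ _ e r R f s S e' r' f' s'] dec_restrict r s r' s' pos
        supp_expand[OF AB fin(3,4) r rn s f supp] supp_expand[OF fin(2,5,6) r' rn' s' f' supp']) auto
qed

text \<open>Apply \<open>ln y \<le> y - 1\<close> to y = \<open>s j / r k\<close> with the weights
  \<open>w k j * r k\<close>. Summing \<open>w k j\<close> over j gives 1, since the support of R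
  lies in that of S; summing over k gives at most 1 by Bessel, as the \<open>e k\<close> may span
  less. What is left is the difference of the traces, which is at most 0.\<close>

theorem klein:
  assumes fin: "finite I" "finite K" "finite J"
    and r: "has_dec I K e r R" and rn: "\<And>k. k \<in> K \<Longrightarrow> r k \<ge> 0"
    and s: "has_dec I J f s S" and sn: "\<And>j. j \<in> J \<Longrightarrow> s j \<ge> 0" and f: "orthonormal_basis I J f"
    and supp: "supp_le I R S" and tr: "(\<Sum>j\<in>J. s j) \<le> (\<Sum>k\<in>K. r k)"
  shows "(\<Sum>j\<in>J. ln (s j) * Re (quad I R (f j))) \<le> (\<Sum>k\<in>K. r k * ln (r k))"
proof -
  define K0 where "K0 = {k \<in> K. r k \<noteq> 0}"
  define J0 where "J0 = {j \<in> J. s j \<noteq> 0}"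
  define w where "w = (\<lambda>k j. (cmod (inner_on I (f j) (e k)))\<^sup>2)"
  have f0: "finite K0" "finite J0" using fin by (auto simp: K0_def J0_def)
  have pos: "k \<in> K0 \<Longrightarrow> r k > 0" "j \<in> J0 \<Longrightarrow> s j > 0" for k j
    using rn[of k] sn[of j] by (auto simp: K0_def J0_def)
  have e: "(\<Sum>k\<in>K. r k * ln (r k)) = (\<Sum>k\<in>K0. r k * ln (r k))" "(\<Sum>k\<in>K. r k) = (\<Sum>k\<in>K0. r k)"
    "(\<Sum>j\<in>J. s j) = (\<Sum>j\<in>J0. s j)"
    unfolding K0_def J0_def using fin by (auto intro!: sum.mono_neutral_right)
  have on: "orthonormal I K0 e" using has_dec_orthonormal[OF r] by (auto simp: K0_def orthonormal_def)
  have W: "(\<Sum>j\<in>J0. w k j) = 1" if k: "k \<in> K0" for k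
  proof -
    have "(\<Sum>j\<in>J0. w k j) = (\<Sum>j\<in>J. w k j)"
    proof (rule sum.mono_neutral_left[OF fin(3)])
      show "\<forall>j\<in>J - J0. w k j = 0"
      proof
        fix j assume j: "j \<in> J - J0"
        then have "inner_on I (e k) (f j) = 0"
          using dec_weight_zero[OF fin(2) r rn supp_le_eigvec[OF fin(3) s supp, of j], of k] k
          by (auto simp: K0_def J0_def)
        then show "w k j = 0" using inner_on_cnj[of I "e k" "f j"] by (simp add: w_def)
      qed
    qed (auto simp: J0_def)
    also have "\<dots> = (\<Sum>i\<in>I. (cmod (e k i))\<^sup>2)" unfolding w_def by (rule parseval[OF fin(1) f])
    also have "complex_of_real \<dots> = 1" unfolding inner_on_self[symmetric] using on k by (simp add: orthonormalD)
    finally show ?thesis by (simp only: of_real_eq_1_iff)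
  qed
  have W': "(\<Sum>k\<in>K0. w k j) \<le> 1" if j: "j \<in> J0" for j
  proof -
    have c: "cmod (inner_on I (f j) (e k)) = cmod (inner_on I (e k) (f j))" for k
      using complex_mod_cnj[of "inner_on I (e k) (f j)"] unfolding inner_on_cnj .
    have "(\<Sum>k\<in>K0. w k j) \<le> (\<Sum>i\<in>I. (cmod (f j i))\<^sup>2)"
      unfolding w_def c by (rule bessel[OF f0(1) on])
    also have "complex_of_real (\<Sum>i\<in>I. (cmod (f j i))\<^sup>2) = 1"
      unfolding inner_on_self[symmetric] using has_dec_orthonormal[OF s] j by (simp add: orthonormalD J0_def)
    then have "(\<Sum>i\<in>I. (cmod (f j i))\<^sup>2) = 1" by (simp only: of_real_eq_1_iff)
    finally show ?thesis .
  qed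
  have "(\<Sum>k\<in>K0. \<Sum>j\<in>J0. w k j * r k * ln (s j)) - (\<Sum>k\<in>K0. r k * ln (r k)) =
      (\<Sum>k\<in>K0. \<Sum>j\<in>J0. w k j * (r k * (ln (s j) - ln (r k))))"
  proof -
    have "(\<Sum>k\<in>K0. r k * ln (r k)) = (\<Sum>k\<in>K0. \<Sum>j\<in>J0. w k j * (r k * ln (r k)))"
      by (simp add: W sum_distrib_right[symmetric])
    then show ?thesis by (simp add: sum_subtractf algebra_simps)
  qed
  also have "\<dots> \<le> (\<Sum>k\<in>K0. \<Sum>j\<in>J0. w k j * (s j - r k))"
  proof (intro sum_mono mult_left_mono)
    fix k j assume kj: "k \<in> K0" "j \<in> J0"
    have "ln (s j / r k) \<le> s j / r k - 1" using pos kj by (intro ln_le_minus_one) auto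
    then have "r k * (ln (s j) - ln (r k)) \<le> r k * (s j / r k - 1)"
      using pos(1)[OF kj(1)] pos(2)[OF kj(2)] by (intro mult_left_mono) (simp_all add: ln_div)
    then show "r k * (ln (s j) - ln (r k)) \<le> s j - r k"
      using pos(1)[OF kj(1)] by (simp add: right_diff_distrib)
    show "0 \<le> w k j" by (simp add: w_def)
  qed
  also have "\<dots> = (\<Sum>j\<in>J0. s j * (\<Sum>k\<in>K0. w k j)) - (\<Sum>k\<in>K0. r k * (\<Sum>j\<in>J0. w k j))"
    unfolding sum_distrib_left by (subst (2) sum.swap) (simp add: sum_subtractf algebra_simps)
  also have "\<dots> \<le> (\<Sum>j\<in>J0. s j * 1) - (\<Sum>k\<in>K0. r k * 1)"
    by (intro diff_mono sum_mono mult_left_mono W') (auto simp: W dest: pos)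
  also have "\<dots> \<le> 0" using tr e by simp
  finally show ?thesis
    unfolding cross_split[OF fin(2,3) r s supp] e(1) by (simp add: w_def K0_def J0_def)
qed


section \<open>Block structure of Markov states\<close>

definition block_index :: "nat \<Rightarrow> (nat \<Rightarrow> 'p set) \<Rightarrow> (nat \<Rightarrow> 'q set) \<Rightarrow> (nat \<times> 'p \<times> 'q) set" where
  "block_index N P Q = (SIGMA j:{..<N}. P j \<times> Q j)"

definition block_tensor :: "(nat \<Rightarrow> 'k \<Rightarrow> 'p \<Rightarrow> complex) \<Rightarrow> (nat \<Rightarrow> 'l \<Rightarrow> 'q \<Rightarrow> complex) \<Rightarrow>
    nat \<times> 'k \<times> 'l \<Rightarrow> nat \<times> 'p \<times> 'q \<Rightarrow> complex" where
  "block_tensor u v = (\<lambda>(j, k, l) (j', a, b). if j = j' then u j k a * v j l b else 0)"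

definition block_kernel :: "(nat \<Rightarrow> real) \<Rightarrow> (nat \<Rightarrow> 'p \<Rightarrow> 'p \<Rightarrow> complex) \<Rightarrow> (nat \<Rightarrow> 'q \<Rightarrow> 'q \<Rightarrow> complex) \<Rightarrow>
    nat \<times> 'p \<times> 'q \<Rightarrow> nat \<times> 'p \<times> 'q \<Rightarrow> complex" where
  "block_kernel p \<sigma> \<tau> = (\<lambda>(j, a, b) (j', a', b').
     if j = j' then of_real (p j) * \<sigma> j a a' * \<tau> j b b' else 0)"

definition block_val :: "(nat \<Rightarrow> real) \<Rightarrow> (nat \<Rightarrow> 'k \<Rightarrow> real) \<Rightarrow> (nat \<Rightarrow> 'l \<Rightarrow> real) \<Rightarrow> nat \<times> 'k \<times> 'l \<Rightarrow> real" where
  "block_val p s t = (\<lambda>(j, k, l). p j * s j k * t j l)"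

text \<open>The diagonal block j of M, traced over its second factor. Only diagonal blocks are kept,
  since a block-diagonal logarithm does not see the others.\<close>

definition marg1 :: "(nat \<Rightarrow> 'q set) \<Rightarrow> (nat \<times> 'p \<times> 'q \<Rightarrow> nat \<times> 'p \<times> 'q \<Rightarrow> complex) \<Rightarrow>
    nat \<Rightarrow> 'p \<Rightarrow> 'p \<Rightarrow> complex" where
  "marg1 Q M j a a' = (\<Sum>b\<in>Q j. M (j, a, b) (j, a', b))"

definition marg2 :: "(nat \<Rightarrow> 'p set) \<Rightarrow> (nat \<times> 'p \<times> 'q \<Rightarrow> nat \<times> 'p \<times> 'q \<Rightarrow> complex) \<Rightarrow>
    nat \<Rightarrow> 'q \<Rightarrow> 'q \<Rightarrow> complex" where
  "marg2 P M j b b' = (\<Sum>a\<in>P j. M (j, a, b) (j, a, b'))"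

lemma block_index_iff: "(j, a, b) \<in> block_index N P Q \<longleftrightarrow> j < N \<and> a \<in> P j \<and> b \<in> Q j"
  by (auto simp: block_index_def)

lemma finite_block_index: "\<forall>j<N. finite (P j) \<Longrightarrow> \<forall>j<N. finite (Q j) \<Longrightarrow> finite (block_index N P Q)"
  by (auto simp: block_index_def)

lemma sum_block_index:
  assumes "\<forall>j<N. finite (P j)" "\<forall>j<N. finite (Q j)"
  shows "(\<Sum>x\<in>block_index N P Q. f x) = (\<Sum>j<N. \<Sum>a\<in>P j. \<Sum>b\<in>Q j. f (j, a, b))"
proof -
  have "(\<Sum>x\<in>block_index N P Q. f x) = (\<Sum>j<N. \<Sum>y\<in>P j \<times> Q j. f (j, y))"
    unfolding block_index_def using assms by (subst sum.Sigma) auto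
  then show ?thesis by (simp add: sum.cartesian_product')
qed

lemma sum_block_index_block:
  assumes "\<forall>j<N. finite (P j)" "\<forall>j<N. finite (Q j)" "j < N"
  shows "(\<Sum>x\<in>block_index N P Q. if fst x = j then f x else 0) = (\<Sum>a\<in>P j. \<Sum>b\<in>Q j. f (j, a, b))"
proof -
  have "(\<Sum>x\<in>block_index N P Q. if fst x = j then f x else 0) =
      (\<Sum>i<N. if i = j then \<Sum>a\<in>P j. \<Sum>b\<in>Q j. f (j, a, b) else 0)"
    unfolding sum_block_index[of N P Q, OF assms(1,2)] by (intro sum.cong refl) auto
  then show ?thesis using assms(3) by simp
qed

lemma orthonormal_block_tensor:
  assumes fin: "\<forall>j<N. finite (P j)" "\<forall>j<N. finite (Q j)"
    and u: "\<And>j. j < N \<Longrightarrow> orthonormal (P j) (K j) (u j)" and v: "\<And>j. j < N \<Longrightarrow> orthonormal (Q j) (L j) (v j)"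
  shows "orthonormal (block_index N P Q) (block_index N K L) (block_tensor u v)"
  unfolding orthonormal_def
proof (intro ballI)
  fix x y assume x: "x \<in> block_index N K L" and y: "y \<in> block_index N K L"
  obtain j k l where xe: "x = (j, k, l)" "j < N" "k \<in> K j" "l \<in> L j" using x by (auto simp: block_index_def)
  obtain j' k' l' where ye: "y = (j', k', l')" "j' < N" "k' \<in> K j'" "l' \<in> L j'" using y by (auto simp: block_index_def)
  show "inner_on (block_index N P Q) (block_tensor u v x) (block_tensor u v y) = (if x = y then 1 else 0)"
  proof (cases "j = j'")
    case True
    have "inner_on (block_index N P Q) (block_tensor u v x) (block_tensor u v y) =
        (\<Sum>z\<in>block_index N P Q. if fst z = j then
           case z of (i, a, b) \<Rightarrow> (cnj (u j k a) * u j k' a) * (cnj (v j l b) * v j l' b) else 0)"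
      unfolding inner_on_def xe(1) ye(1) block_tensor_def True by (intro sum.cong refl) auto
    also have "\<dots> = inner_on (P j) (u j k) (u j k') * inner_on (Q j) (v j l) (v j l')"
      unfolding sum_block_index_block[of N P Q, OF fin xe(2)] inner_on_def sum_product by simp
    also have "\<dots> = (if x = y then 1 else 0)"
      using xe ye u[OF xe(2)] v[OF xe(2)] True by (auto simp: orthonormalD)
    finally show ?thesis .
  next
    case False
    then have "inner_on (block_index N P Q) (block_tensor u v x) (block_tensor u v y) = 0"
      unfolding inner_on_def xe(1) ye(1) block_tensor_def by (intro sum.neutral) auto
    then show ?thesis using False xe ye by simp
  qed
qed

text \<open>Stated for general families of vectors, so that it yields both the eigen-decomposition
  of a block kernel and, with all eigenvalues 1, the completeness of the product vectors.\<close>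

lemma block_kernel_expand:
  assumes fin: "\<forall>j<N. finite (K j)" "\<forall>j<N. finite (L j)"
    and \<sigma>: "\<And>j a a'. j < N \<Longrightarrow> a \<in> P j \<Longrightarrow> a' \<in> P j \<Longrightarrow>
      \<sigma> j a a' = (\<Sum>k\<in>K j. of_real (s j k) * u j k a * cnj (u j k a'))"
    and \<tau>: "\<And>j b b'. j < N \<Longrightarrow> b \<in> Q j \<Longrightarrow> b' \<in> Q j \<Longrightarrow>
      \<tau> j b b' = (\<Sum>l\<in>L j. of_real (t j l) * v j l b * cnj (v j l b'))"
    and xy: "x \<in> block_index N P Q" "y \<in> block_index N P Q"
  shows "block_kernel p \<sigma> \<tau> x y = (\<Sum>z\<in>block_index N K L. of_real (block_val p s t z) * block_tensor u v z x * cnj (block_tensor u v z y))"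
proof -
  obtain j a b where xe: "x = (j, a, b)" "j < N" "a \<in> P j" "b \<in> Q j" using xy by (auto simp: block_index_def)
  obtain j' a' b' where ye: "y = (j', a', b')" "j' < N" "a' \<in> P j'" "b' \<in> Q j'" using xy by (auto simp: block_index_def)
  show ?thesis
  proof (cases "j = j'")
    case True
    have "(\<Sum>z\<in>block_index N K L. of_real (block_val p s t z) * block_tensor u v z x * cnj (block_tensor u v z y)) =
        (\<Sum>z\<in>block_index N K L. if fst z = j then
           case z of (i, k, l) \<Rightarrow> of_real (p j) * ((of_real (s j k) * u j k a * cnj (u j k a')) *
             (of_real (t j l) * v j l b * cnj (v j l b'))) else 0)"
      unfolding xe(1) ye(1) block_tensor_def block_val_def True by (intro sum.cong refl) (auto simp: mult_ac)
    also have "\<dots> = of_real (p j) * ((\<Sum>k\<in>K j. of_real (s j k) * u j k a * cnj (u j k a')) *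
        (\<Sum>l\<in>L j. of_real (t j l) * v j l b * cnj (v j l b')))"
      unfolding sum_block_index_block[of N K L, OF fin xe(2)] sum_product unfolding sum_distrib_left by simp
    also have "\<dots> = of_real (p j) * (\<sigma> j a a' * \<tau> j b b')"
      using xe ye True by (simp add: \<sigma> \<tau>)
    finally show ?thesis using True by (simp add: block_kernel_def xe ye)
  next
    case False
    then have "(\<Sum>z\<in>block_index N K L. of_real (block_val p s t z) * block_tensor u v z x * cnj (block_tensor u v z y)) = 0"
      unfolding xe(1) ye(1) block_tensor_def by (intro sum.neutral) auto
    then show ?thesis using False by (simp add: block_kernel_def xe ye)
  qed
qed

lemma dec_block_tensor:
  assumes fin: "\<forall>j<N. finite (P j)" "\<forall>j<N. finite (Q j)"
    "\<forall>j<N. finite (K j)" "\<forall>j<N. finite (L j)"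
    and u: "\<And>j. j < N \<Longrightarrow> has_dec (P j) (K j) (u j) (s j) (\<sigma> j)"
    and v: "\<And>j. j < N \<Longrightarrow> has_dec (Q j) (L j) (v j) (t j) (\<tau> j)"
  shows "has_dec (block_index N P Q) (block_index N K L) (block_tensor u v) (block_val p s t) (block_kernel p \<sigma> \<tau>)"
  unfolding has_dec_def
proof (intro conjI ballI)
  show "orthonormal (block_index N P Q) (block_index N K L) (block_tensor u v)"
    by (rule orthonormal_block_tensor[OF fin(1,2) has_dec_orthonormal[OF u] has_dec_orthonormal[OF v]])
  show "block_kernel p \<sigma> \<tau> x y = (\<Sum>z\<in>block_index N K L. of_real (block_val p s t z) * block_tensor u v z x * cnj (block_tensor u v z y))"
    if "x \<in> block_index N P Q" "y \<in> block_index N P Q" for x y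
    by (rule block_kernel_expand[OF fin(3,4) has_decD[OF u] has_decD[OF v] that])
qed

lemma orthonormal_basis_block_tensor:
  assumes fin: "\<forall>j<N. finite (P j)" "\<forall>j<N. finite (Q j)"
    "\<forall>j<N. finite (K j)" "\<forall>j<N. finite (L j)"
    and u: "\<And>j. j < N \<Longrightarrow> orthonormal_basis (P j) (K j) (u j)" and v: "\<And>j. j < N \<Longrightarrow> orthonormal_basis (Q j) (L j) (v j)"
  shows "orthonormal_basis (block_index N P Q) (block_index N K L) (block_tensor u v)"
  unfolding orthonormal_basis_def
proof (intro conjI ballI)
  show "orthonormal (block_index N P Q) (block_index N K L) (block_tensor u v)"
    by (rule orthonormal_block_tensor[OF fin(1,2) basis_orthonormal[OF u] basis_orthonormal[OF v]])
  fix x y assume xy: "x \<in> block_index N P Q" "y \<in> block_index N P Q"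
  \<comment> \<open>Identity kernels on the factors, whose expansions are the completeness relations
    of \<open>u j\<close> and \<open>v j\<close>.\<close>
  define D :: "nat \<Rightarrow> 'a \<Rightarrow> 'a \<Rightarrow> complex" where "D = (\<lambda>j a a'. if a = a' then 1 else 0)"
  define E :: "nat \<Rightarrow> 'b \<Rightarrow> 'b \<Rightarrow> complex" where "E = (\<lambda>j a a'. if a = a' then 1 else 0)"
  have D: "D j a a' = (\<Sum>k\<in>K j. of_real 1 * u j k a * cnj (u j k a'))"
    if "j < N" "a \<in> P j" "a' \<in> P j" for j a a' using u[OF that(1)] that by (simp add: D_def orthonormal_basis_def)
  have E: "E j a a' = (\<Sum>k\<in>L j. of_real 1 * v j k a * cnj (v j k a'))"
    if "j < N" "a \<in> Q j" "a' \<in> Q j" for j a a' using v[OF that(1)] that by (simp add: E_def orthonormal_basis_def)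
  have "(\<Sum>z\<in>block_index N K L. block_tensor u v z x * cnj (block_tensor u v z y)) = block_kernel (\<lambda>_. 1) D E x y"
    by (subst block_kernel_expand[OF fin(3,4) D E xy]) (simp_all add: block_val_def case_prod_unfold)
  also have "\<dots> = (if x = y then 1 else 0)"
    using xy by (auto simp: block_kernel_def D_def E_def split: prod.splits)
  finally show "(\<Sum>z\<in>block_index N K L. block_tensor u v z x * cnj (block_tensor u v z y)) = (if x = y then 1 else 0)" .
qed

lemma sum_quad_orthonormal_basis:
  assumes "finite I" "orthonormal_basis I K u"
  shows "(\<Sum>k\<in>K. quad I M (u k)) = (\<Sum>i\<in>I. M i i)"
proof -
  have "(\<Sum>k\<in>K. 1 * quad I M (u k)) = (\<Sum>i\<in>I. \<Sum>j\<in>I. M i j * (if j = i then 1 else 0))"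
    unfolding quad_weighted_sum using assms by (intro sum.cong refl) (simp add: orthonormal_basis_def)
  then show ?thesis using assms by (simp add: if_distrib cong: if_cong)
qed

lemma quad_block_tensor:
  assumes fin: "\<forall>j<N. finite (P j)" "\<forall>j<N. finite (Q j)" and j: "j < N"
  shows "quad (block_index N P Q) M (block_tensor u v (j, k, l)) =
    (\<Sum>a\<in>P j. \<Sum>b\<in>Q j. \<Sum>a'\<in>P j. \<Sum>b'\<in>Q j.
       cnj (u j k a) * cnj (v j l b) * M (j, a, b) (j, a', b') * u j k a' * v j l b')"
proof -
  have "quad (block_index N P Q) M (block_tensor u v (j, k, l)) =
     (\<Sum>x\<in>block_index N P Q. if fst x = j then
        (\<Sum>y\<in>block_index N P Q. if fst y = j then
          cnj (u j k (fst (snd x))) * cnj (v j l (snd (snd x))) * M x y * u j k (fst (snd y)) * v j l (snd (snd y)) else 0) else 0)"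
    unfolding quad_def
  proof (intro sum.cong refl)
    fix x
    show "(\<Sum>y\<in>block_index N P Q. cnj (block_tensor u v (j, k, l) x) * M x y * block_tensor u v (j, k, l) y) =
     (if fst x = j then
        (\<Sum>y\<in>block_index N P Q. if fst y = j then
          cnj (u j k (fst (snd x))) * cnj (v j l (snd (snd x))) * M x y * u j k (fst (snd y)) * v j l (snd (snd y)) else 0) else 0)"
      by (cases x; cases "fst x = j") (auto simp: block_tensor_def intro!: sum.cong sum.neutral split: prod.splits)
  qed
  then show ?thesis by (simp add: sum_block_index_block[of N P Q, OF fin j])
qed

text \<open>Summing over an orthonormal basis of the second factor is a trace over that
  factor.\<close>

lemma quad_block_tensor_marg1:
  assumes fin: "\<forall>j<N. finite (P j)" "\<forall>j<N. finite (Q j)" and j: "j < N"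
    and v: "orthonormal_basis (Q j) L (v j)"
  shows "(\<Sum>l\<in>L. quad (block_index N P Q) M (block_tensor u v (j, k, l))) = quad (P j) (marg1 Q M j) (u j k)"
proof -
  have "quad (block_index N P Q) M (block_tensor u v (j, k, l)) = (\<Sum>a\<in>P j. \<Sum>a'\<in>P j.
      cnj (u j k a) * u j k a' * quad (Q j) (\<lambda>b b'. M (j, a, b) (j, a', b')) (v j l))" for l
    unfolding quad_block_tensor[of N P Q, OF fin j]
    by (subst sum.swap[of _ "P j" "Q j"]) (simp add: quad_def sum_distrib_left mult_ac)
  then have "(\<Sum>l\<in>L. quad (block_index N P Q) M (block_tensor u v (j, k, l))) =
      (\<Sum>l\<in>L. \<Sum>a\<in>P j. \<Sum>a'\<in>P j.
      cnj (u j k a) * u j k a' * quad (Q j) (\<lambda>b b'. M (j, a, b) (j, a', b')) (v j l))" by simp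
  also have "\<dots> = (\<Sum>a\<in>P j. \<Sum>l\<in>L. \<Sum>a'\<in>P j.
      cnj (u j k a) * u j k a' * quad (Q j) (\<lambda>b b'. M (j, a, b) (j, a', b')) (v j l))"
    by (rule sum.swap)
  also have "\<dots> = (\<Sum>a\<in>P j. \<Sum>a'\<in>P j. \<Sum>l\<in>L.
      cnj (u j k a) * u j k a' * quad (Q j) (\<lambda>b b'. M (j, a, b) (j, a', b')) (v j l))"
    by (intro sum.cong refl sum.swap)
  also have "\<dots> = quad (P j) (marg1 Q M j) (u j k)"
    unfolding quad_def[of "P j"] marg1_def sum_distrib_left[symmetric] sum_quad_orthonormal_basis[OF fin(2)[rule_format, OF j] v]
    by (simp add: mult_ac)
  finally show ?thesis .
qed

lemma quad_block_tensor_marg2: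
  assumes fin: "\<forall>j<N. finite (P j)" "\<forall>j<N. finite (Q j)" and j: "j < N"
    and u: "orthonormal_basis (P j) K (u j)"
  shows "(\<Sum>k\<in>K. quad (block_index N P Q) M (block_tensor u v (j, k, l))) = quad (Q j) (marg2 P M j) (v j l)"
proof -
  have "quad (block_index N P Q) M (block_tensor u v (j, k, l)) = (\<Sum>b\<in>Q j. \<Sum>b'\<in>Q j.
      cnj (v j l b) * v j l b' * quad (P j) (\<lambda>a a'. M (j, a, b) (j, a', b')) (u j k))" for k
  proof -
    have "quad (block_index N P Q) M (block_tensor u v (j, k, l)) = (\<Sum>b\<in>Q j. \<Sum>a\<in>P j. \<Sum>a'\<in>P j. \<Sum>b'\<in>Q j.
       cnj (u j k a) * cnj (v j l b) * M (j, a, b) (j, a', b') * u j k a' * v j l b')"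
      unfolding quad_block_tensor[of N P Q, OF fin j] by (rule sum.swap)
    also have "\<dots> = (\<Sum>b\<in>Q j. \<Sum>a\<in>P j. \<Sum>b'\<in>Q j. \<Sum>a'\<in>P j.
       cnj (u j k a) * cnj (v j l b) * M (j, a, b) (j, a', b') * u j k a' * v j l b')"
      by (intro sum.cong refl sum.swap)
    also have "\<dots> = (\<Sum>b\<in>Q j. \<Sum>b'\<in>Q j. \<Sum>a\<in>P j. \<Sum>a'\<in>P j.
       cnj (u j k a) * cnj (v j l b) * M (j, a, b) (j, a', b') * u j k a' * v j l b')"
      by (intro sum.cong refl sum.swap)
    finally show ?thesis by (simp add: quad_def sum_distrib_left mult_ac)
  qed
  then have "(\<Sum>k\<in>K. quad (block_index N P Q) M (block_tensor u v (j, k, l))) =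
      (\<Sum>k\<in>K. \<Sum>b\<in>Q j. \<Sum>b'\<in>Q j.
      cnj (v j l b) * v j l b' * quad (P j) (\<lambda>a a'. M (j, a, b) (j, a', b')) (u j k))" by simp
  also have "\<dots> = (\<Sum>b\<in>Q j. \<Sum>k\<in>K. \<Sum>b'\<in>Q j.
      cnj (v j l b) * v j l b' * quad (P j) (\<lambda>a a'. M (j, a, b) (j, a', b')) (u j k))"
    by (rule sum.swap)
  also have "\<dots> = (\<Sum>b\<in>Q j. \<Sum>b'\<in>Q j. \<Sum>k\<in>K.
      cnj (v j l b) * v j l b' * quad (P j) (\<lambda>a a'. M (j, a, b) (j, a', b')) (u j k))"
    by (intro sum.cong refl sum.swap)
  also have "\<dots> = quad (Q j) (marg2 P M j) (v j l)"
    unfolding quad_def[of "Q j"] marg2_def sum_distrib_left[symmetric] sum_quad_orthonormal_basis[OF fin(1)[rule_format, OF j] u]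
    by (simp add: mult_ac)
  finally show ?thesis .
qed

text \<open>The logarithm of a direct sum of products splits: on a product eigenvector it is
  \<open>ln (p j) + ln (s j k) + ln (t j l)\<close>. Each summand depends on part of the label only,
  so summing over the rest by completeness leaves a marginal of M.\<close>

lemma cross_block_tensor:
  assumes fin: "\<forall>j<N. finite (P j)" "\<forall>j<N. finite (Q j)"
    "\<forall>j<N. finite (K j)" "\<forall>j<N. finite (L j)"
    and u: "\<And>j. j < N \<Longrightarrow> orthonormal_basis (P j) (K j) (u j)" and v: "\<And>j. j < N \<Longrightarrow> orthonormal_basis (Q j) (L j) (v j)"
    and nn: "\<And>j. j < N \<Longrightarrow> p j \<ge> 0" "\<And>j k. j < N \<Longrightarrow> k \<in> K j \<Longrightarrow> s j k \<ge> 0"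
      "\<And>j l. j < N \<Longrightarrow> l \<in> L j \<Longrightarrow> t j l \<ge> 0"
    and z: "\<And>x. x \<in> block_index N K L \<Longrightarrow> block_val p s t x = 0 \<Longrightarrow> quad (block_index N P Q) M (block_tensor u v x) = 0"
  shows "(\<Sum>x\<in>block_index N K L. ln (block_val p s t x) * Re (quad (block_index N P Q) M (block_tensor u v x))) =
     (\<Sum>j<N. ln (p j) * Re (\<Sum>a\<in>P j. marg1 Q M j a a))
   + (\<Sum>j<N. \<Sum>k\<in>K j. ln (s j k) * Re (quad (P j) (marg1 Q M j) (u j k)))
   + (\<Sum>j<N. \<Sum>l\<in>L j. ln (t j l) * Re (quad (Q j) (marg2 P M j) (v j l)))"
proof -
  define w where "w = (\<lambda>x. Re (quad (block_index N P Q) M (block_tensor u v x)))"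
  have w1: "(\<Sum>l\<in>L j. w (j, k, l)) = Re (quad (P j) (marg1 Q M j) (u j k))" if "j < N" for j k
    unfolding w_def Re_sum[symmetric] quad_block_tensor_marg1[of N P Q j "L j" v, OF fin(1,2) that v[OF that]] ..
  have w2: "(\<Sum>k\<in>K j. w (j, k, l)) = Re (quad (Q j) (marg2 P M j) (v j l))" if "j < N" for j l
    unfolding w_def Re_sum[symmetric] quad_block_tensor_marg2[of N P Q j "K j" u, OF fin(1,2) that u[OF that]] ..
  have w0: "(\<Sum>k\<in>K j. Re (quad (P j) (marg1 Q M j) (u j k))) = Re (\<Sum>a\<in>P j. marg1 Q M j a a)"
    if "j < N" for j
    unfolding Re_sum[symmetric] sum_quad_orthonormal_basis[OF fin(1)[rule_format, OF that] u[OF that]] ..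
  \<comment> \<open>The logarithm of a product is split for positive factors; where the product is
    zero, hypothesis \<open>z\<close> makes the weight zero, so both sides vanish whatever the
    separate logarithms are.\<close>
  have split: "ln (p j * s j k * t j l) * w (j, k, l) = ln (p j) * w (j, k, l) + ln (s j k) * w (j, k, l) + ln (t j l) * w (j, k, l)"
    if "j < N" "k \<in> K j" "l \<in> L j" for j k l
  proof (cases "p j * s j k * t j l = 0")
    case True
    then have "w (j, k, l) = 0" using z[of "(j, k, l)"] that by (simp add: w_def block_val_def block_index_iff)
    then show ?thesis by simp
  next
    case False
    then have "p j > 0" "s j k > 0" "t j l > 0" using nn that by (auto simp: less_le)
    then show ?thesis by (simp add: ln_mult algebra_simps)
  qed
  have "(\<Sum>x\<in>block_index N K L. ln (block_val p s t x) * w x) =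
      (\<Sum>j<N. \<Sum>k\<in>K j. \<Sum>l\<in>L j. ln (p j) * w (j, k, l) + ln (s j k) * w (j, k, l) + ln (t j l) * w (j, k, l))"
    unfolding sum_block_index[of N K L, OF fin(3,4)] by (intro sum.cong refl) (simp add: block_val_def split)
  also have "\<dots> = (\<Sum>j<N. ln (p j) * (\<Sum>k\<in>K j. \<Sum>l\<in>L j. w (j, k, l)))
      + (\<Sum>j<N. \<Sum>k\<in>K j. ln (s j k) * (\<Sum>l\<in>L j. w (j, k, l)))
      + (\<Sum>j<N. \<Sum>k\<in>K j. \<Sum>l\<in>L j. ln (t j l) * w (j, k, l))"
    by (simp add: sum.distrib sum_distrib_left)
  also have "(\<Sum>j<N. \<Sum>k\<in>K j. \<Sum>l\<in>L j. ln (t j l) * w (j, k, l)) =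
      (\<Sum>j<N. \<Sum>l\<in>L j. ln (t j l) * (\<Sum>k\<in>K j. w (j, k, l)))"
    by (intro sum.cong refl) (subst sum.swap, simp add: sum_distrib_left)
  also have "(\<Sum>x\<in>block_index N K L. ln (block_val p s t x) * w x) =
      (\<Sum>x\<in>block_index N K L. ln (block_val p s t x) * Re (quad (block_index N P Q) M (block_tensor u v x)))"
    by (simp add: w_def)
  finally show ?thesis by (simp add: w0 w1 w2)
qed


section \<open>Markov kernels in block coordinates and the central inequality\<close>

definition ptrace_snd :: "'b set \<Rightarrow> ('a \<times> 'b \<Rightarrow> 'a \<times> 'b \<Rightarrow> complex) \<Rightarrow> 'a \<Rightarrow> 'a \<Rightarrow> complex" where
  "ptrace_snd B M a a' = (\<Sum>b\<in>B. M (a, b) (a', b))"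

text \<open>Triples nest to the right, so the last factor is not the second component of a pair and
  gets its own partial trace.\<close>

definition trace_last :: "'z set \<Rightarrow> ('x \<times> 't \<times> 'z \<Rightarrow> 'x \<times> 't \<times> 'z \<Rightarrow> complex) \<Rightarrow>
    'x \<times> 't \<Rightarrow> 'x \<times> 't \<Rightarrow> complex" where
  "trace_last Z M = (\<lambda>(x, t) (x', t'). \<Sum>z\<in>Z. M (x, t, z) (x', t', z))"

text \<open>A Markov state after the basis of the middle system has been rotated and its indices
  renamed to triples (block, left, right).\<close>

definition markov_ker :: "(nat \<Rightarrow> real) \<Rightarrow> (nat \<Rightarrow> 'x \<times> 'l \<Rightarrow> 'x \<times> 'l \<Rightarrow> complex) \<Rightarrow>
    (nat \<Rightarrow> 'r \<times> 'z \<Rightarrow> 'r \<times> 'z \<Rightarrow> complex) \<Rightarrow>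
    'x \<times> (nat \<times> 'l \<times> 'r) \<times> 'z \<Rightarrow> 'x \<times> (nat \<times> 'l \<times> 'r) \<times> 'z \<Rightarrow> complex" where
  "markov_ker p \<sigma> \<tau> = (\<lambda>(x, (j, l, r), z) (x', (j', l', r'), z').
     if j = j' then of_real (p j) * \<sigma> j (x, l) (x', l') * \<tau> j (r, z) (r', z') else 0)"

lemma supp_le_reindex:
  assumes h: "bij_betw h P I" and supp: "supp_le I R S"
  shows "supp_le P (\<lambda>p q. R (h p) (h q)) (\<lambda>p q. S (h p) (h q))"
  unfolding supp_le_def
proof (intro allI impI)
  fix v
  define g where "g = inv_into P h"
  have gh: "g (h p) = p" if "p \<in> P" for p
    using that h by (simp add: g_def bij_betw_def inv_into_f_f)
  have q: "quad P (\<lambda>p q. M (h p) (h q)) v = quad I M (\<lambda>i. v (g i))" for M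
  proof -
    have "quad P (\<lambda>p q. M (h p) (h q)) v = quad P (\<lambda>p q. M (h p) (h q)) (\<lambda>p. v (g (h p)))"
      by (simp add: quad_def gh)
    also have "\<dots> = quad I M (\<lambda>i. v (g i))" by (rule quad_reindex[OF h])
    finally show ?thesis .
  qed
  assume "quad P (\<lambda>p q. S (h p) (h q)) v = 0"
  then show "quad P (\<lambda>p q. R (h p) (h q)) v = 0" using supp by (simp add: q supp_le_def)
qed

lemma supp_le_trace_last:
  assumes fin: "finite X" "finite T" "finite Z" "finite J"
    and s: "has_dec (X \<times> T \<times> Z) J f s S" and sn: "\<And>j. j \<in> J \<Longrightarrow> s j \<ge> 0"
    and supp: "supp_le (X \<times> T \<times> Z) R S"
  shows "supp_le (X \<times> T) (trace_last Z R) (trace_last Z S)"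
proof -
  \<comment> \<open>Moving the last factor to the front reduces the claim to
    \<open>supp_le_ptrace_fst\<close>.\<close>
  define h where "h = (\<lambda>(z :: 'c, (x :: 'a, t :: 'b)). (x, t, z))"
  have h: "bij_betw h (Z \<times> (X \<times> T)) (X \<times> T \<times> Z)"
    by (rule bij_betw_byWitness[where f'="\<lambda>(x, t, z). (z, (x, t))"]) (auto simp: h_def)
  have e: "ptrace_fst Z (\<lambda>p q. M (h p) (h q)) = trace_last Z M" for M
    by (auto simp: ptrace_fst_def trace_last_def h_def fun_eq_iff)
  show ?thesis
    using supp_le_ptrace_fst[OF fin(3,4) dec_reindex[OF h s refl] sn supp_le_reindex[OF h supp]] by (simp add: e)
qed

text \<open>After regrouping, S and its marginals on XT, TZ and T are block kernels with the same
  weights \<open>p\<close> and with factor pairs (\<sigma>, \<tau>), (\<sigma>, \<tau>'),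
  (\<sigma>', \<tau>) and (\<sigma>', \<tau>'), primes being partial traces. In log S - log S_XT -
  log S_TZ + log S_T every factor occurs as often with plus as with minus, which is the reason for
  the identity of logarithms. The two entropy inequalities then take care of the pair XT, T and of
  TZ.\<close>

theorem markov_core:
  fixes X :: "'x set" and Z :: "'z set" and N :: nat
    and LL :: "nat \<Rightarrow> 'l set" and RR :: "nat \<Rightarrow> 'r set"
    and R :: "'x \<times> (nat \<times> 'l \<times> 'r) \<times> 'z \<Rightarrow> 'x \<times> (nat \<times> 'l \<times> 'r) \<times> 'z \<Rightarrow> complex"
  defines "T \<equiv> block_index N LL RR"
  assumes fin: "finite X" "finite Z" "\<forall>j<N. finite (LL j)" "\<forall>j<N. finite (RR j)"
    and finK: "finite K0" "finite K1" "finite K2" "finite K3" "finite J"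
    and finS: "\<forall>j<N. finite (KS j)" "\<forall>j<N. finite (KT j)" "\<forall>j<N. finite (KS' j)" "\<forall>j<N. finite (KT' j)"
    and d0: "has_dec (X \<times> T \<times> Z) K0 e0 r0 R" and n0: "\<And>k. k \<in> K0 \<Longrightarrow> r0 k \<ge> 0"
    and d1: "has_dec (X \<times> T) K1 e1 r1 (trace_last Z R)" and n1: "\<And>k. k \<in> K1 \<Longrightarrow> r1 k \<ge> 0"
    and d2: "has_dec (T \<times> Z) K2 e2 r2 (ptrace_fst X R)" and n2: "\<And>k. k \<in> K2 \<Longrightarrow> r2 k \<ge> 0"
    and d3: "has_dec T K3 e3 r3 (ptrace_fst X (trace_last Z R))" and n3: "\<And>k. k \<in> K3 \<Longrightarrow> r3 k \<ge> 0"
    and pn: "\<And>j. j < N \<Longrightarrow> p j \<ge> 0"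
    and u: "\<And>j. j < N \<Longrightarrow> has_dec (X \<times> LL j) (KS j) (u j) (s j) (\<sigma> j)"
      "\<And>j. j < N \<Longrightarrow> orthonormal_basis (X \<times> LL j) (KS j) (u j)" "\<And>j k. j < N \<Longrightarrow> k \<in> KS j \<Longrightarrow> s j k \<ge> 0"
    and v: "\<And>j. j < N \<Longrightarrow> has_dec (RR j \<times> Z) (KT j) (v j) (t j) (\<tau> j)"
      "\<And>j. j < N \<Longrightarrow> orthonormal_basis (RR j \<times> Z) (KT j) (v j)" "\<And>j k. j < N \<Longrightarrow> k \<in> KT j \<Longrightarrow> t j k \<ge> 0"
    and u': "\<And>j. j < N \<Longrightarrow> has_dec (LL j) (KS' j) (u' j) (s' j) (ptrace_fst X (\<sigma> j))"
      "\<And>j. j < N \<Longrightarrow> orthonormal_basis (LL j) (KS' j) (u' j)" "\<And>j k. j < N \<Longrightarrow> k \<in> KS' j \<Longrightarrow> s' j k \<ge> 0"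
    and v': "\<And>j. j < N \<Longrightarrow> has_dec (RR j) (KT' j) (v' j) (t' j) (ptrace_snd Z (\<tau> j))"
      "\<And>j. j < N \<Longrightarrow> orthonormal_basis (RR j) (KT' j) (v' j)" "\<And>j k. j < N \<Longrightarrow> k \<in> KT' j \<Longrightarrow> t' j k \<ge> 0"
    and f: "has_dec (X \<times> T \<times> Z) J f m (markov_ker p \<sigma> \<tau>)" "orthonormal_basis (X \<times> T \<times> Z) J f" "\<And>j. j \<in> J \<Longrightarrow> m j \<ge> 0"
    and z: "\<And>j. j \<in> J \<Longrightarrow> m j = 0 \<Longrightarrow> quad (X \<times> T \<times> Z) R (f j) = 0"
    and tr: "(\<Sum>j\<in>J. m j) = (\<Sum>k\<in>K0. r0 k)"
  shows "(\<Sum>j\<in>J. ln (m j) * Re (quad (X \<times> T \<times> Z) R (f j))) \<le>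
    (\<Sum>k\<in>K1. r1 k * ln (r1 k)) + (\<Sum>k\<in>K2. r2 k * ln (r2 k)) - (\<Sum>k\<in>K3. r3 k * ln (r3 k))"
proof -
  define S where "S = markov_ker p \<sigma> \<tau>"
  have finT: "finite T" unfolding T_def by (rule finite_block_index[OF fin(3,4)])
  have finI: "finite (X \<times> T \<times> Z)" "finite (X \<times> T)" "finite (T \<times> Z)" using fin finT by auto
  have finB: "\<forall>j<N. finite (X \<times> LL j)" "\<forall>j<N. finite (RR j \<times> Z)" using fin by auto
  have fS: "has_dec (X \<times> T \<times> Z) J f m S" unfolding S_def by (rule f(1))
  have supp0: "supp_le (X \<times> T \<times> Z) R S"
    by (rule supp_leI[OF finI(1) finK(1,5) d0 n0 fS f(3,2) z])
  have supp1: "supp_le (X \<times> T) (trace_last Z R) (trace_last Z S)"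
    by (rule supp_le_trace_last[OF fin(1) finT fin(2) finK(5) fS f(3) supp0])
  have supp2: "supp_le (T \<times> Z) (ptrace_fst X R) (ptrace_fst X S)"
    by (rule supp_le_ptrace_fst[OF fin(1) finK(5) fS f(3) supp0])

  \<comment> \<open>The block label moves to the front, \<open>x\<close> joins the left factor and
    \<open>z\<close> the right one; the maps \<open>g0\<close>, \<open>g1\<close>, \<open>g2\<close>
    are the inverses.\<close>
  define h0 where "h0 = (\<lambda>(x :: 'x, (j :: nat, l :: 'l, r :: 'r), z :: 'z). (j, (x, l), (r, z)))"
  define h1 where "h1 = (\<lambda>(x :: 'x, (j :: nat, l :: 'l, r :: 'r)). (j, (x, l), r))"
  define h2 where "h2 = (\<lambda>((j :: nat, l :: 'l, r :: 'r), z :: 'z). (j, l, (r, z)))"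
  define g0 where "g0 = (\<lambda>(j :: nat, (x :: 'x, l :: 'l), (r :: 'r, z :: 'z)). (x, (j, l, r), z))"
  define g1 where "g1 = (\<lambda>(j :: nat, (x :: 'x, l :: 'l), r :: 'r). (x, (j, l, r)))"
  define g2 where "g2 = (\<lambda>(j :: nat, l :: 'l, (r :: 'r, z :: 'z)). ((j, l, r), z))"
  have h0: "bij_betw h0 (X \<times> T \<times> Z) (block_index N (\<lambda>j. X \<times> LL j) (\<lambda>j. RR j \<times> Z))"
    by (rule bij_betw_byWitness[where f'=g0]) (auto simp: h0_def g0_def T_def block_index_iff)
  have h1: "bij_betw h1 (X \<times> T) (block_index N (\<lambda>j. X \<times> LL j) RR)"
    by (rule bij_betw_byWitness[where f'=g1]) (auto simp: h1_def g1_def T_def block_index_iff)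
  have h2: "bij_betw h2 (T \<times> Z) (block_index N LL (\<lambda>j. RR j \<times> Z))"
    by (rule bij_betw_byWitness[where f'=g2]) (auto simp: h2_def g2_def T_def block_index_iff)
  have gh: "g0 (h0 a) = a" "g1 (h1 b) = b" "g2 (h2 c) = c" for a b c
    by (auto simp: h0_def g0_def h1_def g1_def h2_def g2_def split: prod.splits)

  \<comment> \<open>Product eigenvectors of S and of its three marginals, all built from the same
    four families so that the logarithms can be compared.\<close>
  define b0 where "b0 = (\<lambda>k p. block_tensor u v k (h0 p))"
  define b1 where "b1 = (\<lambda>k p. block_tensor u v' k (h1 p))"
  define b2 where "b2 = (\<lambda>k p. block_tensor u' v k (h2 p))"
  define b3 where "b3 = block_tensor u' v'"
  have c0: "has_dec (X \<times> T \<times> Z) (block_index N KS KT) b0 (block_val p s t) S"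
    unfolding b0_def
    by (rule dec_reindex[OF h0 dec_block_tensor[OF finB finS(1,2) u(1) v(1)]])
       (auto simp: S_def markov_ker_def block_kernel_def h0_def)
  have c1: "has_dec (X \<times> T) (block_index N KS KT') b1 (block_val p s t') (trace_last Z S)"
    unfolding b1_def
    by (rule dec_reindex[OF h1 dec_block_tensor[OF finB(1) fin(4) finS(1,4) u(1) v'(1)]])
       (auto simp: S_def trace_last_def markov_ker_def block_kernel_def h1_def ptrace_snd_def sum_distrib_left)
  have c2: "has_dec (T \<times> Z) (block_index N KS' KT) b2 (block_val p s' t) (ptrace_fst X S)"
    unfolding b2_def
    by (rule dec_reindex[OF h2 dec_block_tensor[OF fin(3) finB(2) finS(3,2) u'(1) v(1)]])
       (auto simp: S_def ptrace_fst_def markov_ker_def block_kernel_def h2_def sum_distrib_left sum_distrib_right)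
  have pull: "(\<Sum>x\<in>X. \<Sum>z\<in>Z. c * A x * B z) = c * sum A X * sum B Z" for c :: complex and A B
    by (simp only: sum_distrib_left[of c A X] sum_product)
  \<comment> \<open>Tracing out both ends factorizes within each block; \<open>pull\<close>
    separates the two sums.\<close>
  have S3: "ptrace_fst X (trace_last Z S) = block_kernel p (\<lambda>j. ptrace_fst X (\<sigma> j)) (\<lambda>j. ptrace_snd Z (\<tau> j))"
    by (auto simp: S_def ptrace_fst_def ptrace_snd_def trace_last_def markov_ker_def block_kernel_def fun_eq_iff pull)
  have c3: "has_dec T (block_index N KS' KT') b3 (block_val p s' t') (ptrace_fst X (trace_last Z S))"
    unfolding S3 b3_def T_def by (rule dec_block_tensor[OF fin(3,4) finS(3,4) u'(1) v'(1)])
  have o1: "orthonormal_basis (X \<times> T) (block_index N KS KT') b1"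
    unfolding b1_def by (rule orthonormal_basis_reindex[OF h1 orthonormal_basis_block_tensor[OF finB(1) fin(4) finS(1,4) u(2) v'(2)]])
  have o2: "orthonormal_basis (T \<times> Z) (block_index N KS' KT) b2"
    unfolding b2_def by (rule orthonormal_basis_reindex[OF h2 orthonormal_basis_block_tensor[OF fin(3) finB(2) finS(3,2) u'(2) v(2)]])
  have o3: "orthonormal_basis T (block_index N KS' KT') b3"
    unfolding b3_def T_def by (rule orthonormal_basis_block_tensor[OF fin(3,4) finS(3,4) u'(2) v'(2)])
  have fb: "finite (block_index N KS KT)" "finite (block_index N KS KT')" "finite (block_index N KS' KT)" "finite (block_index N KS' KT')"
    using finS by (simp_all add: finite_block_index)
  have bn: "block_val p s t' x \<ge> 0" if "x \<in> block_index N KS KT'" for x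
    using that pn u(3) v'(3) by (auto simp: block_val_def block_index_def)
  have bn2: "block_val p s' t x \<ge> 0" if "x \<in> block_index N KS' KT" for x
    using that pn u'(3) v(3) by (auto simp: block_val_def block_index_def)
  have bn3: "block_val p s' t' x \<ge> 0" if "x \<in> block_index N KS' KT'" for x
    using that pn u'(3) v'(3) by (auto simp: block_val_def block_index_def)
  have supp3: "supp_le T (ptrace_fst X (trace_last Z R)) (ptrace_fst X (trace_last Z S))"
    by (rule supp_le_ptrace_fst[OF fin(1) fb(2) c1 bn supp1])

  \<comment> \<open>R and its partial traces in block coordinates. They need not be block diagonal;
    only their marginals enter the expansions below.\<close>
  define M0 where "M0 = (\<lambda>a b. R (g0 a) (g0 b))"
  define M1 where "M1 = (\<lambda>a b. trace_last Z R (g1 a) (g1 b))"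
  define M2 where "M2 = (\<lambda>a b. ptrace_fst X R (g2 a) (g2 b))"
  define M3 where "M3 = ptrace_fst X (trace_last Z R)"
  have q0: "quad (block_index N (\<lambda>j. X \<times> LL j) (\<lambda>j. RR j \<times> Z)) M0 (block_tensor u v k) = quad (X \<times> T \<times> Z) R (b0 k)" for k
    using quad_reindex[OF h0, of M0 "block_tensor u v k"] by (simp add: M0_def gh b0_def)
  have q1: "quad (block_index N (\<lambda>j. X \<times> LL j) RR) M1 (block_tensor u v' k) = quad (X \<times> T) (trace_last Z R) (b1 k)" for k
    using quad_reindex[OF h1, of M1 "block_tensor u v' k"] by (simp add: M1_def gh b1_def)
  have q2: "quad (block_index N LL (\<lambda>j. RR j \<times> Z)) M2 (block_tensor u' v k) = quad (T \<times> Z) (ptrace_fst X R) (b2 k)" for k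
    using quad_reindex[OF h2, of M2 "block_tensor u' v k"] by (simp add: M2_def gh b2_def)
  have q3: "quad (block_index N LL RR) M3 (block_tensor u' v' k) = quad T (ptrace_fst X (trace_last Z R)) (b3 k)" for k
    by (simp add: M3_def b3_def T_def)

  have C0: "(\<Sum>k\<in>block_index N KS KT. ln (block_val p s t k) * Re (quad (X \<times> T \<times> Z) R (b0 k))) =
     (\<Sum>j<N. ln (p j) * Re (\<Sum>a\<in>X \<times> LL j. marg1 (\<lambda>j. RR j \<times> Z) M0 j a a))
   + (\<Sum>j<N. \<Sum>k\<in>KS j. ln (s j k) * Re (quad (X \<times> LL j) (marg1 (\<lambda>j. RR j \<times> Z) M0 j) (u j k)))
   + (\<Sum>j<N. \<Sum>k\<in>KT j. ln (t j k) * Re (quad (RR j \<times> Z) (marg2 (\<lambda>j. X \<times> LL j) M0 j) (v j k)))"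
    unfolding q0[symmetric]
    by (rule cross_block_tensor[OF finB finS(1,2) u(2) v(2) pn u(3) v(3)])
       (auto simp: q0 intro: supp_le_eigvec[OF fb(1) c0 supp0])
  have C1: "(\<Sum>k\<in>block_index N KS KT'. ln (block_val p s t' k) * Re (quad (X \<times> T) (trace_last Z R) (b1 k))) =
     (\<Sum>j<N. ln (p j) * Re (\<Sum>a\<in>X \<times> LL j. marg1 RR M1 j a a))
   + (\<Sum>j<N. \<Sum>k\<in>KS j. ln (s j k) * Re (quad (X \<times> LL j) (marg1 RR M1 j) (u j k)))
   + (\<Sum>j<N. \<Sum>k\<in>KT' j. ln (t' j k) * Re (quad (RR j) (marg2 (\<lambda>j. X \<times> LL j) M1 j) (v' j k)))"
    unfolding q1[symmetric]
    by (rule cross_block_tensor[OF finB(1) fin(4) finS(1,4) u(2) v'(2) pn u(3) v'(3)])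
       (auto simp: q1 intro: supp_le_eigvec[OF fb(2) c1 supp1])
  have C2: "(\<Sum>k\<in>block_index N KS' KT. ln (block_val p s' t k) * Re (quad (T \<times> Z) (ptrace_fst X R) (b2 k))) =
     (\<Sum>j<N. ln (p j) * Re (\<Sum>a\<in>LL j. marg1 (\<lambda>j. RR j \<times> Z) M2 j a a))
   + (\<Sum>j<N. \<Sum>k\<in>KS' j. ln (s' j k) * Re (quad (LL j) (marg1 (\<lambda>j. RR j \<times> Z) M2 j) (u' j k)))
   + (\<Sum>j<N. \<Sum>k\<in>KT j. ln (t j k) * Re (quad (RR j \<times> Z) (marg2 LL M2 j) (v j k)))"
    unfolding q2[symmetric]
    by (rule cross_block_tensor[OF fin(3) finB(2) finS(3,2) u'(2) v(2) pn u'(3) v(3)])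
       (auto simp: q2 intro: supp_le_eigvec[OF fb(3) c2 supp2])
  have C3: "(\<Sum>k\<in>block_index N KS' KT'. ln (block_val p s' t' k) * Re (quad T (ptrace_fst X (trace_last Z R)) (b3 k))) =
     (\<Sum>j<N. ln (p j) * Re (\<Sum>a\<in>LL j. marg1 RR M3 j a a))
   + (\<Sum>j<N. \<Sum>k\<in>KS' j. ln (s' j k) * Re (quad (LL j) (marg1 RR M3 j) (u' j k)))
   + (\<Sum>j<N. \<Sum>k\<in>KT' j. ln (t' j k) * Re (quad (RR j) (marg2 LL M3 j) (v' j k)))"
    unfolding q3[symmetric]
    by (rule cross_block_tensor[OF fin(3,4) finS(3,4) u'(2) v'(2) pn u'(3) v'(3)])
       (auto simp: q3 intro: supp_le_eigvec[OF fb(4) c3 supp3])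
  \<comment> \<open>Tracing out an end of R and then a factor of a block is the same as tracing out
    the enlarged factor at once, so the four expansions share their terms.\<close>
  have m: "marg1 (\<lambda>j. RR j \<times> Z) M0 j = marg1 RR M1 j"
    "marg2 (\<lambda>j. X \<times> LL j) M0 j = marg2 LL M2 j"
    "marg1 (\<lambda>j. RR j \<times> Z) M2 j = marg1 RR M3 j"
    "marg2 (\<lambda>j. X \<times> LL j) M1 j = marg2 LL M3 j" for j
  proof -
    show "marg1 (\<lambda>j. RR j \<times> Z) M0 j = marg1 RR M1 j"
      by (auto simp: fun_eq_iff marg1_def M0_def M1_def g0_def g1_def trace_last_def sum.cartesian_product')
    show "marg2 (\<lambda>j. X \<times> LL j) M0 j = marg2 LL M2 j"
      by (auto simp: fun_eq_iff marg2_def M0_def M2_def g0_def g2_def ptrace_fst_def sum.cartesian_product')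
         (rule sum.swap)
    show "marg1 (\<lambda>j. RR j \<times> Z) M2 j = marg1 RR M3 j"
      by (auto simp: fun_eq_iff marg1_def M2_def M3_def g2_def ptrace_fst_def trace_last_def sum.cartesian_product'
          intro!: sum.cong sum.swap)
    show "marg2 (\<lambda>j. X \<times> LL j) M1 j = marg2 LL M3 j"
      by (auto simp: fun_eq_iff marg2_def M1_def M3_def g1_def ptrace_fst_def trace_last_def sum.cartesian_product')
         (rule sum.swap)
  qed
  have mt: "(\<Sum>a\<in>LL j. marg1 RR M3 j a a) = (\<Sum>a\<in>X \<times> LL j. marg1 RR M1 j a a)" for j
  proof -
    have "(\<Sum>a\<in>LL j. marg1 RR M3 j a a) =
        (\<Sum>l\<in>LL j. \<Sum>x\<in>X. \<Sum>r\<in>RR j. trace_last Z R (x, (j, l, r)) (x, (j, l, r)))"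
      by (simp add: marg1_def M3_def ptrace_fst_def) (intro sum.cong refl sum.swap)
    also have "\<dots> = (\<Sum>x\<in>X. \<Sum>l\<in>LL j. \<Sum>r\<in>RR j. trace_last Z R (x, (j, l, r)) (x, (j, l, r)))"
      by (rule sum.swap)
    finally show ?thesis by (simp add: marg1_def M1_def g1_def sum.cartesian_product')
  qed
  have chain: "(\<Sum>k\<in>block_index N KS KT. ln (block_val p s t k) * Re (quad (X \<times> T \<times> Z) R (b0 k))) =
      (\<Sum>k\<in>block_index N KS KT'. ln (block_val p s t' k) * Re (quad (X \<times> T) (trace_last Z R) (b1 k)))
    + (\<Sum>k\<in>block_index N KS' KT. ln (block_val p s' t k) * Re (quad (T \<times> Z) (ptrace_fst X R) (b2 k)))
    - (\<Sum>k\<in>block_index N KS' KT'. ln (block_val p s' t' k) * Re (quad T (ptrace_fst X (trace_last Z R)) (b3 k)))"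
    unfolding C0 C1 C2 C3 m mt by simp

  \<comment> \<open>The given eigenbasis \<open>f\<close> is exchanged for the product basis;
    \<open>ln 0 = 0\<close> permits \<open>ln\<close> in \<open>dec_cross_fun\<close>.\<close>
  have "(\<Sum>j\<in>J. ln (m j) * Re (quad (X \<times> T \<times> Z) R (f j))) =
      (\<Sum>k\<in>block_index N KS KT. ln (block_val p s t k) * Re (quad (X \<times> T \<times> Z) R (b0 k)))"
    using arg_cong[OF dec_cross_fun[where \<phi>=ln, OF finK(5) fb(1) fS c0, of R], of Re] by simp
  \<comment> \<open>Monotonicity for tracing X out of XT, with T remaining.\<close>
  moreover have "(\<Sum>k\<in>block_index N KS KT'. ln (block_val p s t' k) * Re (quad (X \<times> T) (trace_last Z R) (b1 k)))
    - (\<Sum>k\<in>block_index N KS' KT'. ln (block_val p s' t' k) * Re (quad T (ptrace_fst X (trace_last Z R)) (b3 k)))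
    \<le> (\<Sum>k\<in>K1. r1 k * ln (r1 k)) - (\<Sum>k\<in>K3. r3 k * ln (r3 k))"
    by (rule cross_mono[OF fin(1) finT finK(2) fb(2) finK(4) fb(4) d1 n1 c1 bn o1 d3 n3 c3 bn3 o3 supp1])
  moreover have "(\<Sum>k\<in>block_index N KS' KT. ln (block_val p s' t k) * Re (quad (T \<times> Z) (ptrace_fst X R) (b2 k)))
    \<le> (\<Sum>k\<in>K2. r2 k * ln (r2 k))"
  proof (rule klein[OF finI(3) finK(3) fb(3) d2 n2 c2 bn2 o2 supp2])
    \<comment> \<open>Partial traces preserve the trace, so equality of the traces of S and R passes
      to the system TZ.\<close>
    have t: "(\<Sum>i\<in>T \<times> Z. ptrace_fst X M i i) = (\<Sum>i\<in>X \<times> T \<times> Z. M i i)" for M :: "'x \<times> (nat \<times> 'l \<times> 'r) \<times> 'z \<Rightarrow> _"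
      unfolding ptrace_fst_def by (subst sum.swap) (simp add: sum.cartesian_product')
    have "complex_of_real (\<Sum>j\<in>J. m j) = of_real (\<Sum>k\<in>block_index N KS' KT. block_val p s' t k)"
      unfolding dec_trace[OF fS, symmetric] dec_trace[OF c2, symmetric] t ..
    moreover have "complex_of_real (\<Sum>k\<in>K0. r0 k) = of_real (\<Sum>k\<in>K2. r2 k)"
      unfolding dec_trace[OF d0, symmetric] dec_trace[OF d2, symmetric] t ..
    ultimately show "(\<Sum>k\<in>block_index N KS' KT. block_val p s' t k) \<le> (\<Sum>k\<in>K2. r2 k)"
      using tr unfolding of_real_eq_iff by simp
  qed
  ultimately show ?thesis using chain by linarith
qed


section \<open>The spectral theorem\<close>

lemma sum_swap_pairs:
  "(\<Sum>i\<in>A. \<Sum>j\<in>B. \<Sum>k\<in>C. \<Sum>l\<in>D. f i j k l) = (\<Sum>k\<in>C. \<Sum>l\<in>D. \<Sum>i\<in>A. \<Sum>j\<in>B. f i j k l)"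
proof -
  have "(\<Sum>i\<in>A. \<Sum>j\<in>B. \<Sum>k\<in>C. \<Sum>l\<in>D. f i j k l) = (\<Sum>i\<in>A. \<Sum>k\<in>C. \<Sum>j\<in>B. \<Sum>l\<in>D. f i j k l)"
    by (intro sum.cong refl sum.swap)
  also have "\<dots> = (\<Sum>k\<in>C. \<Sum>i\<in>A. \<Sum>j\<in>B. \<Sum>l\<in>D. f i j k l)" by (rule sum.swap)
  also have "\<dots> = (\<Sum>k\<in>C. \<Sum>i\<in>A. \<Sum>l\<in>D. \<Sum>j\<in>B. f i j k l)" by (intro sum.cong refl sum.swap)
  also have "\<dots> = (\<Sum>k\<in>C. \<Sum>l\<in>D. \<Sum>i\<in>A. \<Sum>j\<in>B. f i j k l)" by (intro sum.cong refl sum.swap)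
  finally show ?thesis .
qed

lemma conj_by_conj_by: "conj_by J V (conj_by I W M) p q = conj_by I (\<lambda>k. lift J V (W k)) M p q"
proof -
  have "conj_by J V (conj_by I W M) p q =
      (\<Sum>i\<in>J. \<Sum>j\<in>J. \<Sum>k\<in>I. \<Sum>l\<in>I. V i p * W k i * M k l * cnj (W l j) * cnj (V j q))"
    unfolding conj_by_def by (simp add: sum_distrib_left sum_distrib_right mult_ac)
  also have "\<dots> = (\<Sum>k\<in>I. \<Sum>l\<in>I. \<Sum>i\<in>J. \<Sum>j\<in>J. V i p * W k i * M k l * cnj (W l j) * cnj (V j q))"
    by (rule sum_swap_pairs)
  also have "\<dots> = conj_by I (\<lambda>k. lift J V (W k)) M p q"
    unfolding conj_by_def lift_def
    by (intro sum.cong refl) (simp add: sum_distrib_left sum_distrib_right mult_ac)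
  finally show ?thesis .
qed

text \<open>Over the complex numbers a matrix of positive size has nonempty spectrum. Hermitian
  symmetry makes the quadratic form at an eigenvector equal to its conjugate, so the eigenvalue is
  real.\<close>

lemma hermitian_eigvec:
  fixes M :: "nat \<Rightarrow> nat \<Rightarrow> complex"
  assumes n: "n > 0" and herm: "\<And>i j. i < n \<Longrightarrow> j < n \<Longrightarrow> M j i = cnj (M i j)"
  obtains v c where "inner_on {..<n} v v = 1" "\<And>i. i < n \<Longrightarrow> (\<Sum>j<n. M i j * v j) = complex_of_real c * v i"
proof -
  define A where "A = mat n n (\<lambda>(i, j). M i j)"
  have A: "A \<in> carrier_mat n n" by (simp add: A_def)
  obtain k w where ev: "eigenvector A w k"
    using spectrum_non_empty[OF A n] by (auto simp: spectrum_def eigenvalue_def)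
  then have w: "dim_vec w = n" "w \<noteq> 0\<^sub>v n" "A *\<^sub>v w = k \<cdot>\<^sub>v w"
    using A by (auto simp: eigenvector_def)
  define x where "x = (\<lambda>i. w $ i)"
  have x: "(\<Sum>j<n. M i j * x j) = k * x i" if "i < n" for i
  proof -
    have "(A *\<^sub>v w) $ i = (\<Sum>j<n. M i j * x j)"
      using that w(1) by (simp add: A_def scalar_prod_def x_def atLeast0LessThan)
    then show ?thesis using that w(1,3) by (simp add: x_def)
  qed
  define d where "d = (\<Sum>i<n. (cmod (x i))\<^sup>2)"
  have "d \<noteq> 0"
  proof
    assume "d = 0"
    then have "\<forall>i<n. x i = 0" by (auto simp: d_def sum_nonneg_eq_0_iff)
    then have "w = 0\<^sub>v n" using w(1) by (intro eq_vecI) (auto simp: x_def)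
    then show False using w by simp
  qed
  then have d: "d > 0" by (auto simp: d_def less_le intro!: sum_nonneg)
  have xx: "inner_on {..<n} x x = of_real d" by (simp add: inner_on_self d_def)
  have q: "quad {..<n} M x = k * of_real d"
  proof -
    have "quad {..<n} M x = (\<Sum>i<n. cnj (x i) * (\<Sum>j<n. M i j * x j))"
      by (simp add: quad_def sum_distrib_left mult_ac)
    also have "\<dots> = (\<Sum>i<n. cnj (x i) * (k * x i))" by (simp add: x)
    also have "\<dots> = k * inner_on {..<n} x x" by (simp add: inner_on_def sum_distrib_left mult_ac)
    finally show ?thesis by (simp add: xx)
  qed
  have "cnj (quad {..<n} M x) = (\<Sum>i<n. \<Sum>j<n. cnj (cnj (x i) * M i j * x j))"
    by (simp add: quad_def)
  also have "\<dots> = (\<Sum>i<n. \<Sum>j<n. cnj (x j) * M j i * x i)"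
  proof (intro sum.cong refl)
    fix i j assume "i \<in> {..<n}" "j \<in> {..<n}"
    then show "cnj (cnj (x i) * M i j * x j) = cnj (x j) * M j i * x i"
      using herm[of i j] by (simp add: mult_ac)
  qed
  also have "\<dots> = quad {..<n} M x" unfolding quad_def by (rule sum.swap)
  finally have "cnj k = k" using d by (simp add: q)
  then have k: "k = of_real (Re k)" by (simp add: complex_eq_iff)
  obtain e where e: "e * e * d = (1 :: real)"
  proof
    show "(1 / sqrt d) * (1 / sqrt d) * d = 1" using d by simp
  qed
  define v where "v = (\<lambda>i. of_real e * x i)"
  have "inner_on {..<n} v v = of_real (e * e) * inner_on {..<n} x x"
    by (simp add: v_def inner_on_def sum_distrib_left mult_ac)
  also have "\<dots> = 1" unfolding xx of_real_mult[symmetric] e by simp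
  finally show thesis
  proof (rule that)
    fix i assume i: "i < n"
    have "(\<Sum>j<n. M i j * v j) = of_real e * (\<Sum>j<n. M i j * x j)"
      by (simp add: v_def sum_distrib_left mult_ac)
    then show "(\<Sum>j<n. M i j * v j) = of_real (Re k) * v i"
      unfolding x[OF i] v_def k[symmetric] by simp
  qed
qed

text \<open>If \<open>v\<close> is the unit vector \<open>n\<close>, then \<open>c = 0\<close> below and \<open>g = 2 / 0 = 0\<close> makes \<open>W\<close> the identity.\<close>

lemma householder:
  fixes v :: "nat \<Rightarrow> complex"
  assumes n: "n \<in> I" "finite I" and v: "inner_on I v v = 1" and re: "cnj (v n) = v n"
  obtains W where "orthonormal_basis I I W" "\<And>i j. W i j = cnj (W j i)" "\<And>p. p \<in> I \<Longrightarrow> W n p = v p"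
proof
  define w where "w = (\<lambda>p. v p - (if p = n then 1 else 0))"
  define c where "c = inner_on I w w"
  define g where "g = 2 / c"
  define W where "W = (\<lambda>i p. (if i = p then 1 else 0) - g * w p * cnj (w i))"
  have cr: "cnj c = c" by (simp add: c_def inner_on_cnj)
  have gr: "cnj g = g" by (simp add: g_def cr)
  \<comment> \<open>The squared length of \<open>v\<close> minus the unit vector n, using that
    \<open>v\<close> has norm 1 and that \<open>v n\<close> is real. Reality of \<open>v n\<close>
    is what lets a reflection carry the unit vector to \<open>v\<close>.\<close>
  have cv: "c = 2 - 2 * v n"
  proof -
    have "c = inner_on I v v - (\<Sum>p\<in>I. if p = n then cnj (v n) else 0) - (\<Sum>p\<in>I. if p = n then v n else 0)
        + (\<Sum>p\<in>I. if p = n then 1 else 0)"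
      unfolding c_def w_def inner_on_def sum_subtractf[symmetric] sum.distrib[symmetric]
      by (intro sum.cong refl) (auto simp: algebra_simps)
    then show ?thesis using n v re by simp
  qed
  have w0: "w p = 0" if "c = 0" "p \<in> I" for p
  proof -
    have "(\<Sum>p\<in>I. (cmod (w p))\<^sup>2) = 0"
      using that(1) unfolding c_def inner_on_self by (simp only: of_real_eq_0_iff)
    then show ?thesis using n that(2) by (simp add: sum_nonneg_eq_0_iff)
  qed
  show sym: "W i j = cnj (W j i)" for i j by (simp add: W_def gr)
  show "W n p = v p" if p: "p \<in> I" for p
  proof (cases "c = 0")
    case True
    then show ?thesis using w0[OF True p] by (simp add: W_def w_def)
  next
    case False
    have "cnj (w n) = v n - 1" by (simp add: w_def re)
    moreover have "g * (v n - 1) = -1" using False by (simp add: g_def cv field_simps)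
    moreover have "g * w p * cnj (w n) = w p * (g * cnj (w n))" by simp
    ultimately have "g * w p * cnj (w n) = - w p" by simp
    then show ?thesis by (simp add: W_def) (simp add: w_def)
  qed
  have ww: "inner_on I (W i) (W j) = (if i = j then 1 else 0)" if ij: "i \<in> I" "j \<in> I" for i j
  proof -
    have "inner_on I (W i) (W j) = (\<Sum>p\<in>I. if p = i then (if i = j then 1 else 0) else 0)
       - (\<Sum>p\<in>I. if p = i then g * w i * cnj (w j) else 0) - (\<Sum>p\<in>I. if p = j then g * w i * cnj (w j) else 0)
       + (\<Sum>p\<in>I. g * g * w i * cnj (w j) * (cnj (w p) * w p))"
      unfolding W_def inner_on_def sum_subtractf[symmetric] sum.distrib[symmetric]
      by (intro sum.cong refl) (auto simp: algebra_simps gr)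
    also have "\<dots> = (if i = j then 1 else 0) - 2 * (g * w i * cnj (w j)) + g * g * w i * cnj (w j) * c"
      using n ij by (simp add: c_def inner_on_def sum_distrib_left)
    also have "\<dots> = (if i = j then 1 else 0)"
    proof (cases "c = 0")
      case True then show ?thesis using w0[OF True ij(1)] by simp
    next
      case False
      then have "g * c = 2" by (simp add: g_def)
      moreover have "g * g * w i * cnj (w j) * c = g * c * (g * w i * cnj (w j))" by simp
      ultimately have "g * g * w i * cnj (w j) * c = 2 * (g * w i * cnj (w j))" by simp
      then show ?thesis by simp
    qed
    finally show ?thesis .
  qed
  show "orthonormal_basis I I W"
    unfolding orthonormal_basis_def orthonormal_def
  proof (intro conjI ballI)
    fix i j assume ij: "i \<in> I" "j \<in> I"
    show "inner_on I (W i) (W j) = (if i = j then 1 else 0)" by (rule ww[OF ij])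
    have "(\<Sum>k\<in>I. W k i * cnj (W k j)) = inner_on I (W i) (W j)"
      unfolding inner_on_def by (intro sum.cong refl) (simp add: sym[of _ i] sym[of j])
    then show "(\<Sum>k\<in>I. W k i * cnj (W k j)) = (if i = j then 1 else 0)" using ww[OF ij] by simp
  qed
qed

text \<open>Induction on the dimension. A unitary W with a unit eigenvector as its last member makes
  row and column n of the conjugated kernel vanish off the diagonal, and the induction hypothesis
  handles the remaining corner. A Householder reflection is convenient since, being Hermitian, it is
  its own inverse.\<close>

theorem spectral_kernel:
  fixes M :: "nat \<Rightarrow> nat \<Rightarrow> complex"
  assumes "\<And>i j. i < n \<Longrightarrow> j < n \<Longrightarrow> M j i = cnj (M i j)"
  shows "\<exists>u lam. has_dec {..<n} {..<n} u lam M \<and> orthonormal_basis {..<n} {..<n} u"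
  using assms
proof (induction n arbitrary: M)
  case 0
  then show ?case by (simp add: has_dec_def orthonormal_basis_def orthonormal_def)
next
  case (Suc n)
  define I where "I = {..<Suc n}"
  have I: "n \<in> I" "finite I" by (auto simp: I_def)
  have herm: "M j i = cnj (M i j)" if "i \<in> I" "j \<in> I" for i j 
    by (rule Suc.prems) (use that in \<open>auto simp: I_def\<close>)
  have "\<exists>x c. inner_on I x x = 1 \<and> (\<forall>i\<in>I. (\<Sum>j\<in>I. M i j * x j) = complex_of_real c * x i)"
  proof (rule hermitian_eigvec[of "Suc n" M])
    show "M j i = cnj (M i j)" if "i < Suc n" "j < Suc n" for i j by (rule Suc.prems[OF that])
    fix x c assume "inner_on {..<Suc n} x x = 1" "\<And>i. i < Suc n \<Longrightarrow> (\<Sum>j<Suc n. M i j * x j) = complex_of_real c * x i"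
    then show ?thesis unfolding I_def by (intro exI conjI ballI) (simp_all only: lessThan_iff)
  qed simp
  then obtain x c where x: "inner_on I x x = 1" "\<And>i. i \<in> I \<Longrightarrow> (\<Sum>j\<in>I. M i j * x j) = complex_of_real c * x i"
    by blast
  \<comment> \<open>A phase that makes the last component of the eigenvector real, as
    \<open>householder\<close> requires.\<close>
  define a where "a = (if x n = 0 then 1 else cnj (x n) / of_real (cmod (x n)))"
  have aa: "cnj a * a = 1"
  proof -
    have "cmod a = 1" by (simp add: a_def norm_divide)
    then show ?thesis using complex_norm_square[of a] by (simp add: mult.commute)
  qed
  have ar: "cnj (a * x n) = a * x n" by (simp add: a_def mult.commute)
  define v where "v = (\<lambda>i. a * x i)"
  have v1: "inner_on I v v = 1"
  proof -
    have "inner_on I v v = cnj a * a * inner_on I x x" by (simp add: v_def inner_on_def sum_distrib_left mult_ac)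
    then show ?thesis using x aa by simp
  qed
  have Mv: "(\<Sum>j\<in>I. M i j * v j) = of_real c * v i" if "i \<in> I" for i
  proof -
    have "(\<Sum>j\<in>I. M i j * v j) = a * (\<Sum>j\<in>I. M i j * x j)" by (simp add: v_def sum_distrib_left mult_ac)
    then show ?thesis using x(2)[OF that] by (simp add: v_def)
  qed
  have vn: "v n = a * x n" by (simp add: v_def)
  obtain W where W: "orthonormal_basis I I W" "\<And>i j. W i j = cnj (W j i)" "\<And>p. p \<in> I \<Longrightarrow> W n p = v p"
    using householder[OF I v1 ar[folded vn]] by blast
  define M' where "M' = conj_by I W M"
  have M'_eq: "M' p q = inner_on I (W p) (\<lambda>i. \<Sum>j\<in>I. M i j * W q j)" for p q
  proof -
    have "M' p q = (\<Sum>i\<in>I. \<Sum>j\<in>I. cnj (W p i) * M i j * W q j)"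
      unfolding M'_def conj_by_def
      by (intro sum.cong refl) (simp add: W(2)[of _ p] W(2)[of q])
    then show ?thesis by (simp add: inner_on_def sum_distrib_left mult_ac)
  qed
  have col: "M' p n = (if p = n then of_real c else 0)" if p: "p \<in> I" for p
  proof -
    have "M' p n = inner_on I (W p) (\<lambda>i. of_real c * W n i)"
      unfolding M'_eq by (rule inner_on_cong) (simp_all add: W(3) Mv)
    also have "\<dots> = of_real c * inner_on I (W p) (W n)" by (simp add: inner_on_def sum_distrib_left mult_ac)
    also have "\<dots> = (if p = n then of_real c else 0)"
      using orthonormalD[OF basis_orthonormal[OF W(1)] p I(1)] by simp
    finally show ?thesis .
  qed
  have herm': "M' q p = cnj (M' p q)" if "p \<in> I" "q \<in> I" for p q
  proof -
    have "cnj (M' p q) = (\<Sum>i\<in>I. \<Sum>j\<in>I. cnj (W i p * M i j * cnj (W j q)))"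
      unfolding M'_def conj_by_def by simp
    also have "\<dots> = (\<Sum>i\<in>I. \<Sum>j\<in>I. W j q * M j i * cnj (W i p))"
    proof (intro sum.cong refl)
      fix i j assume "i \<in> I" "j \<in> I"
      then show "cnj (W i p * M i j * cnj (W j q)) = W j q * M j i * cnj (W i p)"
        using herm[of i j] by (simp add: mult_ac)
    qed
    also have "\<dots> = M' q p" unfolding M'_def conj_by_def by (rule sum.swap)
    finally show ?thesis ..
  qed
  obtain u' lam' where u': "has_dec {..<n} {..<n} u' lam' M'" "orthonormal_basis {..<n} {..<n} u'"
    using Suc.IH[of M', OF herm'] by (force simp: I_def)
  \<comment> \<open>The eigenvectors of the corner extended by 0, together with the unit vector
    n.\<close>
  define u where "u = (\<lambda>k i. if k = n then if i = n then 1 else 0 else if i = n then 0 else u' k i :: complex)"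
  define lam where "lam = (\<lambda>k. if k = n then c else lam' k)"
  have In: "I = insert n {..<n}" by (auto simp: I_def)
  have onu: "orthonormal I I u"
    using basis_orthonormal[OF u'(2)] unfolding orthonormal_def inner_on_def In by (auto simp: u_def)
  have ub: "orthonormal_basis I I u"
    using u'(2) onu unfolding orthonormal_basis_def In by (auto simp: u_def)
  have ud: "has_dec I I u lam M'"
    unfolding has_dec_def
  proof (intro conjI ballI onu)
    fix i j assume ij: "i \<in> I" "j \<in> I"
    have "M' n j = (if j = n then of_real c else 0)" using herm'[OF ij(2) I(1)] col[OF ij(2)] by simp
    then show "M' i j = (\<Sum>k\<in>I. complex_of_real (lam k) * u k i * cnj (u k j))"
      using ij col[OF ij(1)] has_decD[OF u'(1), of i j] unfolding In by (auto simp: u_def lam_def)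
  qed
  have "has_dec I I (\<lambda>k. lift I W (u k)) lam (conj_by I W M')"
    by (rule dec_lift[OF I(2) basis_orthonormal[OF W(1)] ud])
  \<comment> \<open>Conjugating twice with the involution W gives M back.\<close>
  moreover have "conj_by I W M' p q = M p q" if pq: "p \<in> I" "q \<in> I" for p q
  proof -
    have l: "lift I W (W k) r = (if k = r then 1 else 0)" if "k \<in> I" "r \<in> I" for k r
    proof -
      have "lift I W (W k) r = (\<Sum>i\<in>I. W i r * cnj (W i k))"
        unfolding lift_def by (intro sum.cong refl) (simp add: W(2)[of k])
      then show ?thesis using W(1) that by (auto simp: orthonormal_basis_def)
    qed
    have "conj_by I W M' p q = (\<Sum>i\<in>I. \<Sum>j\<in>I. if j = q then if i = p then M i j else 0 else 0)"
      unfolding M'_def conj_by_conj_by unfolding conj_by_def using pq by (intro sum.cong refl) (auto simp: l)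
    then show ?thesis using pq I by simp
  qed
  ultimately have "has_dec I I (\<lambda>k. lift I W (u k)) lam M" by (simp add: has_dec_def)
  moreover have "orthonormal_basis I I (\<lambda>k. lift I W (u k))" by (rule orthonormal_basis_lift[OF I(2) W(1) ub])
  ultimately show ?case unfolding I_def by blast
qed


section \<open>Kernels of density matrices\<close>

definition tensor :: "('a \<Rightarrow> 'x \<Rightarrow> complex) \<Rightarrow> ('b \<Rightarrow> 'y \<Rightarrow> complex) \<Rightarrow> 'a \<times> 'b \<Rightarrow> 'x \<times> 'y \<Rightarrow> complex" where
  "tensor W V = (\<lambda>(a, b) (x, y). W a x * V b y)"

lemma orthonormal_tensor:
  assumes W: "orthonormal X A W" and V: "orthonormal Y B V"
  shows "orthonormal (X \<times> Y) (A \<times> B) (tensor W V)"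
  unfolding orthonormal_def
proof (intro ballI)
  fix p q assume "p \<in> A \<times> B" "q \<in> A \<times> B"
  then obtain a b a' b' where pq: "p = (a, b)" "q = (a', b')" "a \<in> A" "a' \<in> A" "b \<in> B" "b' \<in> B" by auto
  have "inner_on (X \<times> Y) (tensor W V p) (tensor W V q) =
      (\<Sum>x\<in>X. \<Sum>y\<in>Y. (cnj (W a x) * W a' x) * (cnj (V b y) * V b' y))"
    by (simp add: inner_on_def tensor_def pq sum.cartesian_product' mult_ac)
  also have "\<dots> = inner_on X (W a) (W a') * inner_on Y (V b) (V b')"
    unfolding inner_on_def sum_product ..
  finally show "inner_on (X \<times> Y) (tensor W V p) (tensor W V q) = (if p = q then 1 else 0)"
    using orthonormalD[OF W] orthonormalD[OF V] pq by auto
qed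

text \<open>Summing over x produces the inner products of the vectors \<open>W a\<close>, so an
  isometry on the traced factor disappears. Local embeddings therefore commute with taking reduced
  states.\<close>

lemma ptrace_fst_conj_by:
  assumes fin: "finite A" and W: "orthonormal X A W"
  shows "ptrace_fst X (conj_by (A \<times> I) (tensor W V) M) y y' = conj_by I V (ptrace_fst A M) y y'"
proof -
  have "ptrace_fst X (conj_by (A \<times> I) (tensor W V) M) y y' =
      (\<Sum>x\<in>X. \<Sum>p\<in>A \<times> I. \<Sum>q\<in>A \<times> I. (W (fst p) x * cnj (W (fst q) x)) *
        (V (snd p) y * M p q * cnj (V (snd q) y')))"
    unfolding ptrace_fst_def conj_by_def tensor_def by (simp add: case_prod_unfold mult_ac)
  also have "\<dots> = (\<Sum>p\<in>A \<times> I. \<Sum>x\<in>X. \<Sum>q\<in>A \<times> I. (W (fst p) x * cnj (W (fst q) x)) *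
        (V (snd p) y * M p q * cnj (V (snd q) y')))" by (rule sum.swap)
  also have "\<dots> = (\<Sum>p\<in>A \<times> I. \<Sum>q\<in>A \<times> I. \<Sum>x\<in>X. (W (fst p) x * cnj (W (fst q) x)) *
        (V (snd p) y * M p q * cnj (V (snd q) y')))" by (intro sum.cong refl sum.swap)
  also have "\<dots> = (\<Sum>p\<in>A \<times> I. \<Sum>q\<in>A \<times> I. inner_on X (W (fst q)) (W (fst p)) *
        (V (snd p) y * M p q * cnj (V (snd q) y')))"
    by (simp add: inner_on_def sum_distrib_left sum_distrib_right mult_ac)
  also have "\<dots> = (\<Sum>p\<in>A \<times> I. \<Sum>q\<in>A \<times> I. if fst q = fst p then V (snd p) y * M p q * cnj (V (snd q) y') else 0)"
    by (intro sum.cong refl) (auto simp: orthonormalD[OF W])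
  also have "\<dots> = (\<Sum>a\<in>A. \<Sum>i\<in>I. \<Sum>a'\<in>A. if a' = a then (\<Sum>i'\<in>I. V i y * M (a, i) (a, i') * cnj (V i' y')) else 0)"
    unfolding sum.cartesian_product' by (intro sum.cong refl) auto
  also have "\<dots> = (\<Sum>a\<in>A. \<Sum>i\<in>I. \<Sum>i'\<in>I. V i y * M (a, i) (a, i') * cnj (V i' y'))"
    using fin by simp
  also have "\<dots> = (\<Sum>i\<in>I. \<Sum>a\<in>A. \<Sum>i'\<in>I. V i y * M (a, i) (a, i') * cnj (V i' y'))"
    by (rule sum.swap)
  also have "\<dots> = (\<Sum>i\<in>I. \<Sum>i'\<in>I. \<Sum>a\<in>A. V i y * M (a, i) (a, i') * cnj (V i' y'))"
    by (intro sum.cong refl sum.swap)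
  finally show ?thesis by (simp add: conj_by_def ptrace_fst_def sum_distrib_left sum_distrib_right)
qed

lemma conj_by_reindex:
  assumes h: "bij_betw h P I"
  shows "conj_by P (\<lambda>p. W (h p)) (\<lambda>p q. M (h p) (h q)) x y = conj_by I W M x y"
proof -
  have "conj_by P (\<lambda>p. W (h p)) (\<lambda>p q. M (h p) (h q)) x y =
      (\<Sum>p\<in>P. \<Sum>j\<in>I. W (h p) x * M (h p) j * cnj (W j y))"
    unfolding conj_by_def by (intro sum.cong refl sum.reindex_bij_betw[OF h])
  also have "\<dots> = conj_by I W M x y"
    unfolding conj_by_def by (rule sum.reindex_bij_betw[OF h])
  finally show ?thesis .
qed

lemma trace_last_conj_by:
  fixes A :: "'a set" and B :: "'b set" and C :: "'c set"
  assumes fin: "finite C" and W: "orthonormal Z C WC"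
  shows "trace_last Z (conj_by (A \<times> B \<times> C) (tensor WA (tensor WB WC)) M) p q =
    conj_by (A \<times> B) (tensor WA WB) (trace_last C M) p q"
proof -
  \<comment> \<open>The last factor is moved to the front to reuse the result for
    \<open>ptrace_fst\<close>.\<close>
  define h where "h = (\<lambda>(c :: 'c, (a :: 'a, b :: 'b)). (a, b, c))"
  have h: "bij_betw h (C \<times> (A \<times> B)) (A \<times> B \<times> C)"
    by (rule bij_betw_byWitness[where f'="\<lambda>(a, b, c). (c, (a, b))"]) (auto simp: h_def)
  obtain x t x' t' where pq: "p = (x, t)" "q = (x', t')" by (cases p, cases q)
  have "trace_last Z (conj_by (A \<times> B \<times> C) (tensor WA (tensor WB WC)) M) p q =
      (\<Sum>z\<in>Z. conj_by (C \<times> (A \<times> B)) (\<lambda>k. tensor WA (tensor WB WC) (h k)) (\<lambda>k l. M (h k) (h l)) (x, t, z) (x', t', z))"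
    by (simp add: trace_last_def pq conj_by_reindex[OF h])
  also have "\<dots> = ptrace_fst Z (conj_by (C \<times> (A \<times> B)) (tensor WC (tensor WA WB)) (\<lambda>k l. M (h k) (h l))) p q"
    unfolding ptrace_fst_def conj_by_def pq
    by (intro sum.cong refl) (auto simp: tensor_def h_def mult_ac)
  also have "\<dots> = conj_by (A \<times> B) (tensor WA WB) (ptrace_fst C (\<lambda>k l. M (h k) (h l))) p q"
    by (rule ptrace_fst_conj_by[OF fin W])
  also have "ptrace_fst C (\<lambda>k l. M (h k) (h l)) = trace_last C M"
    by (auto simp: ptrace_fst_def trace_last_def h_def fun_eq_iff)
  finally show ?thesis .
qed

text \<open>The conditions of \<open>is_state\<close>, transplanted to arbitrary index sets so that
  they survive relabelling.\<close>

definition kernel_state :: "'i set \<Rightarrow> ('i \<Rightarrow> 'i \<Rightarrow> complex) \<Rightarrow> bool" where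
  "kernel_state I M \<longleftrightarrow> (\<forall>i\<in>I. \<forall>j\<in>I. M j i = cnj (M i j)) \<and> (\<forall>v. 0 \<le> Re (quad I M v)) \<and> (\<Sum>i\<in>I. M i i) = 1"

lemma kernel_state_herm: "kernel_state I M \<Longrightarrow> i \<in> I \<Longrightarrow> j \<in> I \<Longrightarrow> M j i = cnj (M i j)"
  unfolding kernel_state_def by blast

lemma kernel_state_pos: "kernel_state I M \<Longrightarrow> 0 \<le> Re (quad I M v)"
  unfolding kernel_state_def by blast

lemma kernel_state_trace: "kernel_state I M \<Longrightarrow> (\<Sum>i\<in>I. M i i) = 1"
  unfolding kernel_state_def by blast

lemma kernel_state_reindex:
  assumes h: "bij_betw h P I" and M: "kernel_state I M"
  shows "kernel_state P (\<lambda>p q. M (h p) (h q))"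
  unfolding kernel_state_def
proof (intro conjI ballI allI)
  fix i j assume "i \<in> P" "j \<in> P"
  then have "h i \<in> I" "h j \<in> I" using bij_betwE[OF h] by auto
  then show "M (h j) (h i) = cnj (M (h i) (h j))" by (rule kernel_state_herm[OF M])
next
  fix v
  define g where "g = inv_into P h"
  have gh: "g (h p) = p" if "p \<in> P" for p
    using that h by (simp add: g_def bij_betw_def inv_into_f_f)
  have "quad P (\<lambda>p q. M (h p) (h q)) v = quad P (\<lambda>p q. M (h p) (h q)) (\<lambda>p. v (g (h p)))"
    by (simp add: quad_def gh)
  also have "\<dots> = quad I M (\<lambda>i. v (g i))" by (rule quad_reindex[OF h])
  finally show "0 \<le> Re (quad P (\<lambda>p q. M (h p) (h q)) v)" using kernel_state_pos[OF M] by simp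
next
  show "(\<Sum>i\<in>P. M (h i) (h i)) = 1"
    using sum.reindex_bij_betw[OF h, of "\<lambda>i. M i i"] kernel_state_trace[OF M] by simp
qed

lemma kernel_state_ptrace_fst:
  assumes fin: "finite A" and M: "kernel_state (A \<times> B) M"
  shows "kernel_state B (ptrace_fst A M)"
  unfolding kernel_state_def
proof (intro conjI ballI allI)
  fix i j assume ij: "i \<in> B" "j \<in> B"
  have "M (a, j) (a, i) = cnj (M (a, i) (a, j))" if "a \<in> A" for a
    by (rule kernel_state_herm[OF M]) (use ij that in auto)
  then show "ptrace_fst A M j i = cnj (ptrace_fst A M i j)" unfolding ptrace_fst_def cnj_sum by (intro sum.cong refl)
next
  fix v
  show "0 \<le> Re (quad B (ptrace_fst A M) v)"
    unfolding quad_ptrace_fst[OF fin, symmetric] Re_sum by (intro sum_nonneg kernel_state_pos[OF M])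
next
  have "(\<Sum>i\<in>B. ptrace_fst A M i i) = (\<Sum>i\<in>A\<times>B. M i i)"
    unfolding ptrace_fst_def by (subst sum.swap) (simp add: sum.cartesian_product')
  then show "(\<Sum>i\<in>B. ptrace_fst A M i i) = 1" using kernel_state_trace[OF M] by simp
qed

section \<open>From matrices to kernels, and the eigenbasis chosen in the entropies\<close>

definition kernel_of :: "complex mat \<Rightarrow> nat \<Rightarrow> nat \<Rightarrow> complex" where
  "kernel_of A i j = A $$ (i, j)"

text \<open>The choice made inside \<open>vN_entropy\<close> and \<open>rel_entropy\<close>, named
  so that both can be expressed by \<open>eigvec\<close> and \<open>eigval\<close>.\<close>

definition eig :: "nat \<Rightarrow> complex mat \<Rightarrow> complex mat \<times> (nat \<Rightarrow> real)" where
  "eig n A = (SOME (U, lam). spectral n A U lam)"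

definition eigvec :: "nat \<Rightarrow> complex mat \<Rightarrow> nat \<Rightarrow> nat \<Rightarrow> complex" where
  "eigvec n A k i = fst (eig n A) $$ (i, k)"

definition eigval :: "nat \<Rightarrow> complex mat \<Rightarrow> nat \<Rightarrow> real" where
  "eigval n A = snd (eig n A)"

lemma mult_index:
  assumes "A \<in> carrier_mat n m" "B \<in> carrier_mat m k" "i < n" "j < k"
  shows "(A * B) $$ (i, j) = (\<Sum>l<m. A $$ (i, l) * B $$ (l, j))"
  using assms by (auto simp: scalar_prod_def atLeast0LessThan intro!: sum.cong)

lemma cadj_carrier: "A \<in> carrier_mat n m \<Longrightarrow> cadj A \<in> carrier_mat m n"
  by (auto simp: cadj_def)

lemma cadj_index: "A \<in> carrier_mat n m \<Longrightarrow> i < m \<Longrightarrow> j < n \<Longrightarrow> cadj A $$ (i, j) = cnj (A $$ (j, i))"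
  by (auto simp: cadj_def)

text \<open>The bridge from matrix conjugation to \<open>conj_by\<close>: the columns of V become
  the family.\<close>

lemma sandwich_index:
  assumes A: "A \<in> carrier_mat n n" and V: "V \<in> carrier_mat m n" and ij: "i < m" "j < m"
  shows "(V * A * cadj V) $$ (i, j) = conj_by {..<n} (\<lambda>k p. V $$ (p, k)) (kernel_of A) i j"
proof -
  have "(V * A * cadj V) $$ (i, j) = (\<Sum>l<n. (V * A) $$ (i, l) * cadj V $$ (l, j))"
    using mult_index[of "V * A" m n "cadj V" m i j] A V ij by (simp add: cadj_carrier)
  also have "\<dots> = (\<Sum>l<n. (\<Sum>k<n. V $$ (i, k) * A $$ (k, l)) * cnj (V $$ (j, l)))"
  proof (intro sum.cong refl)
    fix l assume "l \<in> {..<n}"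
    then show "(V * A) $$ (i, l) * cadj V $$ (l, j) = (\<Sum>k<n. V $$ (i, k) * A $$ (k, l)) * cnj (V $$ (j, l))"
      using mult_index[OF V A ij(1), of l] cadj_index[OF V _ ij(2), of l] by simp
  qed
  also have "\<dots> = (\<Sum>l<n. \<Sum>k<n. V $$ (i, k) * A $$ (k, l) * cnj (V $$ (j, l)))"
    by (simp add: sum_distrib_right)
  also have "\<dots> = conj_by {..<n} (\<lambda>k p. V $$ (p, k)) (kernel_of A) i j"
    unfolding conj_by_def kernel_of_def by (rule sum.swap)
  finally show ?thesis .
qed

lemma isometry_iff_orthonormal:
  assumes V: "V \<in> carrier_mat m n"
  shows "isometry V \<longleftrightarrow> orthonormal {..<m} {..<n} (\<lambda>k p. V $$ (p, k))"
proof -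
  have e: "(cadj V * V) $$ (i, j) = inner_on {..<m} (\<lambda>p. V $$ (p, i)) (\<lambda>p. V $$ (p, j))"
    if "i < n" "j < n" for i j
  proof -
    have "(cadj V * V) $$ (i, j) = (\<Sum>l<m. cadj V $$ (i, l) * V $$ (l, j))"
      by (rule mult_index[OF cadj_carrier[OF V] V that])
    then show ?thesis using cadj_index[OF V that(1)] by (simp add: inner_on_def)
  qed
  have "isometry V \<longleftrightarrow> (\<forall>i<n. \<forall>j<n. (cadj V * V) $$ (i, j) = 1\<^sub>m n $$ (i, j))"
  proof
    assume "isometry V"
    then show "\<forall>i<n. \<forall>j<n. (cadj V * V) $$ (i, j) = 1\<^sub>m n $$ (i, j)" using V by (simp add: isometry_def)
  next
    assume *: "\<forall>i<n. \<forall>j<n. (cadj V * V) $$ (i, j) = 1\<^sub>m n $$ (i, j)"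
    have "cadj V * V = 1\<^sub>m n" using V * by (intro eq_matI) (auto simp: cadj_def)
    then show "isometry V" using V by (simp add: isometry_def)
  qed
  then show ?thesis by (auto simp: orthonormal_def e)
qed

lemma unitary_right_inv:
  assumes "unitary_mat n U"
  shows "U * cadj U = 1\<^sub>m n"
  using assms mat_mult_left_right_inverse[of "cadj U" n U]
  by (auto simp: unitary_mat_def isometry_def cadj_carrier)

lemma unitary_orthonormal_basis:
  assumes U: "unitary_mat n U"
  shows "orthonormal_basis {..<n} {..<n} (\<lambda>k p. U $$ (p, k))"
proof -
  have c: "U \<in> carrier_mat n n" using U by (simp add: unitary_mat_def)
  have "(\<Sum>k<n. U $$ (i, k) * cnj (U $$ (j, k))) = (if i = j then 1 else 0)" if "i < n" "j < n" for i j
  proof -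
    have "(U * cadj U) $$ (i, j) = (\<Sum>k<n. U $$ (i, k) * cadj U $$ (k, j))"
      by (rule mult_index[OF c cadj_carrier[OF c] that])
    then show ?thesis using cadj_index[OF c _ that(2)] that by (simp add: unitary_right_inv[OF U])
  qed
  then show ?thesis using U isometry_iff_orthonormal[OF c] by (simp add: orthonormal_basis_def unitary_mat_def)
qed

lemma spectral_dec:
  assumes "spectral n A U lam"
  shows "has_dec {..<n} {..<n} (\<lambda>k p. U $$ (p, k)) lam (kernel_of A)" "orthonormal_basis {..<n} {..<n} (\<lambda>k p. U $$ (p, k))"
proof -
  have U: "unitary_mat n U" and A: "A = U * rdiag n lam * cadj U" using assms by (auto simp: spectral_def)
  show o: "orthonormal_basis {..<n} {..<n} (\<lambda>k p. U $$ (p, k))" by (rule unitary_orthonormal_basis[OF U])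
  have D: "rdiag n lam \<in> carrier_mat n n" by (simp add: rdiag_def)
  have c: "U \<in> carrier_mat n n" using U by (simp add: unitary_mat_def)
  have "kernel_of A i j = (\<Sum>k<n. of_real (lam k) * U $$ (i, k) * cnj (U $$ (j, k)))" if "i < n" "j < n" for i j
  proof -
    have "kernel_of A i j = (\<Sum>k<n. \<Sum>l<n. if l = k then of_real (lam k) * U $$ (i, k) * cnj (U $$ (j, k)) else 0)"
      unfolding kernel_of_def A sandwich_index[OF D c that] unfolding conj_by_def kernel_of_def rdiag_def
      by (intro sum.cong refl) auto
    then show ?thesis by simp
  qed
  then show "has_dec {..<n} {..<n} (\<lambda>k p. U $$ (p, k)) lam (kernel_of A)"
    using o by (simp add: has_dec_def orthonormal_basis_def)
qed

lemma spectral_exists: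
  assumes A: "A \<in> carrier_mat n n" "cadj A = A"
  shows "\<exists>U lam. spectral n A U lam"
proof -
  have "kernel_of A j i = cnj (kernel_of A i j)" if "i < n" "j < n" for i j
    using cadj_index[OF A(1) that(2,1)] A(2) by (simp add: kernel_of_def)
  then obtain u lam where u: "has_dec {..<n} {..<n} u lam (kernel_of A)" "orthonormal_basis {..<n} {..<n} u"
    using spectral_kernel[of n "kernel_of A"] by blast
  define U where "U = mat n n (\<lambda>(i, k). u k i)"
  have c: "U \<in> carrier_mat n n" by (simp add: U_def)
  have D: "rdiag n lam \<in> carrier_mat n n" by (simp add: rdiag_def)
  have "orthonormal {..<n} {..<n} (\<lambda>k p. U $$ (p, k))"
    using basis_orthonormal[OF u(2)] by (simp add: orthonormal_def inner_on_def U_def)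
  then have "unitary_mat n U" using c isometry_iff_orthonormal[OF c] by (simp add: unitary_mat_def)
  moreover have "A = U * rdiag n lam * cadj U"
  proof (rule eq_matI)
    fix i j assume "i < dim_row (U * rdiag n lam * cadj U)" "j < dim_col (U * rdiag n lam * cadj U)"
    then have ij: "i < n" "j < n" using c cadj_carrier[OF c] by auto
    have "(U * rdiag n lam * cadj U) $$ (i, j) =
        (\<Sum>k<n. \<Sum>l<n. if l = k then of_real (lam k) * u k i * cnj (u k j) else 0)"
      unfolding sandwich_index[OF D c ij] unfolding conj_by_def kernel_of_def rdiag_def U_def using ij
      by (intro sum.cong refl) auto
    then show "A $$ (i, j) = (U * rdiag n lam * cadj U) $$ (i, j)"
      using has_decD[OF u(1), of i j] ij by (simp add: kernel_of_def)
  qed (use A c cadj_carrier[OF c] in auto)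
  ultimately show ?thesis using A by (auto simp: spectral_def)
qed

text \<open>Existence of a spectral decomposition is what gives the \<open>SOME\<close> term its
  meaning.\<close>

lemma eig_spectral:
  assumes "A \<in> carrier_mat n n" "cadj A = A"
  shows "spectral n A (fst (eig n A)) (eigval n A)"
proof -
  obtain U lam where "spectral n A U lam" using spectral_exists[OF assms] by blast
  then have "case eig n A of (U, lam) \<Rightarrow> spectral n A U lam"
    unfolding eig_def by (rule someI[of "\<lambda>(U, lam). spectral n A U lam" "(U, lam)", OF case_prodI])
  then show ?thesis by (simp add: eigval_def case_prod_unfold)
qed

lemma eigvec_dec:
  assumes "A \<in> carrier_mat n n" "cadj A = A"
  shows "has_dec {..<n} {..<n} (eigvec n A) (eigval n A) (kernel_of A)" "orthonormal_basis {..<n} {..<n} (eigvec n A)"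
  using spectral_dec[OF eig_spectral[OF assms]] by (auto simp: eigvec_def[abs_def])

lemma vN_entropy_eigval: "A \<in> carrier_mat n n \<Longrightarrow> vN_entropy A = - (\<Sum>k<n. eta (eigval n A k))"
  by (auto simp: vN_entropy_def eigval_def eig_def Let_def case_prod_unfold)

text \<open>Any orthonormal family of eigenvectors will do, complete or not, as
  \<open>eta 0 = 0\<close>; so an embedded state has the entropy of the original one.\<close>

lemma vN_entropy_dec:
  assumes A: "A \<in> carrier_mat n n" "cadj A = A" and fin: "finite K" and d: "has_dec {..<n} K u lam (kernel_of A)"
  shows "vN_entropy A = - (\<Sum>k\<in>K. eta (lam k))"
proof -
  have "(\<Sum>k<n. eta (eigval n A k)) = (\<Sum>k\<in>K. eta (lam k))"
    by (rule dec_sum_fun[OF finite_lessThan fin eigvec_dec(1)[OF A] d]) (simp add: eta_def)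
  then show ?thesis by (simp add: vN_entropy_eigval[OF A(1)])
qed

lemma is_state_kernel_state:
  "is_state n A \<longleftrightarrow> A \<in> carrier_mat n n \<and> kernel_state {..<n} (kernel_of A)"
proof (cases "A \<in> carrier_mat n n")
  case True
  have "cadj A = A \<longleftrightarrow> (\<forall>i\<in>{..<n}. \<forall>j\<in>{..<n}. A $$ (j, i) = cnj (A $$ (i, j)))"
  proof
    assume c: "cadj A = A"
    show "\<forall>i\<in>{..<n}. \<forall>j\<in>{..<n}. A $$ (j, i) = cnj (A $$ (i, j))"
    proof (intro ballI)
      fix i j assume "i \<in> {..<n}" "j \<in> {..<n}"
      then show "A $$ (j, i) = cnj (A $$ (i, j))" using cadj_index[OF True, of j i] unfolding c by simp
    qed
  next
    assume c: "\<forall>i\<in>{..<n}. \<forall>j\<in>{..<n}. A $$ (j, i) = cnj (A $$ (i, j))"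
    show "cadj A = A"
    proof (rule eq_matI)
      fix i j assume "i < dim_row A" "j < dim_col A"
      then have ij: "i < n" "j < n" using True by auto
      have "A $$ (i, j) = cnj (A $$ (j, i))" using c ij by blast
      then show "cadj A $$ (i, j) = A $$ (i, j)" using cadj_index[OF True ij] by simp
    qed (use True in \<open>auto simp: cadj_def\<close>)
  qed
  then show ?thesis using True unfolding is_state_def kernel_state_def quad_def kernel_of_def by blast
qed (simp add: is_state_def)

lemma state_eigval:
  assumes "is_state n A"
  shows "has_dec {..<n} {..<n} (eigvec n A) (eigval n A) (kernel_of A)" "orthonormal_basis {..<n} {..<n} (eigvec n A)"
    "k < n \<Longrightarrow> eigval n A k \<ge> 0" "(\<Sum>k<n. eigval n A k) = 1"
    "vN_entropy A = - (\<Sum>k<n. eigval n A k * ln (eigval n A k))"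
proof -
  have A: "A \<in> carrier_mat n n" "cadj A = A" using assms by (auto simp: is_state_def)
  show d: "has_dec {..<n} {..<n} (eigvec n A) (eigval n A) (kernel_of A)" and "orthonormal_basis {..<n} {..<n} (eigvec n A)"
    by (rule eigvec_dec[OF A])+
  have ks: "kernel_state {..<n} (kernel_of A)" using assms by (simp add: is_state_kernel_state)
  show nn: "eigval n A k \<ge> 0" if "k < n" for k
  proof -
    have "quad {..<n} (kernel_of A) (eigvec n A k) = of_real (eigval n A k)"
      by (rule dec_quad_eigvec[OF finite_lessThan d]) (simp add: that)
    moreover have "0 \<le> Re (quad {..<n} (kernel_of A) (eigvec n A k))" by (rule kernel_state_pos[OF ks])
    ultimately show ?thesis by simp
  qed
  have "complex_of_real (\<Sum>k<n. eigval n A k) = 1"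
    unfolding dec_trace[OF d, symmetric] by (rule kernel_state_trace[OF ks])
  then show "(\<Sum>k<n. eigval n A k) = 1" by (simp only: of_real_eq_1_iff)
  \<comment> \<open>Nonnegative eigenvalues make the cutoff in \<open>eta\<close> harmless; at 0
    both expressions are 0.\<close>
  have "(\<Sum>k<n. eta (eigval n A k)) = (\<Sum>k<n. eigval n A k * ln (eigval n A k))"
  proof (intro sum.cong refl)
    fix k assume "k \<in> {..<n}"
    then have "eigval n A k \<ge> 0" using nn by simp
    then show "eta (eigval n A k) = eigval n A k * ln (eigval n A k)" by (cases "eigval n A k = 0") (auto simp: eta_def)
  qed
  then show "vN_entropy A = - (\<Sum>k<n. eigval n A k * ln (eigval n A k))" by (simp add: vN_entropy_eigval[OF A(1)])
qed


section \<open>Kronecker products\<close>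

text \<open>The row-major pairing built into \<open>kron\<close>, \<open>ptrace_left\<close> and
  \<open>ptrace_right\<close>.\<close>

definition enc :: "nat \<Rightarrow> nat \<times> nat \<Rightarrow> nat" where
  "enc n = (\<lambda>(i, k). i * n + k)"

lemma enc_less: "i < m \<Longrightarrow> k < n \<Longrightarrow> i * n + k < m * (n::nat)"
  using mult_le_mono1[of "Suc i" m n] by simp

lemma enc_bij: "bij_betw (enc n) ({..<m} \<times> {..<n}) {..<m * n}"
proof (rule bij_betw_byWitness[where f'="\<lambda>l. (l div n, l mod n)"])
  show "enc n ` ({..<m} \<times> {..<n}) \<subseteq> {..<m * n}" by (auto simp: enc_def enc_less)
  show "(\<lambda>l. (l div n, l mod n)) ` {..<m * n} \<subseteq> {..<m} \<times> {..<n}"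
  proof (intro subsetI)
    fix x assume "x \<in> (\<lambda>l. (l div n, l mod n)) ` {..<m * n}"
    then obtain l where l: "x = (l div n, l mod n)" "l < m * n" by auto
    then have "n > 0" by (cases n) auto
    then show "x \<in> {..<m} \<times> {..<n}" using l by (auto simp: less_mult_imp_div_less)
  qed
qed (auto simp: enc_def)

lemma kron_carrier: "A \<in> carrier_mat m n \<Longrightarrow> B \<in> carrier_mat p q \<Longrightarrow> kron A B \<in> carrier_mat (m * p) (n * q)"
  by (auto simp: kron_def)

lemma kron_index:
  assumes "A \<in> carrier_mat m n" "B \<in> carrier_mat p q" "i < m" "k < p" "j < n" "l < q"
  shows "kron A B $$ (i * p + k, j * q + l) = A $$ (i, j) * B $$ (k, l)"
  using assms by (auto simp: kron_def enc_less)

lemma kron_eqI: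
  assumes "M \<in> carrier_mat (m * p) (n * q)" "N \<in> carrier_mat (m * p) (n * q)"
    and "\<And>i k j l. i < m \<Longrightarrow> k < p \<Longrightarrow> j < n \<Longrightarrow> l < q \<Longrightarrow> M $$ (i * p + k, j * q + l) = N $$ (i * p + k, j * q + l)"
  shows "M = N"
proof (rule eq_matI)
  fix x y assume "x < dim_row N" "y < dim_col N"
  then have xy: "x < m * p" "y < n * q" using assms by auto
  then have "p > 0" "q > 0" by (auto intro: ccontr)
  then have "x div p < m" "x mod p < p" "y div q < n" "y mod q < q"
    using xy by (auto simp: less_mult_imp_div_less)
  from assms(3)[OF this] show "M $$ (x, y) = N $$ (x, y)" by simp
qed (use assms in auto)

text \<open>The inner index of the product runs over pairs via \<open>enc\<close>, and over pairs
  the sum factorizes.\<close>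

lemma kron_mult:
  assumes A: "A \<in> carrier_mat m n" and B: "B \<in> carrier_mat p q"
    and C: "C \<in> carrier_mat n r" and D: "D \<in> carrier_mat q s"
  shows "kron A B * kron C D = kron (A * C) (B * D)"
proof (rule kron_eqI[of _ m p r s])
  fix i k j l assume x: "i < m" "k < p" "j < r" "l < s"
  have "(kron A B * kron C D) $$ (i * p + k, j * s + l) =
      (\<Sum>y<n * q. kron A B $$ (i * p + k, y) * kron C D $$ (y, j * s + l))"
    by (rule mult_index[OF kron_carrier[OF A B] kron_carrier[OF C D]]) (simp_all add: x enc_less)
  also have "\<dots> = (\<Sum>z\<in>{..<n} \<times> {..<q}. kron A B $$ (i * p + k, enc q z) * kron C D $$ (enc q z, j * s + l))"
    by (rule sum.reindex_bij_betw[OF enc_bij, symmetric])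
  also have "\<dots> = (\<Sum>x<n. \<Sum>y<q. (A $$ (i, x) * C $$ (x, j)) * (B $$ (k, y) * D $$ (y, l)))"
    unfolding sum.cartesian_product'
    by (intro sum.cong refl) (simp add: enc_def kron_index[OF A B] kron_index[OF C D] x mult_ac)
  also have "\<dots> = (A * C) $$ (i, j) * (B * D) $$ (k, l)"
    unfolding mult_index[OF A C x(1,3)] mult_index[OF B D x(2,4)] sum_product ..
  also have "\<dots> = kron (A * C) (B * D) $$ (i * p + k, j * s + l)"
    using kron_index[of "A * C" m r "B * D" p s i k j l] A B C D x by simp
  finally show "(kron A B * kron C D) $$ (i * p + k, j * s + l) = kron (A * C) (B * D) $$ (i * p + k, j * s + l)" .
qed (use A B C D in \<open>auto intro!: kron_carrier mult_carrier_mat simp: kron_def\<close>)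

lemma cadj_kron:
  assumes A: "A \<in> carrier_mat m n" and B: "B \<in> carrier_mat p q"
  shows "cadj (kron A B) = kron (cadj A) (cadj B)"
proof (rule kron_eqI[of _ n q m p])
  fix i k j l assume x: "i < n" "k < q" "j < m" "l < p"
  show "cadj (kron A B) $$ (i * q + k, j * p + l) = kron (cadj A) (cadj B) $$ (i * q + k, j * p + l)"
    using cadj_index[OF kron_carrier[OF A B], of "i * q + k" "j * p + l"]
      kron_index[OF cadj_carrier[OF A] cadj_carrier[OF B] x]
      kron_index[OF A B x(3,4,1,2)] cadj_index[OF A x(1,3)] cadj_index[OF B x(2,4)]
    by (simp add: x enc_less)
qed (use A B in \<open>auto intro!: kron_carrier cadj_carrier\<close>)

lemma kron_one: "kron (1\<^sub>m m) (1\<^sub>m n) = 1\<^sub>m (m * n)"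
proof (rule kron_eqI[of _ m n m n])
  fix i k j l assume x: "i < m" "k < n" "j < m" "l < n"
  have "enc n (i, k) = enc n (j, l) \<longleftrightarrow> (i, k) = (j, l)"
    by (rule inj_on_eq_iff[OF bij_betw_imp_inj_on[OF enc_bij[of n m]]]) (use x in auto)
  then have "1\<^sub>m (m * n) $$ (i * n + k, j * n + l) = (if (i, k) = (j, l) then 1 else (0 :: complex))"
    using enc_less[OF x(1,2)] enc_less[OF x(3,4)] by (simp only: index_one_mat(1) enc_def prod.case)
  also have "\<dots> = 1\<^sub>m m $$ (i, j) * 1\<^sub>m n $$ (k, l)" using x by auto
  also have "\<dots> = kron (1\<^sub>m m) (1\<^sub>m n) $$ (i * n + k, j * n + l)"
    by (rule kron_index[symmetric]) (use x in auto)
  finally show "kron (1\<^sub>m m) (1\<^sub>m n) $$ (i * n + k, j * n + l) = 1\<^sub>m (m * n) $$ (i * n + k, j * n + l)" ..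
qed (auto intro!: kron_carrier)

lemma cadj_one: "cadj (1\<^sub>m n) = 1\<^sub>m n"
  by (rule eq_matI) (auto simp: cadj_def)

lemma cadj_cadj: "cadj (cadj A) = A"
  by (rule eq_matI) (auto simp: cadj_def)

lemma cadj_mult:
  assumes A: "A \<in> carrier_mat n m" and B: "B \<in> carrier_mat m k"
  shows "cadj (A * B) = cadj B * cadj A"
proof (rule eq_matI)
  fix i j assume "i < dim_row (cadj B * cadj A)" "j < dim_col (cadj B * cadj A)"
  then have ij: "i < k" "j < n" using cadj_carrier[OF A] cadj_carrier[OF B] by auto
  have "cadj (A * B) $$ (i, j) = cnj (\<Sum>l<m. A $$ (j, l) * B $$ (l, i))"
    using cadj_index[of "A * B" n k i j] mult_index[OF A B ij(2,1)] A B ij by simp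
  also have "\<dots> = (\<Sum>l<m. cadj B $$ (i, l) * cadj A $$ (l, j))"
    using ij by (simp add: cadj_index[OF A] cadj_index[OF B] mult.commute)
  also have "\<dots> = (cadj B * cadj A) $$ (i, j)"
    by (rule mult_index[OF cadj_carrier[OF B] cadj_carrier[OF A] ij, symmetric])
  finally show "cadj (A * B) $$ (i, j) = (cadj B * cadj A) $$ (i, j)" .
qed (use A B in \<open>auto simp: cadj_def\<close>)

lemma isometry_kron:
  assumes A: "A \<in> carrier_mat m n" and B: "B \<in> carrier_mat p q" and iso: "isometry A" "isometry B"
  shows "isometry (kron A B)"
proof -
  have "cadj (kron A B) * kron A B = kron (cadj A * A) (cadj B * B)"
    unfolding cadj_kron[OF A B] by (rule kron_mult[OF cadj_carrier[OF A] cadj_carrier[OF B] A B])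
  then show ?thesis using iso A B kron_carrier[OF A B] by (simp add: isometry_def kron_one)
qed

text \<open>U times its adjoint is the identity and cancels between A and its adjoint. This allows
  the unitary of the Markov decomposition to be absorbed into the embedding of B.\<close>

lemma isometry_mult_unitary:
  assumes U: "unitary_mat m U" and A: "A \<in> carrier_mat m n" "isometry A"
  shows "isometry (cadj U * A)"
proof -
  have c: "U \<in> carrier_mat m m" using U by (simp add: unitary_mat_def)
  have cA: "cadj A \<in> carrier_mat n m" and cU: "cadj U \<in> carrier_mat m m"
    using A c by (simp_all add: cadj_carrier)
  have "cadj (cadj U * A) * (cadj U * A) = cadj A * U * (cadj U * A)"
    by (simp add: cadj_mult[OF cU A(1)] cadj_cadj)
  also have "\<dots> = cadj A * (U * cadj U * A)"
    using c cA cU A by (simp add: assoc_mult_mat[of _ n m _ m _ n] assoc_mult_mat[of _ m m _ m _ n])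
  also have "\<dots> = 1\<^sub>m n" using A by (simp add: unitary_right_inv[OF U] isometry_def)
  finally show ?thesis using A cU by (simp add: isometry_def)
qed

lemma unitary_cadj: "unitary_mat n U \<Longrightarrow> unitary_mat n (cadj U)"
  using unitary_right_inv[of n U] cadj_carrier[of U n n]
  by (auto simp: unitary_mat_def isometry_def cadj_cadj)

lemma kernel_state_cong:
  assumes "\<And>i j. i \<in> I \<Longrightarrow> j \<in> I \<Longrightarrow> N i j = M i j" and M: "kernel_state I M"
  shows "kernel_state I N"
proof -
  have q: "quad I N v = quad I M v" for v using assms(1) by (simp add: quad_def)
  have t: "(\<Sum>i\<in>I. N i i) = (\<Sum>i\<in>I. M i i)" using assms(1) by simp
  have h: "N j i = cnj (N i j)" if "i \<in> I" "j \<in> I" for i j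
    using kernel_state_herm[OF M that] unfolding assms(1)[OF that] assms(1)[OF that(2,1)] .
  show ?thesis
    unfolding kernel_state_def q t using h kernel_state_pos[OF M] kernel_state_trace[OF M] by blast
qed

lemma kernel_of_ptrace_left: "i < n \<Longrightarrow> j < n \<Longrightarrow> kernel_of (ptrace_left m n M) i j =
    ptrace_fst {..<m} (\<lambda>p q. kernel_of M (enc n p) (enc n q)) i j"
  by (simp add: kernel_of_def ptrace_left_def ptrace_fst_def enc_def)

lemma kernel_of_ptrace_right: "i < m \<Longrightarrow> j < m \<Longrightarrow> kernel_of (ptrace_right m n M) i j =
    ptrace_snd {..<n} (\<lambda>p q. kernel_of M (enc n p) (enc n q)) i j"
  by (simp add: kernel_of_def ptrace_right_def ptrace_snd_def enc_def)

lemma state_ptrace_left: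
  assumes "is_state (m * n) M"
  shows "is_state n (ptrace_left m n M)"
proof -
  have "kernel_state {..<n} (ptrace_fst {..<m} (\<lambda>p q. kernel_of M (enc n p) (enc n q)))"
    using assms by (intro kernel_state_ptrace_fst kernel_state_reindex[OF enc_bij]) (simp_all add: is_state_kernel_state)
  then have "kernel_state {..<n} (kernel_of (ptrace_left m n M))"
    by (rule kernel_state_cong[rotated]) (simp add: kernel_of_ptrace_left)
  then show ?thesis by (simp add: is_state_kernel_state ptrace_left_def)
qed

lemma state_ptrace_right:
  assumes "is_state (m * n) M"
  shows "is_state m (ptrace_right m n M)"
proof -
  define sw where "sw = (\<lambda>(k :: nat, i :: nat). (i, k))"
  have sw: "bij_betw sw ({..<n} \<times> {..<m}) ({..<m} \<times> {..<n})"
    by (rule bij_betw_byWitness[where f'="\<lambda>(i, k). (k, i)"]) (auto simp: sw_def)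
  have "kernel_state ({..<m} \<times> {..<n}) (\<lambda>p q. kernel_of M (enc n p) (enc n q))"
    using assms by (intro kernel_state_reindex[OF enc_bij]) (simp add: is_state_kernel_state)
  from kernel_state_ptrace_fst[OF _ kernel_state_reindex[OF sw this]]
  have "kernel_state {..<m} (ptrace_fst {..<n} (\<lambda>p q. kernel_of M (enc n (sw p)) (enc n (sw q))))" by simp
  then have "kernel_state {..<m} (kernel_of (ptrace_right m n M))"
    by (rule kernel_state_cong[rotated]) (simp add: kernel_of_ptrace_right ptrace_fst_def ptrace_snd_def sw_def)
  then show ?thesis by (simp add: is_state_kernel_state ptrace_right_def)
qed

text \<open>The vector \<open>lift I W v\<close> lies in the range of the isometry, and the adjoint
  of W recovers \<open>v\<close> from it.\<close>

lemma quad_conj_by_lift: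
  assumes fin: "finite I" and W: "orthonormal P I W"
  shows "quad P (conj_by I W M) (lift I W v) = quad I M v"
proof -
  have l: "inner_on P (W i) (lift I W v) = v i" if i: "i \<in> I" for i
  proof -
    have "inner_on P (W i) (lift I W v) = (\<Sum>j\<in>I. v j * (if i = j then 1 else 0))"
      unfolding lift_def inner_on_sum_right using orthonormalD[OF W i] by (intro sum.cong refl) simp
    then show ?thesis using fin i by (simp add: if_distrib cong: if_cong)
  qed
  have "quad P (conj_by I W M) (lift I W v) = (\<Sum>p\<in>P. \<Sum>q\<in>P. \<Sum>i\<in>I. \<Sum>j\<in>I.
      M i j * (cnj (lift I W v p) * W i p) * (cnj (W j q) * lift I W v q))"
    unfolding quad_def conj_by_def by (simp add: sum_distrib_left sum_distrib_right mult_ac)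
  also have "\<dots> = (\<Sum>i\<in>I. \<Sum>j\<in>I. \<Sum>p\<in>P. \<Sum>q\<in>P.
      M i j * (cnj (lift I W v p) * W i p) * (cnj (W j q) * lift I W v q))"
    by (rule sum_swap_pairs)
  also have "\<dots> = (\<Sum>i\<in>I. \<Sum>j\<in>I. M i j * inner_on P (lift I W v) (W i) * inner_on P (W j) (lift I W v))"
    unfolding inner_on_def by (simp add: sum_distrib_left sum_distrib_right mult_ac)
  also have "\<dots> = (\<Sum>i\<in>I. \<Sum>j\<in>I. M i j * cnj (inner_on P (W i) (lift I W v)) * inner_on P (W j) (lift I W v))"
    by (simp only: inner_on_cnj)
  also have "\<dots> = quad I M v"
    unfolding quad_def by (intro sum.cong refl) (simp add: l)
  finally show ?thesis .
qed

text \<open>In the infinite case nothing is to be shown, so the bound is asked for only under the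
  support condition, which is the premise inside \<open>le\<close>.\<close>

lemma rel_entropy_ge:
  assumes \<mu>: "\<mu> \<in> carrier_mat n n" "cadj \<mu> = \<mu>" and \<rho>: "\<rho> \<in> carrier_mat n n"
    and le: "(\<And>j. j < n \<Longrightarrow> eigval n \<mu> j = 0 \<Longrightarrow> Re (quad {..<n} (kernel_of \<rho>) (eigvec n \<mu> j)) = 0) \<Longrightarrow>
      x \<le> - vN_entropy \<rho> - (\<Sum>j<n. ln (eigval n \<mu> j) * Re (quad {..<n} (kernel_of \<rho>) (eigvec n \<mu> j)))"
  shows "ereal x \<le> rel_entropy \<rho> \<mu>"
proof -
  define U where "U = fst (eig n \<mu>)"
  define m where "m = eigval n \<mu>"
  define q where "q = (\<lambda>j. Re ((cadj U * \<rho> * U) $$ (j, j)))"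
  have U: "U \<in> carrier_mat n n"
    using eig_spectral[OF \<mu>] by (simp add: spectral_def unitary_mat_def U_def)
  have q: "q j = Re (quad {..<n} (kernel_of \<rho>) (eigvec n \<mu> j))" if j: "j < n" for j
  proof -
    have "(cadj U * \<rho> * U) $$ (j, j) = conj_by {..<n} (\<lambda>k p. cadj U $$ (p, k)) (kernel_of \<rho>) j j"
      using sandwich_index[OF \<rho> cadj_carrier[OF U] j j] by (simp add: cadj_cadj)
    also have "\<dots> = quad {..<n} (kernel_of \<rho>) (eigvec n \<mu> j)"
      unfolding conj_by_def quad_def eigvec_def U_def[symmetric]
      by (intro sum.cong refl) (simp add: cadj_index[OF U] j)
    finally show ?thesis by (simp add: q_def)
  qed
  have r: "rel_entropy \<rho> \<mu> = (if \<exists>j<n. m j = 0 \<and> q j \<noteq> 0 then \<infinity>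
      else ereal (- vN_entropy \<rho> - (\<Sum>j\<in>{j. j < n \<and> m j \<noteq> 0}. q j * ln (m j))))"
    unfolding rel_entropy_def q_def U_def m_def eigval_def eig_def Let_def case_prod_unfold
      carrier_matD(1)[OF \<mu>(1)] by (rule refl)
  show ?thesis
  proof (cases "\<exists>j<n. m j = 0 \<and> q j \<noteq> 0")
    case False
    \<comment> \<open>Zero eigenvalues may be included in the sum, as
      \<open>ln 0 = 0\<close>.\<close>
    have "(\<Sum>j\<in>{j. j < n \<and> m j \<noteq> 0}. q j * ln (m j)) = (\<Sum>j<n. q j * ln (m j))"
      by (rule sum.mono_neutral_left) auto
    also have "\<dots> = (\<Sum>j<n. ln (eigval n \<mu> j) * Re (quad {..<n} (kernel_of \<rho>) (eigvec n \<mu> j)))"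
      by (intro sum.cong refl) (simp add: q m_def mult.commute)
    finally show ?thesis using le False unfolding r by (auto simp: q m_def)
  qed (simp add: r)
qed


section \<open>Three-factor indices and the passage to the Markov kernel\<close>

definition enc3 :: "nat \<Rightarrow> nat \<Rightarrow> nat \<times> nat \<times> nat \<Rightarrow> nat" where
  "enc3 b c = (\<lambda>(x, y, z). (x * b + y) * c + z)"

text \<open>These are the divisions by which \<open>markov_state\<close> reads off the three
  coordinates of an index.\<close>

lemma enc3_digits:
  fixes x y z b c :: nat
  assumes "y < b" "z < c"
  shows "((x * b + y) * c + z) div (b * c) = x" "((x * b + y) * c + z) div c mod b = y"
    "((x * b + y) * c + z) mod c = z"
proof -
  have d: "((x * b + y) * c + z) div c = x * b + y" using assms by (subst div_mult_self3) auto
  then show "((x * b + y) * c + z) div c mod b = y" using assms by simp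
  show "((x * b + y) * c + z) div (b * c) = x"
    unfolding mult.commute[of b c] div_mult2_eq d using assms by simp
  show "((x * b + y) * c + z) mod c = z" using assms by simp
qed

lemma enc3_bij: "bij_betw (enc3 b c) ({..<a} \<times> {..<b} \<times> {..<c}) {..<a * b * c}"
proof (rule bij_betw_byWitness[where f'="\<lambda>i. (i div (b * c), i div c mod b, i mod c)"])
  show "\<forall>p\<in>{..<a} \<times> {..<b} \<times> {..<c}. (enc3 b c p div (b * c), enc3 b c p div c mod b, enc3 b c p mod c) = p"
    by (auto simp: enc3_def enc3_digits)
  show "\<forall>i\<in>{..<a * b * c}. enc3 b c (i div (b * c), i div c mod b, i mod c) = i"
    unfolding enc3_def prod.case mult.commute[of b c] div_mult2_eq by simp
  show "enc3 b c ` ({..<a} \<times> {..<b} \<times> {..<c}) \<subseteq> {..<a * b * c}"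
    by (auto simp: enc3_def enc_less)
  show "(\<lambda>i. (i div (b * c), i div c mod b, i mod c)) ` {..<a * b * c} \<subseteq> {..<a} \<times> {..<b} \<times> {..<c}"
  proof
    fix p assume "p \<in> (\<lambda>i. (i div (b * c), i div c mod b, i mod c)) ` {..<a * b * c}"
    then obtain i where i: "p = (i div (b * c), i div c mod b, i mod c)" "i < a * b * c" by auto
    then have "b > 0" "c > 0" by (auto intro: ccontr)
    moreover have "i div (b * c) < a" using i(2) by (intro less_mult_imp_div_less) (simp add: mult.assoc)
    ultimately show "p \<in> {..<a} \<times> {..<b} \<times> {..<c}" using i(1) by simp
  qed
qed

lemma has_dec_cong:
  "has_dec I K u lam M \<Longrightarrow> (\<And>i j. i \<in> I \<Longrightarrow> j \<in> I \<Longrightarrow> N i j = M i j) \<Longrightarrow> has_dec I K u lam N"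
  by (simp add: has_dec_def)

lemma conj_by_congr: "(\<And>i j. i \<in> I \<Longrightarrow> j \<in> I \<Longrightarrow> M i j = N i j) \<Longrightarrow> conj_by I W M = conj_by I W N"
  by (intro ext) (simp add: conj_by_def)

lemma quad_congr: "(\<And>i j. i \<in> I \<Longrightarrow> j \<in> I \<Longrightarrow> M i j = N i j) \<Longrightarrow> quad I M v = quad I N v"
  by (simp add: quad_def)

text \<open>Undoing the unitary G = 1 tensor U tensor 1 and renaming the index of the middle system
  by \<open>e\<close> turns \<mu> into a \<open>markov_ker\<close>. As G is local, the same change
  turns the embedded \<rho> into \<open>R\<close>, again an image of \<rho> under local isometries.
  Hence the marginals of \<open>R\<close> have the nonzero eigenvalues of those of \<rho>, and
  \<open>markov_core\<close> speaks of the entropies in \<open>qCMI\<close>.\<close>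

theorem qCMI_le_rel_entropy:
  assumes \<rho>: "is_state (a * b * c) \<rho>"
    and VA: "VA \<in> carrier_mat a' a" "isometry VA" and VB: "VB \<in> carrier_mat b' b" "isometry VB"
    and VC: "VC \<in> carrier_mat c' c" "isometry VC"
    and \<mu>: "is_state (a' * b' * c') \<mu>" and markov: "markov_state a' b' c' \<mu>"
  shows "ereal (qCMI a b c \<rho>) \<le>
    rel_entropy (kron (kron VA VB) VC * \<rho> * cadj (kron (kron VA VB) VC)) \<mu>"
proof -
  obtain N :: nat and Ld Rd :: "nat \<Rightarrow> nat" and e :: "nat \<Rightarrow> nat \<times> nat \<times> nat" and U
      and p :: "nat \<Rightarrow> real" and \<sigma> \<tau> :: "nat \<Rightarrow> complex mat" where
    e: "bij_betw e {..<b'} {(j, l, r). j < N \<and> l < Ld j \<and> r < Rd j}"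
    and U: "unitary_mat b' U" and p: "\<forall>j<N. 0 \<le> p j"
    and \<sigma>\<tau>: "\<forall>j<N. is_state (a' * Ld j) (\<sigma> j) \<and> is_state (Rd j * c') (\<tau> j)"
    and \<mu>_eq: "\<mu> = kron (kron (1\<^sub>m a') U) (1\<^sub>m c') *
          mat (a' * b' * c') (a' * b' * c') (\<lambda>(i, i').
            let xi = i div (b' * c'); yi = (i div c') mod b'; zi = i mod c';
                xi' = i' div (b' * c'); yi' = (i' div c') mod b'; zi' = i' mod c';
                (j, l, r) = e yi; (j', l', r') = e yi'
            in if j = j' then complex_of_real (p j) * \<sigma> j $$ (xi * Ld j + l, xi' * Ld j + l')
                               * \<tau> j $$ (r * c' + zi, r' * c' + zi')
               else 0) *
          cadj (kron (kron (1\<^sub>m a') U) (1\<^sub>m c'))"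
    using markov unfolding markov_state_def by blast
  define n where "n = a' * b' * c'"
  define T where "T = block_index N (\<lambda>j. {..<Ld j}) (\<lambda>j. {..<Rd j})"
  define Mm where "Mm = mat n n (\<lambda>(i, i').
            let xi = i div (b' * c'); yi = (i div c') mod b'; zi = i mod c';
                xi' = i' div (b' * c'); yi' = (i' div c') mod b'; zi' = i' mod c';
                (j, l, r) = e yi; (j', l', r') = e yi'
            in if j = j' then complex_of_real (p j) * \<sigma> j $$ (xi * Ld j + l, xi' * Ld j + l')
                               * \<tau> j $$ (r * c' + zi, r' * c' + zi')
               else 0)"
  define G where "G = kron (kron (1\<^sub>m a') U) (1\<^sub>m c')"
  define V where "V = kron (kron VA VB) VC"
  define \<rho>' where "\<rho>' = V * \<rho> * cadj V"
  have \<mu>G: "\<mu> = G * Mm * cadj G" unfolding \<mu>_eq G_def Mm_def n_def ..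
  have Te: "bij_betw e {..<b'} T"
  proof -
    have "{(j, l, r). j < N \<and> l < Ld j \<and> r < Rd j} = T" by (auto simp: T_def block_index_def)
    then show ?thesis using e by simp
  qed
  \<comment> \<open>Translates block labels back to basis indices of the middle system.\<close>
  define ie where "ie = inv_into {..<b'} e"
  have ie: "bij_betw ie T {..<b'}" unfolding ie_def by (rule bij_betw_inv_into[OF Te])
  have e_ie: "e (ie t) = t" if "t \<in> T" for t
    unfolding ie_def by (rule bij_betw_inv_into_right[OF Te that])
  have ie_e: "ie (e y) = y" if "y < b'" for y
    unfolding ie_def by (rule bij_betw_inv_into_left[OF Te]) (simp add: that)
  have ie_less: "ie t < b'" if "t \<in> T" for t using bij_betwE[OF ie] that by auto

  define A where "A = {..<a}"
  define B where "B = {..<b}"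
  define C where "C = {..<c}"
  define X where "X = {..<a'}"
  define Z where "Z = {..<c'}"
  define h where "h = (\<lambda>(x, t, z). enc3 b' c' (x, ie t, z))"
  have h: "bij_betw h (X \<times> T \<times> Z) {..<n}"
  proof -
    have "bij_betw (\<lambda>(x, t, z). (x, ie t, z)) (X \<times> T \<times> Z) (X \<times> {..<b'} \<times> Z)"
      by (rule bij_betw_byWitness[where f'="\<lambda>(x, y, z). (x, e y, z)"])
         (use bij_betwE[OF Te] in \<open>auto simp: e_ie ie_e ie_less\<close>)
    from bij_betw_trans[OF this, of "enc3 b' c'" "{..<n}"]
    show ?thesis using enc3_bij[of b' c' a'] by (simp add: X_def Z_def n_def h_def comp_def case_prod_unfold)
  qed
  have hn: "h q < n" if "q \<in> X \<times> T \<times> Z" for q using bij_betwE[OF h] that by auto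

  have Uc: "U \<in> carrier_mat b' b'" using U by (simp add: unitary_mat_def)
  have G1: "kron (1\<^sub>m a') U \<in> carrier_mat (a' * b') (a' * b')" by (rule kron_carrier[OF one_carrier_mat Uc])
  have Gc: "G \<in> carrier_mat n n" unfolding G_def n_def by (rule kron_carrier[OF G1 one_carrier_mat])
  have Gu: "unitary_mat n G"
  proof -
    have i1: "isometry (1\<^sub>m k)" for k by (simp add: isometry_def cadj_one)
    have "isometry U" using U by (simp add: unitary_mat_def)
    then have "isometry G"
      unfolding G_def by (intro isometry_kron[OF G1 one_carrier_mat] isometry_kron[OF one_carrier_mat Uc] i1)
    then show ?thesis using Gc by (simp add: unitary_mat_def)
  qed
  define Gs where "Gs = cadj G"
  have Gsc: "Gs \<in> carrier_mat n n" unfolding Gs_def by (rule cadj_carrier[OF Gc])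
  have Gsu: "unitary_mat n Gs" unfolding Gs_def by (rule unitary_cadj[OF Gu])
  have Gs_eq: "Gs = kron (kron (1\<^sub>m a') (cadj U)) (1\<^sub>m c')"
    unfolding Gs_def G_def cadj_kron[OF G1 one_carrier_mat] cadj_kron[OF one_carrier_mat Uc] cadj_one ..
  have Mc: "Mm \<in> carrier_mat n n" by (simp add: Mm_def)
  \<comment> \<open>The embedding of B seen in the basis of the Markov decomposition.\<close>
  define VB' where "VB' = cadj U * VB"
  have VB': "VB' \<in> carrier_mat b' b" "isometry VB'"
    unfolding VB'_def using isometry_mult_unitary[OF U VB] cadj_carrier[OF Uc] VB(1) by auto
  have VAB: "kron VA VB \<in> carrier_mat (a' * b') (a * b)" by (rule kron_carrier[OF VA(1) VB(1)])
  have Vc: "V \<in> carrier_mat n (a * b * c)" unfolding V_def n_def by (rule kron_carrier[OF VAB VC(1)])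
  have Viso: "isometry V"
    unfolding V_def by (rule isometry_kron[OF VAB VC(1) isometry_kron[OF VA(1) VB(1) VA(2) VB(2)] VC(2)])
  have GsV: "Gs * V = kron (kron VA VB') VC"
  proof -
    have "Gs * V = kron (kron (1\<^sub>m a') (cadj U) * kron VA VB) (1\<^sub>m c' * VC)"
      unfolding Gs_eq V_def
      by (rule kron_mult[OF kron_carrier[OF one_carrier_mat cadj_carrier[OF Uc]] one_carrier_mat VAB VC(1)])
    also have "kron (1\<^sub>m a') (cadj U) * kron VA VB = kron (1\<^sub>m a' * VA) (cadj U * VB)"
      by (rule kron_mult[OF one_carrier_mat cadj_carrier[OF Uc] VA(1) VB(1)])
    finally show ?thesis using VA(1) VC(1) by (simp add: VB'_def)
  qed
  have \<rho>c: "\<rho> \<in> carrier_mat (a * b * c) (a * b * c)" and \<rho>h: "cadj \<rho> = \<rho>"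
    using \<rho> by (auto simp: is_state_def)
  have \<mu>c: "\<mu> \<in> carrier_mat n n" and \<mu>h: "cadj \<mu> = \<mu>" using \<mu> by (auto simp: is_state_def n_def)
  have \<rho>'c: "\<rho>' \<in> carrier_mat n n" using Vc \<rho>c cadj_carrier[OF Vc] by (simp add: \<rho>'_def)
  have \<rho>'h: "cadj \<rho>' = \<rho>'"
  proof -
    have "cadj \<rho>' = V * cadj (V * \<rho>)"
      unfolding \<rho>'_def using cadj_mult[of "V * \<rho>" n "a * b * c" "cadj V" n] Vc \<rho>c cadj_carrier[OF Vc]
      by (simp add: cadj_cadj)
    also have "\<dots> = V * (\<rho> * cadj V)" using cadj_mult[OF Vc \<rho>c] by (simp add: \<rho>h)
    also have "\<dots> = \<rho>'" unfolding \<rho>'_def using Vc \<rho>c cadj_carrier[OF Vc] by (simp add: assoc_mult_mat)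
    finally show ?thesis .
  qed

  define rk where "rk = (\<lambda>k l. kernel_of \<rho> (enc3 b c k) (enc3 b c l))"
  define WA where "WA = (\<lambda>i x. VA $$ (x, i))"
  define WB where "WB = (\<lambda>j t. VB' $$ (ie t, j))"
  define WC where "WC = (\<lambda>k z. VC $$ (z, k))"
  define R where "R = conj_by (A \<times> B \<times> C) (tensor WA (tensor WB WC)) rk"
  have oA: "orthonormal X A WA" using isometry_iff_orthonormal[OF VA(1)] VA(2) by (simp add: WA_def X_def A_def)
  have oC: "orthonormal Z C WC" using isometry_iff_orthonormal[OF VC(1)] VC(2) by (simp add: WC_def Z_def C_def)
  have oB: "orthonormal T B WB"
    using orthonormal_reindex[OF ie, of B "\<lambda>k p. VB' $$ (p, k)"] isometry_iff_orthonormal[OF VB'(1)] VB'(2)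
    by (simp add: WB_def B_def)
  have fin: "finite A" "finite B" "finite C" "finite X" "finite Z"
    by (simp_all add: A_def B_def C_def X_def Z_def)

  define Wv where "Wv = (\<lambda>k i. V $$ (i, k))"
  \<comment> \<open>The columns of \<open>Gs\<close> with their entries relabelled by
    \<open>h\<close>; conjugation with \<open>Wg\<close> performs both changes of coordinates at
    once.\<close>
  define Wg where "Wg = (\<lambda>i q. Gs $$ (h q, i))"
  have ov: "orthonormal {..<n} {..<a * b * c} Wv" using isometry_iff_orthonormal[OF Vc] Viso by (simp add: Wv_def)
  have og: "orthonormal_basis (X \<times> T \<times> Z) {..<n} Wg"
    unfolding Wg_def by (rule orthonormal_basis_reindex[OF h unitary_orthonormal_basis[OF Gsu]])
  have \<rho>'k: "kernel_of \<rho>' i j = conj_by {..<a * b * c} Wv (kernel_of \<rho>) i j" if "i < n" "j < n" for i j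
    unfolding \<rho>'_def kernel_of_def[of "V * _ * _"] sandwich_index[OF \<rho>c Vc that] Wv_def ..
  have Rk: "conj_by {..<n} Wg (kernel_of \<rho>') q q' = R q q'" if q: "q \<in> X \<times> T \<times> Z" "q' \<in> X \<times> T \<times> Z" for q q'
  proof -
    \<comment> \<open>By \<open>GsV\<close> the transformed columns of V are product
      vectors.\<close>
    have l: "lift {..<n} Wg (Wv (enc3 b c k)) q = tensor WA (tensor WB WC) k q"
      if k: "k \<in> A \<times> B \<times> C" and q: "q \<in> X \<times> T \<times> Z" for k q
    proof -
      obtain i j m where ke: "k = (i, j, m)" "i < a" "j < b" "m < c" using k by (auto simp: A_def B_def C_def)
      obtain x t z where qe: "q = (x, t, z)" "x < a'" "t \<in> T" "z < c'" using q by (auto simp: X_def Z_def)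
      have kn: "enc3 b c k < a * b * c" using ke by (simp add: enc3_def enc_less)
      have "lift {..<n} Wg (Wv (enc3 b c k)) q = (\<Sum>l<n. Gs $$ (h q, l) * V $$ (l, enc3 b c k))"
        by (simp add: lift_def Wg_def Wv_def mult.commute)
      also have "\<dots> = (Gs * V) $$ (h q, enc3 b c k)"
        by (rule mult_index[OF Gsc Vc hn[OF q] kn, symmetric])
      also have "\<dots> = kron VA VB' $$ (x * b' + ie t, i * b + j) * VC $$ (z, m)"
        unfolding GsV h_def enc3_def ke qe prod.case
        by (rule kron_index[OF kron_carrier[OF VA(1) VB'(1)] VC(1)]) (simp_all add: ke qe enc_less ie_less)
      also have "kron VA VB' $$ (x * b' + ie t, i * b + j) = VA $$ (x, i) * VB' $$ (ie t, j)"
        by (rule kron_index[OF VA(1) VB'(1)]) (simp_all add: ke qe ie_less)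
      finally show ?thesis by (simp add: tensor_def ke qe WA_def WB_def WC_def)
    qed
    have "conj_by {..<n} Wg (kernel_of \<rho>') q q' = conj_by {..<n} Wg (conj_by {..<a * b * c} Wv (kernel_of \<rho>)) q q'"
      by (subst conj_by_congr[of "{..<n}" "kernel_of \<rho>'" "conj_by {..<a * b * c} Wv (kernel_of \<rho>)"]) (simp_all add: \<rho>'k)
    also have "\<dots> = conj_by {..<a * b * c} (\<lambda>k. lift {..<n} Wg (Wv k)) (kernel_of \<rho>) q q'"
      by (rule conj_by_conj_by)
    also have "\<dots> = conj_by (A \<times> B \<times> C) (\<lambda>k. lift {..<n} Wg (Wv (enc3 b c k))) rk q q'"
      unfolding rk_def A_def B_def C_def by (rule conj_by_reindex[OF enc3_bij, symmetric])
    also have "\<dots> = R q q'"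
      unfolding R_def conj_by_def by (intro sum.cong refl) (simp add: l q)
    finally show ?thesis .
  qed

  define \<sigma>k where "\<sigma>k = (\<lambda>j q q'. kernel_of (\<sigma> j) (enc (Ld j) q) (enc (Ld j) q'))"
  define \<tau>k where "\<tau>k = (\<lambda>j q q'. kernel_of (\<tau> j) (enc c' q) (enc c' q'))"
  have Mk: "conj_by {..<n} Wg (kernel_of \<mu>) q q' = markov_ker p \<sigma>k \<tau>k q q'"
    if q: "q \<in> X \<times> T \<times> Z" "q' \<in> X \<times> T \<times> Z" for q q'
  proof -
    have "conj_by {..<n} Wg (kernel_of \<mu>) q q' = (Gs * \<mu> * cadj Gs) $$ (h q, h q')"
      unfolding sandwich_index[OF \<mu>c Gsc hn[OF q(1)] hn[OF q(2)]] by (simp add: Wg_def conj_by_def)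
    also have "Gs * \<mu> * cadj Gs = Mm"
    proof -
      have "cadj Gs = G" by (simp add: Gs_def cadj_cadj)
      moreover have "Gs * G = 1\<^sub>m n" using Gu Gc by (simp add: Gs_def unitary_mat_def isometry_def)
      moreover have "Gs * (G * Mm * Gs) * G = (Gs * G) * Mm * (Gs * G)"
        using Gc Gsc Mc by (simp add: assoc_mult_mat[of _ n n _ n _ n])
      ultimately show ?thesis using Mc by (simp add: \<mu>G Gs_def[symmetric])
    qed
    also have "Mm $$ (h q, h q') = markov_ker p \<sigma>k \<tau>k q q'"
    proof -
      obtain x j l r z where qe: "q = (x, (j, l, r), z)" "z < c'" "(j, l, r) \<in> T"
        using q by (auto simp: Z_def)
      obtain x' j' l' r' z' where qe': "q' = (x', (j', l', r'), z')" "z' < c'" "(j', l', r') \<in> T"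
        using q by (auto simp: Z_def)
      have hq: "h q = (x * b' + ie (j, l, r)) * c' + z" "h q' = (x' * b' + ie (j', l', r')) * c' + z'"
        by (simp_all add: h_def enc3_def qe qe')
      note dg = enc3_digits[OF ie_less[OF qe(3)] qe(2), of x] enc3_digits[OF ie_less[OF qe'(3)] qe'(2), of x']
      have "Mm $$ (h q, h q') = (let xi = h q div (b' * c'); yi = (h q div c') mod b'; zi = h q mod c';
                xi' = h q' div (b' * c'); yi' = (h q' div c') mod b'; zi' = h q' mod c';
                (j, l, r) = e yi; (j', l', r') = e yi'
            in if j = j' then complex_of_real (p j) * \<sigma> j $$ (xi * Ld j + l, xi' * Ld j + l')
                               * \<tau> j $$ (r * c' + zi, r' * c' + zi')
               else 0)"
        unfolding Mm_def using hn[OF q(1)] hn[OF q(2)] by simp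
      also have "\<dots> = markov_ker p \<sigma>k \<tau>k q q'"
        unfolding Let_def hq dg e_ie[OF qe(3)] e_ie[OF qe'(3)]
        by (simp add: qe qe' markov_ker_def \<sigma>k_def \<tau>k_def kernel_of_def enc_def)
      finally show ?thesis .
    qed
    finally show ?thesis .
  qed

  \<comment> \<open>The chosen eigenvectors of \<mu> in block coordinates; the change of coordinates
    is unitary, so they stay a basis with the same eigenvalues.\<close>
  define f where "f = (\<lambda>j. lift {..<n} Wg (eigvec n \<mu> j))"
  have \<mu>n: "is_state n \<mu>" using \<mu> by (simp add: n_def)
  have fd: "has_dec (X \<times> T \<times> Z) {..<n} f (eigval n \<mu>) (markov_ker p \<sigma>k \<tau>k)"
    unfolding f_def
    by (rule has_dec_cong[OF dec_lift[OF finite_lessThan basis_orthonormal[OF og] state_eigval(1)[OF \<mu>n]]])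
       (simp add: Mk)
  have fb: "orthonormal_basis (X \<times> T \<times> Z) {..<n} f"
    unfolding f_def by (rule orthonormal_basis_lift[OF finite_lessThan og state_eigval(2)[OF \<mu>n]])
  have fq: "quad (X \<times> T \<times> Z) R (f j) = quad {..<n} (kernel_of \<rho>') (eigvec n \<mu> j)" for j
  proof -
    have "quad (X \<times> T \<times> Z) R (f j) = quad (X \<times> T \<times> Z) (conj_by {..<n} Wg (kernel_of \<rho>')) (f j)"
      by (rule quad_congr) (simp add: Rk)
    also have "\<dots> = quad {..<n} (kernel_of \<rho>') (eigvec n \<mu> j)"
      unfolding f_def by (rule quad_conj_by_lift[OF finite_lessThan basis_orthonormal[OF og]])
    finally show ?thesis .
  qed

  define \<rho>AB where "\<rho>AB = ptrace_right (a * b) c \<rho>"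
  define \<rho>BC where "\<rho>BC = ptrace_left a (b * c) \<rho>"
  define \<rho>B where "\<rho>B = ptrace_left a b \<rho>AB"
  have sAB: "is_state (a * b) \<rho>AB" unfolding \<rho>AB_def by (rule state_ptrace_right[OF \<rho>])
  have sBC: "is_state (b * c) \<rho>BC" unfolding \<rho>BC_def by (rule state_ptrace_left) (use \<rho> in \<open>simp add: mult.assoc\<close>)
  have sB: "is_state b \<rho>B" unfolding \<rho>B_def by (rule state_ptrace_left[OF sAB])

  \<comment> \<open>Taking reduced states commutes with the local isometries, and those on the
    traced systems drop out.\<close>
  have RAB: "trace_last Z R = conj_by (A \<times> B) (tensor WA WB) (\<lambda>k l. kernel_of \<rho>AB (enc b k) (enc b l))"
  proof -
    have "trace_last Z R = conj_by (A \<times> B) (tensor WA WB) (trace_last C rk)"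
      unfolding R_def by (intro ext trace_last_conj_by[OF fin(3) oC])
    also have "\<dots> = conj_by (A \<times> B) (tensor WA WB) (\<lambda>k l. kernel_of \<rho>AB (enc b k) (enc b l))"
      by (rule conj_by_congr)
         (auto simp: trace_last_def rk_def \<rho>AB_def kernel_of_ptrace_right ptrace_snd_def enc_def enc3_def A_def B_def C_def enc_less)
    finally show ?thesis .
  qed
  have RBC: "ptrace_fst X R = conj_by (B \<times> C) (tensor WB WC) (\<lambda>k l. kernel_of \<rho>BC (enc c k) (enc c l))"
  proof -
    have "ptrace_fst X R = conj_by (B \<times> C) (tensor WB WC) (ptrace_fst A rk)"
      unfolding R_def by (intro ext ptrace_fst_conj_by[OF fin(1) oA])
    also have "\<dots> = conj_by (B \<times> C) (tensor WB WC) (\<lambda>k l. kernel_of \<rho>BC (enc c k) (enc c l))"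
    proof (rule conj_by_congr)
      fix k l assume kl: "k \<in> B \<times> C" "l \<in> B \<times> C"
      then have "enc c k < b * c" "enc c l < b * c" by (auto simp: enc_def enc_less B_def C_def)
      then have "kernel_of \<rho>BC (enc c k) (enc c l) =
          (\<Sum>x<a. kernel_of \<rho> (enc (b * c) (x, enc c k)) (enc (b * c) (x, enc c l)))"
        unfolding \<rho>BC_def by (simp add: kernel_of_ptrace_left ptrace_fst_def)
      then show "ptrace_fst A rk k l = kernel_of \<rho>BC (enc c k) (enc c l)"
        by (simp add: ptrace_fst_def rk_def A_def enc_def enc3_def case_prod_unfold algebra_simps)
    qed
    finally show ?thesis .
  qed
  have RB: "ptrace_fst X (trace_last Z R) = conj_by B WB (kernel_of \<rho>B)"
  proof -
    have "ptrace_fst X (trace_last Z R) = conj_by B WB (ptrace_fst A (\<lambda>k l. kernel_of \<rho>AB (enc b k) (enc b l)))"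
      unfolding RAB by (intro ext ptrace_fst_conj_by[OF fin(1) oA])
    also have "\<dots> = conj_by B WB (kernel_of \<rho>B)"
      by (rule conj_by_congr) (simp add: \<rho>B_def kernel_of_ptrace_left A_def B_def)
    finally show ?thesis .
  qed
  have finP: "finite (A \<times> B \<times> C)" "finite (A \<times> B)" "finite (B \<times> C)" using fin by auto
  have d0': "has_dec (A \<times> B \<times> C) {..<a * b * c} (\<lambda>k q. eigvec (a * b * c) \<rho> k (enc3 b c q)) (eigval (a * b * c) \<rho>) rk"
    unfolding A_def B_def C_def by (rule dec_reindex[OF enc3_bij state_eigval(1)[OF \<rho>]]) (simp add: rk_def)
  define e0 where "e0 = (\<lambda>k. lift (A \<times> B \<times> C) (tensor WA (tensor WB WC)) (\<lambda>q. eigvec (a * b * c) \<rho> k (enc3 b c q)))"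
  have d0: "has_dec (X \<times> T \<times> Z) {..<a * b * c} e0 (eigval (a * b * c) \<rho>) R"
    unfolding e0_def R_def by (rule dec_lift[OF finP(1) orthonormal_tensor[OF oA orthonormal_tensor[OF oB oC]] d0'])
  have d1': "has_dec (A \<times> B) {..<a * b} (\<lambda>k q. eigvec (a * b) \<rho>AB k (enc b q)) (eigval (a * b) \<rho>AB)
      (\<lambda>k l. kernel_of \<rho>AB (enc b k) (enc b l))"
    unfolding A_def B_def by (rule dec_reindex[OF enc_bij state_eigval(1)[OF sAB]]) simp
  define e1 where "e1 = (\<lambda>k. lift (A \<times> B) (tensor WA WB) (\<lambda>q. eigvec (a * b) \<rho>AB k (enc b q)))"
  have d1: "has_dec (X \<times> T) {..<a * b} e1 (eigval (a * b) \<rho>AB) (trace_last Z R)"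
    unfolding e1_def RAB by (rule dec_lift[OF finP(2) orthonormal_tensor[OF oA oB] d1'])
  have d2': "has_dec (B \<times> C) {..<b * c} (\<lambda>k q. eigvec (b * c) \<rho>BC k (enc c q)) (eigval (b * c) \<rho>BC)
      (\<lambda>k l. kernel_of \<rho>BC (enc c k) (enc c l))"
    unfolding B_def C_def by (rule dec_reindex[OF enc_bij state_eigval(1)[OF sBC]]) simp
  define e2 where "e2 = (\<lambda>k. lift (B \<times> C) (tensor WB WC) (\<lambda>q. eigvec (b * c) \<rho>BC k (enc c q)))"
  have d2: "has_dec (T \<times> Z) {..<b * c} e2 (eigval (b * c) \<rho>BC) (ptrace_fst X R)"
    unfolding e2_def RBC by (rule dec_lift[OF finP(3) orthonormal_tensor[OF oB oC] d2'])
  have d3': "has_dec B {..<b} (eigvec b \<rho>B) (eigval b \<rho>B) (kernel_of \<rho>B)"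
    unfolding B_def by (rule state_eigval(1)[OF sB])
  define e3 where "e3 = (\<lambda>k. lift B WB (eigvec b \<rho>B k))"
  have d3: "has_dec T {..<b} e3 (eigval b \<rho>B) (ptrace_fst X (trace_last Z R))"
    unfolding e3_def RB by (rule dec_lift[OF fin(2) oB d3'])

  have s\<sigma>: "is_state (a' * Ld j) (\<sigma> j)" "is_state (Ld j) (ptrace_left a' (Ld j) (\<sigma> j))"
    and s\<tau>: "is_state (Rd j * c') (\<tau> j)" "is_state (Rd j) (ptrace_right (Rd j) c' (\<tau> j))" if "j < N" for j
    using \<sigma>\<tau> that by (auto intro: state_ptrace_left state_ptrace_right)
  define u where "u = (\<lambda>j k q. eigvec (a' * Ld j) (\<sigma> j) k (enc (Ld j) q))"
  define v where "v = (\<lambda>j k q. eigvec (Rd j * c') (\<tau> j) k (enc c' q))"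
  define u' where "u' = (\<lambda>j. eigvec (Ld j) (ptrace_left a' (Ld j) (\<sigma> j)))"
  define v' where "v' = (\<lambda>j. eigvec (Rd j) (ptrace_right (Rd j) c' (\<tau> j)))"
  have u: "has_dec (X \<times> {..<Ld j}) {..<a' * Ld j} (u j) (eigval (a' * Ld j) (\<sigma> j)) (\<sigma>k j)"
    "orthonormal_basis (X \<times> {..<Ld j}) {..<a' * Ld j} (u j)" if "j < N" for j
  proof -
    show "has_dec (X \<times> {..<Ld j}) {..<a' * Ld j} (u j) (eigval (a' * Ld j) (\<sigma> j)) (\<sigma>k j)"
      unfolding X_def u_def by (rule dec_reindex[OF enc_bij state_eigval(1)[OF s\<sigma>(1)[OF that]]]) (simp add: \<sigma>k_def)
    show "orthonormal_basis (X \<times> {..<Ld j}) {..<a' * Ld j} (u j)"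
      unfolding X_def u_def by (rule orthonormal_basis_reindex[OF enc_bij state_eigval(2)[OF s\<sigma>(1)[OF that]]])
  qed
  have v: "has_dec ({..<Rd j} \<times> Z) {..<Rd j * c'} (v j) (eigval (Rd j * c') (\<tau> j)) (\<tau>k j)"
    "orthonormal_basis ({..<Rd j} \<times> Z) {..<Rd j * c'} (v j)" if "j < N" for j
  proof -
    show "has_dec ({..<Rd j} \<times> Z) {..<Rd j * c'} (v j) (eigval (Rd j * c') (\<tau> j)) (\<tau>k j)"
      unfolding Z_def v_def by (rule dec_reindex[OF enc_bij state_eigval(1)[OF s\<tau>(1)[OF that]]]) (simp add: \<tau>k_def)
    show "orthonormal_basis ({..<Rd j} \<times> Z) {..<Rd j * c'} (v j)"
      unfolding Z_def v_def by (rule orthonormal_basis_reindex[OF enc_bij state_eigval(2)[OF s\<tau>(1)[OF that]]])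
  qed
  have u': "has_dec {..<Ld j} {..<Ld j} (u' j) (eigval (Ld j) (ptrace_left a' (Ld j) (\<sigma> j))) (ptrace_fst X (\<sigma>k j))"
    "orthonormal_basis {..<Ld j} {..<Ld j} (u' j)" if "j < N" for j
  proof -
    show "has_dec {..<Ld j} {..<Ld j} (u' j) (eigval (Ld j) (ptrace_left a' (Ld j) (\<sigma> j))) (ptrace_fst X (\<sigma>k j))"
      unfolding u'_def
      by (rule has_dec_cong[OF state_eigval(1)[OF s\<sigma>(2)[OF that]]]) (simp add: kernel_of_ptrace_left X_def \<sigma>k_def)
    show "orthonormal_basis {..<Ld j} {..<Ld j} (u' j)" unfolding u'_def by (rule state_eigval(2)[OF s\<sigma>(2)[OF that]])
  qed
  have v': "has_dec {..<Rd j} {..<Rd j} (v' j) (eigval (Rd j) (ptrace_right (Rd j) c' (\<tau> j))) (ptrace_snd Z (\<tau>k j))"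
    "orthonormal_basis {..<Rd j} {..<Rd j} (v' j)" if "j < N" for j
  proof -
    show "has_dec {..<Rd j} {..<Rd j} (v' j) (eigval (Rd j) (ptrace_right (Rd j) c' (\<tau> j))) (ptrace_snd Z (\<tau>k j))"
      unfolding v'_def
      by (rule has_dec_cong[OF state_eigval(1)[OF s\<tau>(2)[OF that]]]) (simp add: kernel_of_ptrace_right Z_def \<tau>k_def)
    show "orthonormal_basis {..<Rd j} {..<Rd j} (v' j)" unfolding v'_def by (rule state_eigval(2)[OF s\<tau>(2)[OF that]])
  qed

  \<comment> \<open>The images under V of the eigenvectors of \<rho> decompose
    \<open>\<rho>'\<close> but need not span the larger space; \<open>vN_entropy_dec\<close> admits
    such families.\<close>
  have vN': "vN_entropy \<rho>' = vN_entropy \<rho>"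
  proof -
    have "has_dec {..<n} {..<a * b * c} (\<lambda>k. lift {..<a * b * c} Wv (eigvec (a * b * c) \<rho> k)) (eigval (a * b * c) \<rho>) (kernel_of \<rho>')"
      by (rule has_dec_cong[OF dec_lift[OF finite_lessThan ov state_eigval(1)[OF \<rho>]]]) (simp add: \<rho>'k)
    from vN_entropy_dec[OF \<rho>'c \<rho>'h finite_lessThan this] show ?thesis
      by (simp add: vN_entropy_eigval[OF \<rho>c])
  qed

  show ?thesis
    unfolding V_def[symmetric] \<rho>'_def[symmetric]
  proof (rule rel_entropy_ge[OF \<mu>c \<mu>h \<rho>'c])
    assume zero: "\<And>j. j < n \<Longrightarrow> eigval n \<mu> j = 0 \<Longrightarrow> Re (quad {..<n} (kernel_of \<rho>') (eigvec n \<mu> j)) = 0"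
    have z: "quad (X \<times> T \<times> Z) R (f j) = 0" if "j \<in> {..<n}" "eigval n \<mu> j = 0" for j
    proof -
      have "Re (quad (X \<times> T \<times> Z) R (f j)) = 0" unfolding fq using zero that by simp
      \<comment> \<open>A kernel with real eigenvalues has a real quadratic form, so its real part
        decides.\<close>
      then show ?thesis unfolding dec_quad[OF d0] by (simp only: Re_complex_of_real of_real_0)
    qed
    have "(\<Sum>j<n. ln (eigval n \<mu> j) * Re (quad (X \<times> T \<times> Z) R (f j))) \<le>
        (\<Sum>k<a * b. eigval (a * b) \<rho>AB k * ln (eigval (a * b) \<rho>AB k)) +
        (\<Sum>k<b * c. eigval (b * c) \<rho>BC k * ln (eigval (b * c) \<rho>BC k)) -
        (\<Sum>k<b. eigval b \<rho>B k * ln (eigval b \<rho>B k))"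
    proof (rule markov_core[of X Z N "\<lambda>j. {..<Ld j}" "\<lambda>j. {..<Rd j}" "{..<a * b * c}" _ _ _ _
          "\<lambda>j. {..<a' * Ld j}" "\<lambda>j. {..<Rd j * c'}" "\<lambda>j. {..<Ld j}" "\<lambda>j. {..<Rd j}", folded T_def])
      show "finite X" "finite Z" by (rule fin)+
      show "has_dec (X \<times> T \<times> Z) {..<a * b * c} e0 (eigval (a * b * c) \<rho>) R" by (rule d0)
      show "has_dec (X \<times> T) {..<a * b} e1 (eigval (a * b) \<rho>AB) (trace_last Z R)" by (rule d1)
      show "has_dec (T \<times> Z) {..<b * c} e2 (eigval (b * c) \<rho>BC) (ptrace_fst X R)" by (rule d2)
      show "has_dec T {..<b} e3 (eigval b \<rho>B) (ptrace_fst X (trace_last Z R))" by (rule d3)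
      show "(\<Sum>j<n. eigval n \<mu> j) = (\<Sum>k<a * b * c. eigval (a * b * c) \<rho> k)"
        using state_eigval(4)[OF \<mu>n] state_eigval(4)[OF \<rho>] by simp
      show "eigval n \<mu> j \<ge> 0" if "j \<in> {..<n}" for j using state_eigval(3)[OF \<mu>n] that by simp
      show "eigval (a * b * c) \<rho> j \<ge> 0" if "j \<in> {..<a * b * c}" for j using state_eigval(3)[OF \<rho>] that by simp
      show "eigval (a * b) \<rho>AB j \<ge> 0" if "j \<in> {..<a * b}" for j using state_eigval(3)[OF sAB] that by simp
      show "eigval (b * c) \<rho>BC j \<ge> 0" if "j \<in> {..<b * c}" for j using state_eigval(3)[OF sBC] that by simp
      show "eigval b \<rho>B j \<ge> 0" if "j \<in> {..<b}" for j using state_eigval(3)[OF sB] that by simp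
      show "eigval (a' * Ld j) (\<sigma> j) k \<ge> 0" if "j < N" "k \<in> {..<a' * Ld j}" for j k
        using state_eigval(3)[OF s\<sigma>(1)] that by simp
      show "eigval (Rd j * c') (\<tau> j) k \<ge> 0" if "j < N" "k \<in> {..<Rd j * c'}" for j k
        using state_eigval(3)[OF s\<tau>(1)] that by simp
      show "eigval (Ld j) (ptrace_left a' (Ld j) (\<sigma> j)) k \<ge> 0" if "j < N" "k \<in> {..<Ld j}" for j k
        using state_eigval(3)[OF s\<sigma>(2)] that by simp
      show "eigval (Rd j) (ptrace_right (Rd j) c' (\<tau> j)) k \<ge> 0" if "j < N" "k \<in> {..<Rd j}" for j k
        using state_eigval(3)[OF s\<tau>(2)] that by simp
    qed (use u v u' v' p fd fb z in auto)
    then show "qCMI a b c \<rho> \<le> - vN_entropy \<rho>' -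
        (\<Sum>j<n. ln (eigval n \<mu> j) * Re (quad {..<n} (kernel_of \<rho>') (eigvec n \<mu> j)))"
      unfolding fq vN' qCMI_def Let_def \<rho>AB_def[symmetric] \<rho>BC_def[symmetric] \<rho>B_def[symmetric]
        state_eigval(5)[OF sAB] state_eigval(5)[OF sBC] state_eigval(5)[OF sB] by simp
  qed
qed

theorem theorem4:
  fixes a b c :: nat and \<rho> :: "complex mat"
  assumes "is_state (a*b*c) \<rho>"
  shows "Delta a b c \<rho> \<ge> ereal (qCMI a b c \<rho>)"
  unfolding Delta_def
  by (rule Inf_greatest) (use qCMI_le_rel_entropy[OF assms] in blast)


end
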